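(* Let $\Omega\subset\mathbb{C}$ be a bounded simply connected domain, $1<p<\infty$, and let $f$ be a non-vanishing complex-valued function on $\Omega$ with $\frac1f\in L_\infty(\Omega)$. If $f\in C^1(\Omega)\cap W^{1,\infty}(\Omega)$, then $\mathcal{A}_f^p(\Omega;\mathbb{B})\subset C^1(\Omega;\mathbb{B})$; that is, every weak $L_p$-solution of the main Vekua equation $\overline{\boldsymbol{\partial}}W-\frac{\overline{\boldsymbol{\partial}}f}{f}\overline{W}=0$ in $\Omega$ is a classical solution.
   Context: $\mathbb{B}=\{u+\mathbf{j}v : u,v\in\mathbb{C}\}$ is the commutative $\mathbb{C}$-algebra of bicomplex numbers, with $\mathbf{j}^2=-1$ and $i\mathbf{j}=\mathbf{j}i$. For $W=u+\mathbf{j}v$: $\operatorname{Sc}W=u$, $\operatorname{Vec}W=v$, $\overline{W}=u-\mathbf{j}v$. A function $F:\Omega\to\mathbb{B}$ belongs to $\mathscr{F}(\Omega;\mathbb{B})$ (for a space $\mathscr{F}(\Omega)$ of complex-valued functions) iff $\operatorname{Sc}F,\operatorname{Vec}F\in\mathscr{F}(\Omega)$. With $z=x+iy$, $\overline{\boldsymbol{\partial}}=\frac12\left(\frac{\partial}{\partial x}+\mathbf{j}\frac{\partial}{\partial y}\right)$. A function $V\in L_{1,loc}(\Omega;\mathbb{B})$ is the weak $\overline{\boldsymbol{\partial}}$-derivative of $W\in L_p(\Omega;\mathbb{B})$ if $\iint_\Omega W\,\overline{\boldsymbol{\partial}}\phi\,dA=-\iint_\Omega V\phi\,dA$ for all $\phi\in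 C_0^\infty(\Omega;\mathbb{B})$. $\mathcal{A}_f^p(\Omega;\mathbb{B})$ is the set of all weak solutions $W\in L_p(\Omega;\mathbb{B})$ of $\overline{\boldsymbol{\partial}}W=\frac{\overline{\boldsymbol{\partial}}f}{f}\,\overline{W}$ in $\Omega$. The inclusion in $C^1$ is understood up to modification on a null set. *)

theory Defs
  imports "HOL-Analysis.Analysis"
begin

section \<open>Bicomplex numbers\<close>

datatype bicomplex = BC (Sc: complex) (Vec: complex)

lemma bicomplex_eq_iff: "W = Z \<longleftrightarrow> Sc W = Sc Z \<and> Vec W = Vec Z"
  by (cases W; cases Z) auto

instantiation bicomplex :: comm_ring_1
begin

definition "0 = BC 0 0"
definition "1 = BC 1 0"
definition "W + Z = BC (Sc W + Sc Z) (Vec W + Vec Z)"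
definition "W - Z = BC (Sc W - Sc Z) (Vec W - Vec Z)"
definition "- W = BC (- Sc W) (- Vec W)"
definition "W * Z = BC (Sc W * Sc Z - Vec W * Vec Z) (Sc W * Vec Z + Vec W * Sc Z)"

instance
  by standard
    (auto simp: bicomplex_eq_iff zero_bicomplex_def one_bicomplex_def plus_bicomplex_def
      minus_bicomplex_def uminus_bicomplex_def times_bicomplex_def algebra_simps)

end

lemmas bicomplex_ring_defs =
  zero_bicomplex_def one_bicomplex_def plus_bicomplex_def minus_bicomplex_def
  uminus_bicomplex_def times_bicomplex_def

text \<open>The ring has zero divisors; \<open>inverse W\<close> is the multiplicative inverse exactly when
  \<open>(Sc W)\<^sup>2 + (Vec W)\<^sup>2 \<noteq> 0\<close>, and \<open>0\<close> by convention otherwise.\<close>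

instantiation bicomplex :: inverse
begin

definition inverse_bicomplex :: "bicomplex \<Rightarrow> bicomplex" where
  "inverse W = BC (Sc W / ((Sc W)\<^sup>2 + (Vec W)\<^sup>2)) (- Vec W / ((Sc W)\<^sup>2 + (Vec W)\<^sup>2))"

definition divide_bicomplex :: "bicomplex \<Rightarrow> bicomplex \<Rightarrow> bicomplex" where
  "divide_bicomplex W Z = W * inverse Z"

instance ..

end

definition bc_of_complex :: "complex \<Rightarrow> bicomplex" where
  "bc_of_complex u = BC u 0"

definition bc_j :: bicomplex where
  "bc_j = BC 0 1"

definition bc_cnj :: "bicomplex \<Rightarrow> bicomplex" where
  "bc_cnj W = BC (Sc W) (- Vec W)"

lemma bicomplex_decomp: "W = bc_of_complex (Sc W) + bc_j * bc_of_complex (Vec W)"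
  by (simp add: bicomplex_eq_iff bicomplex_ring_defs bc_of_complex_def bc_j_def)

lemma bc_j_squared: "bc_j * bc_j = -1"
  by (simp add: bicomplex_eq_iff bicomplex_ring_defs bc_j_def)

lemma bicomplex_mult_inverse:
  assumes "(Sc W)\<^sup>2 + (Vec W)\<^sup>2 \<noteq> 0"
  shows "W * inverse W = 1"
  using assms
  by (simp add: bicomplex_eq_iff bicomplex_ring_defs inverse_bicomplex_def
      add_divide_distrib[symmetric] power2_eq_square[symmetric])

lemma bc_divide_of_complex: "W / bc_of_complex u = BC (Sc W / u) (Vec W / u)"
  by (simp add: bicomplex_eq_iff bicomplex_ring_defs inverse_bicomplex_def divide_bicomplex_def
      bc_of_complex_def power2_eq_square)


section \<open>Function spaces\<close>

text \<open>Elements of the spaces below are total functions, of which only the restriction to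
  \<open>\<Omega>\<close> matters; functions equal almost everywhere are not identified.\<close>

definition Lp_space :: "real \<Rightarrow> complex set \<Rightarrow> (complex \<Rightarrow> complex) set" where
  "Lp_space p \<Omega> = {g \<in> borel_measurable (lebesgue_on \<Omega>).
     integrable (lebesgue_on \<Omega>) (\<lambda>z. norm (g z) powr p)}"

definition Linf_space :: "complex set \<Rightarrow> (complex \<Rightarrow> complex) set" where
  "Linf_space \<Omega> = {g \<in> borel_measurable (lebesgue_on \<Omega>).
     \<exists>C. AE z in lebesgue_on \<Omega>. norm (g z) \<le> C}"

definition L1loc_space :: "complex set \<Rightarrow> (complex \<Rightarrow> complex) set" where
  "L1loc_space \<Omega> = {g \<in> borel_measurable (lebesgue_on \<Omega>).
     \<forall>K. compact K \<and> K \<subseteq> \<Omega> \<longrightarrow> integrable (lebesgue_on K) g}"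

text \<open>\<open>dir_deriv 1\<close> and \<open>dir_deriv \<i>\<close> are \<open>\<partial>/\<partial>x\<close> and \<open>\<partial>/\<partial>y\<close> at points of (real)
  differentiability.\<close>

definition dir_deriv :: "complex \<Rightarrow> (complex \<Rightarrow> complex) \<Rightarrow> complex \<Rightarrow> complex" where
  "dir_deriv e g z = frechet_derivative g (at z) e"

text \<open>\<open>Ck_space k \<Omega>\<close> is meant for open \<open>\<Omega>\<close>. Differentiability is in the real sense.\<close>

primrec Ck_space :: "nat \<Rightarrow> complex set \<Rightarrow> (complex \<Rightarrow> complex) set" where
  "Ck_space 0 \<Omega> = {g. continuous_on \<Omega> g}"
| "Ck_space (Suc k) \<Omega> = {g. (\<forall>z\<in>\<Omega>. g differentiable (at z)) \<and>
     dir_deriv 1 g \<in> Ck_space k \<Omega> \<and> dir_deriv \<i> g \<in> Ck_space k \<Omega>}"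

text \<open>Test functions are extended by zero to the whole plane.\<close>

definition test_space :: "complex set \<Rightarrow> (complex \<Rightarrow> complex) set" where
  "test_space \<Omega> = {\<phi>. (\<forall>k. \<phi> \<in> Ck_space k UNIV) \<and>
     compact (closure {z. \<phi> z \<noteq> 0}) \<and> closure {z. \<phi> z \<noteq> 0} \<subseteq> \<Omega>}"

definition weak_dir_deriv ::
    "complex set \<Rightarrow> complex \<Rightarrow> (complex \<Rightarrow> complex) \<Rightarrow> (complex \<Rightarrow> complex) \<Rightarrow> bool" where
  "weak_dir_deriv \<Omega> e g h \<longleftrightarrow> g \<in> L1loc_space \<Omega> \<and> h \<in> L1loc_space \<Omega> \<and>
     (\<forall>\<phi>\<in>test_space \<Omega>. (LINT z|lebesgue_on \<Omega>. g z * dir_deriv e \<phi> z) =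
                       - (LINT z|lebesgue_on \<Omega>. h z * \<phi> z))"

definition W1inf_space :: "complex set \<Rightarrow> (complex \<Rightarrow> complex) set" where
  "W1inf_space \<Omega> = {g \<in> Linf_space \<Omega>.
     (\<exists>h\<in>Linf_space \<Omega>. weak_dir_deriv \<Omega> 1 g h) \<and> (\<exists>h\<in>Linf_space \<Omega>. weak_dir_deriv \<Omega> \<i> g h)}"

definition bc_space :: "(complex \<Rightarrow> complex) set \<Rightarrow> (complex \<Rightarrow> bicomplex) set" where
  "bc_space S = {F. (\<lambda>z. Sc (F z)) \<in> S \<and> (\<lambda>z. Vec (F z)) \<in> S}"


section \<open>The main Vekua equation\<close>

definition bc_integral :: "complex set \<Rightarrow> (complex \<Rightarrow> bicomplex) \<Rightarrow> bicomplex" where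
  "bc_integral \<Omega> F =
     BC (LINT z|lebesgue_on \<Omega>. Sc (F z)) (LINT z|lebesgue_on \<Omega>. Vec (F z))"

definition bc_dir_deriv :: "complex \<Rightarrow> (complex \<Rightarrow> bicomplex) \<Rightarrow> complex \<Rightarrow> bicomplex" where
  "bc_dir_deriv e F z = BC (dir_deriv e (\<lambda>w. Sc (F w)) z) (dir_deriv e (\<lambda>w. Vec (F w)) z)"

definition bc_dbar :: "(complex \<Rightarrow> bicomplex) \<Rightarrow> complex \<Rightarrow> bicomplex" where
  "bc_dbar F z = bc_of_complex (1/2) * (bc_dir_deriv 1 F z + bc_j * bc_dir_deriv \<i> F z)"

definition weak_dbar :: "complex set \<Rightarrow> (complex \<Rightarrow> bicomplex) \<Rightarrow> (complex \<Rightarrow> bicomplex) \<Rightarrow> bool" where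
  "weak_dbar \<Omega> W V \<longleftrightarrow> V \<in> bc_space (L1loc_space \<Omega>) \<and>
     (\<forall>\<phi>\<in>bc_space (test_space \<Omega>).
        bc_integral \<Omega> (\<lambda>z. W z * bc_dbar \<phi> z) = - bc_integral \<Omega> (\<lambda>z. V z * \<phi> z))"

text \<open>The coefficient uses the classical derivative of \<open>f\<close>, so this is meant for
  continuously differentiable, non-vanishing \<open>f\<close>.\<close>

definition vekua_coeff :: "(complex \<Rightarrow> complex) \<Rightarrow> complex \<Rightarrow> bicomplex" where
  "vekua_coeff f z = bc_dbar (\<lambda>w. bc_of_complex (f w)) z / bc_of_complex (f z)"

definition vekua_space ::
    "real \<Rightarrow> (complex \<Rightarrow> complex) \<Rightarrow> complex set \<Rightarrow> (complex \<Rightarrow> bicomplex) set" where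
  "vekua_space p f \<Omega> = {W \<in> bc_space (Lp_space p \<Omega>).
     weak_dbar \<Omega> W (\<lambda>z. vekua_coeff f z * bc_cnj (W z))}"

end

theory Submission
  imports Defs
begin

text \<open>
  Substituting \<open>\<^bold>j \<mapsto> \<plusminus> \<i>\<close> turns the Vekua equation into a system
  \<open>dbar A = a * cnj B\<close>, \<open>dbar B = b * cnj A\<close> with merely continuous coefficients
  \<open>a = dbar f / f\<close>, \<open>b = dbar (cnj f) / cnj f\<close>. Locally, \<open>A\<close> and \<open>B\<close> are Cauchy transforms
  of integrable functions dominated by \<open>\<bar>A\<bar> + \<bar>B\<bar>\<close>; three iterations make the kernel bounded, so the
  solutions are locally bounded and hence, applying the transform once more, Hoelder continuous.
  For general continuous coefficients \<open>C\<^sup>1\<close> regularity can fail. Here, however, \<open>c1 * f + \<^bold>j * c2 / f\<close>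
  is a \<open>C\<^sup>1\<close> solution for all complex constants \<open>c1\<close>, \<open>c2\<close>. Subtracting the one that
  agrees with the given solution at \<open>x\<close> leaves the Cauchy transform of a function of size
  \<open>O(\<bar>y - x\<bar>\<^sup>1\<^sup>/\<^sup>2)\<close>; such a transform is complex differentiable at \<open>x\<close>, with a derivative given by
  an absolutely convergent integral that depends continuously on \<open>x\<close>.
\<close>

section \<open>Smooth functions on the plane\<close>

text \<open>Why the two explicit functions are solutions: \<open>f\<close> equals its bicomplex
  conjugate, so for it the equation is a tautology; for j / f the minus sign from differentiating
  the reciprocal is the one that conjugation produces. In the components \<open>(A, cnj B)\<close>
  they read \<open>(f, f)\<close> and \<open>(\<i> / f, - \<i> / f)\<close>, with constant
  determinant \<open>- 2 * \<i>\<close>. Hence they can be fitted to any values at a point, with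
  coefficients that depend continuously on the point. The obstacle is that \<open>a * cnj B\<close>
  is no smoother than \<open>a\<close>, while the Cauchy transform of a continuous function need not
  be differentiable. After the subtraction \<open>a\<close> multiplies a difference that vanishes at
  \<open>x\<close>, and a bound on \<open>a\<close> is enough. Three rounds are used because
  composing two plane kernels of exponent 1 gives a logarithm. Giving up half an exponent avoids it,
  and the exponents run 1, 1/2, 0. The Hoelder exponent 1/2 is a convenient choice in (0, 1): the
  composite exponents 3/2 and 7/4 stay below 2, the threshold of local integrability in the plane.
  All estimates thus rest on elementary power kernels rather than on singular integrals.\<close>

lemma dir_deriv_has_derivative:
  "(g has_derivative g') (at z) \<Longrightarrow> dir_deriv e g z = g' e"
  unfolding dir_deriv_def using frechet_derivative_at by metis

lemma Ck_Suc_iff: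
  "g \<in> Ck_space (Suc k) \<Omega> \<longleftrightarrow> (\<forall>z\<in>\<Omega>. g differentiable (at z)) \<and>
     dir_deriv 1 g \<in> Ck_space k \<Omega> \<and> dir_deriv \<i> g \<in> Ck_space k \<Omega>"
  by simp

declare Ck_space.simps(2) [simp del]

lemma Ck_UNIV_SucI:
  assumes "\<And>z. (g has_derivative g' z) (at z)"
    and "(\<lambda>z. g' z 1) \<in> Ck_space k UNIV" "(\<lambda>z. g' z \<i>) \<in> Ck_space k UNIV"
  shows "g \<in> Ck_space (Suc k) UNIV"
proof -
  have "dir_deriv e g = (\<lambda>z. g' z e)" for e
    using dir_deriv_has_derivative[OF assms(1)] by blast
  then show ?thesis
    using assms by (auto simp: differentiable_def Ck_Suc_iff)
qed

text \<open>Expressing the derivative through the two partials, which are themselves members of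
  \<open>Ck_space k\<close>, is what makes the closure properties below provable by induction on
  \<open>k\<close>.\<close>

lemma Ck_Suc_has_derivative:
  assumes "g \<in> Ck_space (Suc k) \<Omega>" "z \<in> \<Omega>"
  shows "(g has_derivative (\<lambda>v. of_real (Re v) * dir_deriv 1 g z + of_real (Im v) * dir_deriv \<i> g z)) (at z)"
proof -
  have D: "(g has_derivative frechet_derivative g (at z)) (at z)"
    using assms by (auto simp: frechet_derivative_works Ck_Suc_iff)
  then interpret bounded_linear "frechet_derivative g (at z)"
    by (rule has_derivative_bounded_linear)
  have "frechet_derivative g (at z) v =
      of_real (Re v) * dir_deriv 1 g z + of_real (Im v) * dir_deriv \<i> g z" for v
  proof -
    have "v = Re v *\<^sub>R 1 + Im v *\<^sub>R \<i>"
      by (simp add: complex_eq_iff)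
    then have "frechet_derivative g (at z) v = frechet_derivative g (at z) (Re v *\<^sub>R 1 + Im v *\<^sub>R \<i>)"
      by simp
    also have "\<dots> = Re v *\<^sub>R dir_deriv 1 g z + Im v *\<^sub>R dir_deriv \<i> g z"
      by (simp only: add scaleR dir_deriv_def)
    finally show ?thesis
      by (simp only: scaleR_conv_of_real)
  qed
  then have "frechet_derivative g (at z) =
      (\<lambda>v. of_real (Re v) * dir_deriv 1 g z + of_real (Im v) * dir_deriv \<i> g z)"
    by blast
  with D show ?thesis by simp
qed

lemma Ck_space_SucD: "g \<in> Ck_space (Suc k) \<Omega> \<Longrightarrow> g \<in> Ck_space k \<Omega>"
proof (induction k arbitrary: g)
  case 0
  then have "\<And>z. z \<in> \<Omega> \<Longrightarrow> isCont g z"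
    by (auto simp: Ck_Suc_iff intro: differentiable_imp_continuous_within)
  then show ?case
    by (auto intro: continuous_at_imp_continuous_on)
next
  case (Suc k)
  show ?case
    using Ck_Suc_iff[of g "Suc k"] Ck_Suc_iff[of g k] Suc by blast
qed

lemma Ck_space_dir_deriv:
  "g \<in> Ck_space (Suc k) \<Omega> \<Longrightarrow> dir_deriv 1 g \<in> Ck_space k \<Omega>"
  "g \<in> Ck_space (Suc k) \<Omega> \<Longrightarrow> dir_deriv \<i> g \<in> Ck_space k \<Omega>"
  by (auto simp: Ck_Suc_iff)

lemma Ck_add:
  assumes "g \<in> Ck_space k UNIV" "h \<in> Ck_space k UNIV"
  shows "(\<lambda>z. g z + h z) \<in> Ck_space k UNIV"
  using assms
proof (induction k arbitrary: g h)
  case 0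
  then show ?case by (auto intro!: continuous_intros)
next
  case (Suc k)
  show ?case
    by (rule Ck_UNIV_SucI[OF has_derivative_add[OF Ck_Suc_has_derivative[OF Suc.prems(1)] Ck_Suc_has_derivative[OF Suc.prems(2)]]])
      (use Suc.IH Suc.prems in \<open>simp_all add: Ck_Suc_iff\<close>)
qed

lemma Ck_mult:
  assumes "g \<in> Ck_space k UNIV" "h \<in> Ck_space k UNIV"
  shows "(\<lambda>z. g z * h z) \<in> Ck_space k UNIV"
  using assms
proof (induction k arbitrary: g h)
  case 0
  then show ?case by (auto intro!: continuous_intros)
next
  case (Suc k)
  note gh = Suc.prems[THEN Ck_space_SucD]
  show ?case
    by (rule Ck_UNIV_SucI[OF has_derivative_mult[OF Ck_Suc_has_derivative[OF Suc.prems(1)] Ck_Suc_has_derivative[OF Suc.prems(2)]]])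
      (use Suc.prems gh in \<open>simp_all add: Ck_Suc_iff Ck_add Suc.IH\<close>)
qed

lemma Ck_const: "(\<lambda>z. c) \<in> Ck_space k UNIV"
proof (induction k arbitrary: c)
  case (Suc k)
  show ?case
    by (rule Ck_UNIV_SucI[where g' = "\<lambda>_ _. 0"]) (use Suc in auto)
qed auto

lemma Ck_bounded_linear:
  assumes "bounded_linear L"
  shows "L \<in> Ck_space k UNIV"
proof (cases k)
  case 0
  then show ?thesis
    using assms by (auto intro: linear_continuous_on)
next
  case (Suc n)
  then show ?thesis
    using Ck_UNIV_SucI[OF bounded_linear_imp_has_derivative[OF assms]] Ck_const by auto
qed

lemma Ck_inverse:
  assumes "g \<in> Ck_space k UNIV" "\<And>z. g z \<noteq> 0"
  shows "(\<lambda>z. inverse (g z)) \<in> Ck_space k UNIV"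
  using assms
proof (induction k arbitrary: g)
  case 0
  then show ?case by (auto intro!: continuous_intros)
next
  case (Suc k)
  have i: "(\<lambda>z. inverse (g z)) \<in> Ck_space k UNIV"
    using Suc Ck_space_SucD by blast
  have D: "((\<lambda>z. inverse (g z)) has_derivative
      (\<lambda>v. (-1) * (inverse (g z) * (of_real (Re v) * dir_deriv 1 g z + of_real (Im v) * dir_deriv \<i> g z) * inverse (g z)))) (at z)" for z
    using Deriv.has_derivative_inverse[OF Suc.prems(2) Ck_Suc_has_derivative[OF Suc.prems(1) UNIV_I]]
    by simp
  have "dir_deriv 1 g \<in> Ck_space k UNIV" "dir_deriv \<i> g \<in> Ck_space k UNIV"
    using Suc.prems by (auto simp: Ck_Suc_iff)
  then show ?case
    by (intro Ck_UNIV_SucI[OF D] Ck_mult Ck_const i) simp_all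
qed

section \<open>Smooth bump functions with compact support\<close>

text \<open>The factor \<open>(1 / t) ^ n\<close> makes the family closed under differentiation, up
  to linear combinations. Smoothness of \<open>exp (- (1 / t))\<close>, extended by 0, then follows
  from one induction over the order with \<open>n\<close> arbitrary.\<close>

definition bump_profile :: "nat \<Rightarrow> real \<Rightarrow> real" where
  "bump_profile n t = (if t > 0 then exp (- (1 / t)) * (1 / t) ^ n else 0)"

lemma bump_profile_bound: "\<bar>bump_profile n t\<bar> \<le> fact (n + 2) * t\<^sup>2"
proof (cases "t > 0")
  case True
  define s where "s = 1 / t"
  have s: "s > 0" "t = 1 / s" using True by (auto simp: s_def)
  have "s ^ (n + 2) / fact (n + 2) \<le> exp s"
  proof -
    have "(\<lambda>k. s ^ k /\<^sub>R fact k) sums exp s" by (rule exp_converges)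
    from sum_le_suminf[OF sums_summable[OF this], of "{n + 2}"] sums_unique[OF this] s
    show ?thesis by (simp add: divide_inverse mult.commute)
  qed
  then have "s ^ (n + 2) \<le> fact (n + 2) * exp s"
    by (simp add: pos_divide_le_eq mult.commute del: fact_Suc add_2_eq_Suc')
  then have "s ^ n * s\<^sup>2 / (exp s * s\<^sup>2) \<le> fact (n + 2) * exp s / (exp s * s\<^sup>2)"
    using s by (intro divide_right_mono) (simp_all add: power_add del: fact_Suc add_2_eq_Suc')
  then have "exp (- s) * s ^ n \<le> fact (n + 2) * (1 / s)\<^sup>2"
    using s by (simp add: exp_minus power_one_over del: fact_Suc add_2_eq_Suc') (simp add: divide_inverse mult_ac del: fact_Suc add_2_eq_Suc')
  then show ?thesis
    using True s by (simp add: bump_profile_def)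
qed (simp add: bump_profile_def)

lemma bump_profile_deriv:
  "(bump_profile n has_real_derivative bump_profile (n + 2) t - real n * bump_profile (n + 1) t) (at t)"
proof -
  consider "t > 0" | "t < 0" | "t = 0" by linarith
  then show ?thesis
  proof cases
    case 1
    have "((\<lambda>t. exp (- (1 / t)) * (1 / t) ^ n) has_real_derivative
        exp (- (1 / t)) * (1 / t) ^ (n + 2) - real n * (exp (- (1 / t)) * (1 / t) ^ (n + 1))) (at t)"
      using 1 by (auto intro!: derivative_eq_intros simp: power2_eq_square divide_inverse algebra_simps)
        (cases n; simp add: algebra_simps)+
    moreover have "\<forall>\<^sub>F s in nhds t. bump_profile n s = exp (- (1 / s)) * (1 / s) ^ n"
      using eventually_nhds_in_open[of "{0<..}" t] 1
      by (auto simp: bump_profile_def elim!: eventually_mono)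
    ultimately show ?thesis
      using 1 by (simp add: bump_profile_def DERIV_cong_ev[OF refl _ refl])
  next
    case 2
    have "\<forall>\<^sub>F s in nhds t. bump_profile n s = 0"
      using eventually_nhds_in_open[of "{..<0}" t] 2
      by (auto simp: bump_profile_def elim!: eventually_mono)
    moreover have "((\<lambda>s. 0) has_real_derivative 0) (at t)" by simp
    ultimately show ?thesis
      using 2 DERIV_cong_ev[of t t "bump_profile n" "\<lambda>_. 0" 0 0] by (simp add: bump_profile_def)
  next
    case 3
    have "((\<lambda>h. bump_profile n h / h) \<longlongrightarrow> 0) (at 0)"
    proof (rule Lim_null_comparison)
      show "\<forall>\<^sub>F h in at 0. norm (bump_profile n h / h) \<le> fact (n + 2) * \<bar>h\<bar>"
      proof (rule always_eventually, rule allI)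
        fix h :: real
        show "norm (bump_profile n h / h) \<le> fact (n + 2) * \<bar>h\<bar>"
          using bump_profile_bound[of n h]
          by (cases "h = 0") (simp_all add: pos_divide_le_eq mult.assoc power2_eq_square
              del: fact_Suc add_2_eq_Suc')
      qed
      show "((\<lambda>h. fact (n + 2) * \<bar>h\<bar>) \<longlongrightarrow> (0::real)) (at 0)"
        by (auto intro!: tendsto_eq_intros)
    qed
    then show ?thesis
      using 3 by (simp add: DERIV_def bump_profile_def)
  qed
qed

text \<open>The squared distance, unlike the distance, is smooth at \<open>x0\<close> too.\<close>

definition bump :: "complex \<Rightarrow> real \<Rightarrow> complex \<Rightarrow> complex" where
  "bump x0 \<rho> z = of_real (bump_profile 0 (\<rho>\<^sup>2 - (norm (z - x0))\<^sup>2))"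

lemma bump_profile_radial_smooth:
  "(\<lambda>z. of_real (bump_profile n (\<rho>\<^sup>2 - (norm (z - x0))\<^sup>2))) \<in> Ck_space k UNIV"
proof (induction k arbitrary: n)
  case 0
  have "continuous_on UNIV (bump_profile n)"
    by (rule DERIV_continuous_on[OF DERIV_subset[OF bump_profile_deriv subset_UNIV]])
  then have "continuous_on UNIV (\<lambda>z. bump_profile n (\<rho>\<^sup>2 - (norm (z - x0))\<^sup>2))"
    by (rule continuous_on_compose2) (auto intro!: continuous_intros)
  then show ?case
    by (simp add: continuous_on_of_real)
next
  case (Suc k)
  have D: "((\<lambda>z. of_real (bump_profile n (\<rho>\<^sup>2 - (norm (z - x0))\<^sup>2))) has_derivative
      (\<lambda>v. (of_real (bump_profile (n + 2) (\<rho>\<^sup>2 - (norm (z - x0))\<^sup>2))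
        + of_real (- real n) * of_real (bump_profile (n + 1) (\<rho>\<^sup>2 - (norm (z - x0))\<^sup>2)))
        * (of_real (- 2 * (z \<bullet> v)) + of_real (2 * (x0 \<bullet> v)) :: complex))) (at z)" for z
  proof -
    have 1: "((\<lambda>z. \<rho>\<^sup>2 - (norm (z - x0))\<^sup>2) has_derivative (\<lambda>v. - 2 * (z \<bullet> v) + 2 * (x0 \<bullet> v))) (at z)"
      unfolding power2_norm_eq_inner
      by (auto intro!: derivative_eq_intros simp: inner_diff_left inner_diff_right inner_commute)
    show ?thesis
      by (rule has_derivative_eq_rhs[OF has_derivative_of_real[OF has_derivative_compose[OF 1
                bump_profile_deriv[unfolded has_field_derivative_def]]]])
        (simp add: fun_eq_iff)
  qed
  have L: "(\<lambda>z. of_real (- 2 * (z \<bullet> v)) + of_real (2 * (x0 \<bullet> v)) :: complex) \<in> Ck_space k UNIV" for v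
  proof -
    have "bounded_linear (\<lambda>z. of_real (- 2 * (z \<bullet> v)) :: complex)"
      by (intro bounded_linear_compose[OF bounded_linear_of_real]
          bounded_linear_const_mult bounded_linear_inner_left)
    then show ?thesis by (intro Ck_add Ck_const Ck_bounded_linear)
  qed
  show ?case
    by (rule Ck_UNIV_SucI[OF D]) (intro Ck_mult Ck_add Ck_const Suc.IH L)+
qed

lemma bump_smooth: "bump x0 \<rho> \<in> Ck_space k UNIV"
  using bump_profile_radial_smooth[of 0 \<rho> x0 k] by (simp add: bump_def[abs_def])

lemma bump_nonzero_iff:
  assumes "\<rho> > 0"
  shows "bump x0 \<rho> z \<noteq> 0 \<longleftrightarrow> z \<in> ball x0 \<rho>"
proof -
  have "\<rho>\<^sup>2 - (norm (z - x0))\<^sup>2 > 0 \<longleftrightarrow> norm (z - x0) < \<rho>"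
    using assms by (smt (verit) norm_ge_zero power_strict_mono power2_le_imp_le zero_less_numeral)
  then show ?thesis
    by (auto simp: bump_def bump_profile_def dist_norm norm_minus_commute)
qed

text \<open>The representation formula is tested with such products, \<open>g\<close> being the
  regularised Cauchy kernel: smooth on the whole plane, but without compact support.\<close>

lemma bump_mult_test:
  assumes "\<rho> > 0" "cball x0 \<rho> \<subseteq> \<Omega>" "\<And>k. g \<in> Ck_space k UNIV"
  shows "(\<lambda>z. bump x0 \<rho> z * g z) \<in> test_space \<Omega>"
proof -
  have "closure {z. bump x0 \<rho> z * g z \<noteq> 0} \<subseteq> cball x0 \<rho>"
    using bump_nonzero_iff[OF assms(1)] by (intro closure_minimal) auto
  moreover from this have "compact (closure {z. bump x0 \<rho> z * g z \<noteq> 0})"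
    by (meson bounded_cball bounded_subset closed_closure compact_eq_bounded_closed)
  ultimately show ?thesis
    using assms by (auto simp: test_space_def intro: Ck_mult bump_smooth)
qed

subsection \<open>The complex Cauchy--Riemann operator\<close>

definition cdbar :: "(complex \<Rightarrow> complex) \<Rightarrow> complex \<Rightarrow> complex" where
  "cdbar g z = (dir_deriv 1 g z + \<i> * dir_deriv \<i> g z) / 2"

lemma cdbar_has_derivative:
  "(g has_derivative g') (at z) \<Longrightarrow> cdbar g z = (g' 1 + \<i> * g' \<i>) / 2"
  by (simp add: cdbar_def dir_deriv_has_derivative)

lemma cdbar_mult:
  assumes "g differentiable (at z)" "h differentiable (at z)"
  shows "cdbar (\<lambda>z. g z * h z) z = cdbar g z * h z + g z * cdbar h z"
proof -
  obtain g' h' where D: "(g has_derivative g') (at z)" "(h has_derivative h') (at z)"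
    using assms by (auto simp: differentiable_def)
  show ?thesis
    using cdbar_has_derivative[OF D(1)] cdbar_has_derivative[OF D(2)]
      cdbar_has_derivative[OF has_derivative_mult[OF D]]
    by (simp add: algebra_simps add_divide_distrib)
qed

lemma cdbar_smooth:
  assumes "g \<in> Ck_space (Suc k) UNIV"
  shows "cdbar g \<in> Ck_space k UNIV"
proof -
  have "cdbar g = (\<lambda>z. (1/2) * dir_deriv 1 g z + (\<i>/2) * dir_deriv \<i> g z)"
    by (auto simp: cdbar_def add_divide_distrib)
  also have "\<dots> \<in> Ck_space k UNIV"
    using assms by (intro Ck_add Ck_mult Ck_const Ck_space_dir_deriv)
  finally show ?thesis .
qed

lemma smooth_differentiable: "(\<And>k. g \<in> Ck_space k UNIV) \<Longrightarrow> g differentiable (at z)"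
  using Ck_Suc_iff[of g 0] by blast

lemma smooth_continuous: "(\<And>k. g \<in> Ck_space k UNIV) \<Longrightarrow> continuous_on UNIV g"
  using Ck_space.simps(1) by blast

lemma dir_deriv_eq_0:
  assumes "open S" "z \<in> S" "\<And>w. w \<in> S \<Longrightarrow> g w = 0"
  shows "dir_deriv e g z = 0"
proof -
  have "((\<lambda>_. 0) has_derivative (\<lambda>_. 0)) (at z)" by simp
  then have "(g has_derivative (\<lambda>_. 0)) (at z)"
    by (rule has_derivative_transform_within_open[OF _ assms(1,2)]) (simp add: assms)
  then show ?thesis by (rule dir_deriv_has_derivative)
qed

lemma cdbar_eq_0:
  assumes "open S" "z \<in> S" "\<And>w. w \<in> S \<Longrightarrow> g w = 0"
  shows "cdbar g z = 0"
  using dir_deriv_eq_0[OF assms] by (simp add: cdbar_def)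

lemma cdbar_test_space_eq_0:
  assumes "\<phi> \<in> test_space \<Omega>" "z \<notin> \<Omega>"
  shows "\<phi> z = 0" "cdbar \<phi> z = 0"
proof -
  have z: "z \<in> - closure {z. \<phi> z \<noteq> 0}"
    using assms by (auto simp: test_space_def)
  then show "cdbar \<phi> z = 0"
    by (rule cdbar_eq_0[rotated]) (use closure_subset[of "{z. \<phi> z \<noteq> 0}"] in auto)
  from z show "\<phi> z = 0" using closure_subset[of "{z. \<phi> z \<noteq> 0}"] by auto
qed

lemma cdbar_bump_eq_0:
  assumes "\<rho> > 0" "z \<notin> cball x0 \<rho>"
  shows "cdbar (bump x0 \<rho>) z = 0"
proof (rule cdbar_eq_0)
  show "bump x0 \<rho> w = 0" if "w \<in> - cball x0 \<rho>" for w
    using that bump_nonzero_iff[OF assms(1), of x0 w] by auto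
qed (use assms in auto)

lemma of_real_norm_squared: "(of_real (norm z))\<^sup>2 = z * cnj z"
  using complex_norm_square[of z] by simp

text \<open>A smooth substitute for \<open>1 / z\<close>; its \<open>cdbar\<close> is, up to sign and a constant factor,
  an approximate identity as \<open>\<epsilon>\<close> tends to \<open>0\<close>.\<close>

definition reg_kernel :: "real \<Rightarrow> complex \<Rightarrow> complex" where
  "reg_kernel \<epsilon> z = cnj z / of_real ((norm z)\<^sup>2 + \<epsilon>\<^sup>2)"

definition reg_delta :: "real \<Rightarrow> complex \<Rightarrow> real" where
  "reg_delta \<epsilon> z = \<epsilon>\<^sup>2 / ((norm z)\<^sup>2 + \<epsilon>\<^sup>2)\<^sup>2"

lemma reg_kernel_smooth:
  assumes "\<epsilon> \<noteq> 0"
  shows "(\<lambda>y. reg_kernel \<epsilon> (x - y)) \<in> Ck_space k UNIV"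
proof -
  \<comment> \<open>Writing the squared modulus as a number times its conjugate leaves sums,
    products and one inverse, for which the closure lemmas are available.\<close>
  have eq: "(\<lambda>y. reg_kernel \<epsilon> (x - y)) =
      (\<lambda>y. (cnj x + (-1) * cnj y) * inverse ((x + (-1) * y) * (cnj x + (-1) * cnj y) + of_real (\<epsilon>\<^sup>2)))"
    by (simp add: fun_eq_iff reg_kernel_def divide_inverse of_real_norm_squared)
  have nz: "(x + (-1) * y) * (cnj x + (-1) * cnj y) + of_real (\<epsilon>\<^sup>2) \<noteq> 0" for y
  proof -
    have "(x + (-1) * y) * (cnj x + (-1) * cnj y) + of_real (\<epsilon>\<^sup>2) = of_real ((norm (x - y))\<^sup>2 + \<epsilon>\<^sup>2)"
      by (simp add: of_real_norm_squared)
    also have "\<dots> \<noteq> 0"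
      unfolding of_real_eq_0_iff using assms by (smt (verit) zero_le_power2 zero_less_power2)
    finally show ?thesis .
  qed
  show ?thesis
    unfolding eq
    by (intro Ck_mult Ck_add Ck_const Ck_inverse nz Ck_bounded_linear[OF bounded_linear_cnj]
        Ck_bounded_linear[OF bounded_linear_ident])
qed

text \<open>In the quotient rule the numerator is the denominator \<open>q\<close> minus
  \<open>z * cnj z\<close>, so only \<epsilon>^2 survives. The sign comes from differentiating in
  \<open>y\<close> instead of in \<open>x - y\<close>.\<close>

lemma cdbar_reg_kernel:
  assumes "\<epsilon> \<noteq> 0"
  shows "cdbar (\<lambda>y. reg_kernel \<epsilon> (x - y)) y = - of_real (reg_delta \<epsilon> (x - y))"
proof -
  define q where "q = (x - y) * cnj (x - y) + of_real (\<epsilon>\<^sup>2)"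
  have q: "q = of_real ((norm (x - y))\<^sup>2 + \<epsilon>\<^sup>2)"
    by (simp add: q_def of_real_norm_squared)
  have q0: "q \<noteq> 0"
    unfolding q of_real_eq_0_iff using assms by (smt (verit) zero_le_power2 zero_less_power2)
  have eq: "(\<lambda>y. reg_kernel \<epsilon> (x - y)) = (\<lambda>y. cnj (x - y) / ((x - y) * cnj (x - y) + of_real (\<epsilon>\<^sup>2)))"
    by (simp add: fun_eq_iff reg_kernel_def of_real_norm_squared)
  have Dc: "((\<lambda>y. cnj (x - y)) has_derivative (\<lambda>v. - cnj v)) (at y)"
    by (auto intro!: derivative_eq_intros bounded_linear.has_derivative[OF bounded_linear_cnj])
  have Dz: "((\<lambda>y. x - y) has_derivative (\<lambda>v. - v)) (at y)"
    by (auto intro!: derivative_eq_intros)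
  have Dq: "((\<lambda>y. (x - y) * cnj (x - y) + of_real (\<epsilon>\<^sup>2)) has_derivative
      (\<lambda>v. (x - y) * (- cnj v) + (- v) * cnj (x - y) + 0)) (at y)"
    by (intro has_derivative_add has_derivative_mult Dz Dc has_derivative_const)
  define c where "c = cnj (x - y)"
  define z where "z = x - y"
  have "cdbar (\<lambda>y. reg_kernel \<epsilon> (x - y)) y =
     ((- 1 * q - c * (- z - c)) / (q * q) + \<i> * ((\<i> * q - c * (z * \<i> - \<i> * c)) / (q * q))) / 2"
    unfolding eq cdbar_has_derivative[OF has_derivative_divide'[OF Dc Dq q0[unfolded q_def]]]
    by (simp add: q_def c_def z_def)
  also have "\<dots> = - (q - z * c) / (q * q)"
    using q0 by (simp add: field_simps)
  also have "q - z * c = of_real (\<epsilon>\<^sup>2)"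
    by (simp add: q_def z_def c_def)
  finally show ?thesis
    by (simp add: q reg_delta_def power2_eq_square)
qed

lemma norm_reg_kernel_le: "norm (reg_kernel \<epsilon> z) \<le> 1 / norm z"
proof (cases "z = 0")
  case False
  have "norm (reg_kernel \<epsilon> z) = norm z / ((norm z)\<^sup>2 + \<epsilon>\<^sup>2)"
    unfolding reg_kernel_def norm_divide norm_of_real by simp
  also have "\<dots> \<le> norm z / (norm z)\<^sup>2"
    using False by (intro divide_left_mono) (auto intro!: mult_pos_pos add_pos_nonneg)
  also have "\<dots> = 1 / norm z"
    using False by (simp add: power2_eq_square)
  finally show ?thesis .
qed (simp add: reg_kernel_def)

lemma reg_kernel_tendsto:
  assumes "\<epsilon> \<longlonglongrightarrow> 0"
  shows "(\<lambda>n. reg_kernel (\<epsilon> n) z) \<longlonglongrightarrow> 1 / z"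
proof (cases "z = 0")
  case False
  have "(\<lambda>n. reg_kernel (\<epsilon> n) z) \<longlonglongrightarrow> cnj z / of_real ((norm z)\<^sup>2 + 0\<^sup>2)"
    unfolding reg_kernel_def using False
    by (intro tendsto_intros assms) simp
  also have "cnj z / of_real ((norm z)\<^sup>2 + 0\<^sup>2) = 1 / z"
    using False by (simp add: of_real_norm_squared)
  finally show ?thesis .
\<comment> \<open>At \<open>z = 0\<close> both sides are 0, since division by 0 yields 0.\<close>
qed (simp add: reg_kernel_def)

section \<open>Singular kernels\<close>

text \<open>After dividing by \<open>a + b\<close> the two fractions lie in (0, 1) and add up to 1;
  raising such a number to a power \<open>r \<le> 1\<close> does not decrease it.\<close>

lemma powr_add_le:
  assumes "0 < a" "0 < b" "0 \<le> r" "r \<le> (1::real)"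
  shows "(a + b) powr r \<le> a powr r + b powr r"
proof -
  define t where "t = a / (a + b)"
  have t: "0 < t" "t < 1" and t': "(a + b) * t = a" "(a + b) * (1 - t) = b"
    using assms by (auto simp: t_def field_simps)
  have "t powr 1 \<le> t powr r" "(1 - t) powr 1 \<le> (1 - t) powr r"
    using t assms powr_mono'[of r 1 t] powr_mono'[of r 1 "1 - t"] by auto
  then have "1 \<le> t powr r + (1 - t) powr r"
    using t by simp
  then have "(a + b) powr r * 1 \<le> (a + b) powr r * (t powr r + (1 - t) powr r)"
    by (intro mult_left_mono) auto
  also have "\<dots> = a powr r + b powr r"
    using assms t' by (simp add: distrib_left powr_mult[symmetric])
  finally show ?thesis by simp
qed

text \<open>Replacing the larger of \<open>a\<close>, \<open>b\<close> by the smaller one increases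
  the product and turns it into a single power.\<close>

lemma powr_mult_le_add:
  assumes "0 < a" "0 < b" "0 \<le> p" "0 \<le> (q::real)"
  shows "a powr - p * b powr - q \<le> a powr - (p + q) + b powr - (p + q)"
proof (cases "a \<le> b")
  case True
  then have "b powr - q \<le> a powr - q"
    using assms by (simp add: powr_mono2')
  then have "a powr - p * b powr - q \<le> a powr - p * a powr - q"
    by (intro mult_left_mono) auto
  then show ?thesis by (simp add: powr_add[symmetric] add_increasing2)
next
  case False
  then have "a powr - p \<le> b powr - p"
    using assms by (simp add: powr_mono2')
  then have "a powr - p * b powr - q \<le> b powr - p * b powr - q"
    by (intro mult_right_mono) auto
  then show ?thesis by (simp add: powr_add[symmetric] add_increasing)
qed

text \<open>The inequality behind every kernel estimate here. With \<open>a\<close>,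
  \<open>b\<close> the distances of \<open>y\<close> to two points at distance \<open>d\<close>, a
  factor \<open>d powr r\<close> buys a reduction by \<open>r\<close> of the total singularity, and
  the product of two singular factors becomes a sum with one singularity each. It yields the Hoelder
  bound, the bound on difference quotients and the composition of potentials.\<close>

lemma kernel_product_le:
  assumes "0 < a" "0 < b" "0 \<le> d" "d \<le> a + b" "0 \<le> r" "r \<le> 1" "r \<le> p" "r \<le> (q::real)"
  shows "d powr r * (a powr - p * b powr - q) \<le> 2 * (a powr - (p + q - r) + b powr - (p + q - r))"
proof -
  have "d powr r \<le> (a + b) powr r"
    using assms by (intro powr_mono2) auto
  also have "\<dots> \<le> a powr r + b powr r"
    using assms by (intro powr_add_le) auto
  finally have "d powr r * (a powr - p * b powr - q) \<le> (a powr r + b powr r) * (a powr - p * b powr - q)"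
    by (intro mult_right_mono) auto
  also have "\<dots> = a powr - (p - r) * b powr - q + a powr - p * b powr - (q - r)"
  proof -
    have "a powr - (p - r) = a powr r * a powr - p" "b powr - (q - r) = b powr r * b powr - q"
      by (simp_all add: powr_add[symmetric])
    then show ?thesis by (simp only: distrib_right distrib_left mult_ac)
  qed
  also have "\<dots> \<le> (a powr - (p - r + q) + b powr - (p - r + q)) + (a powr - (p + (q - r)) + b powr - (p + (q - r)))"
    using assms by (intro add_mono powr_mult_le_add) auto
  also have "\<dots> = 2 * (a powr - (p + q - r) + b powr - (p + q - r))"
    by (simp add: algebra_simps)
  finally show ?thesis .
qed

section \<open>Integrals of power kernels in the plane\<close>

lemma lborel_distr_diff: "distr lborel borel (\<lambda>y. x - y) = (lborel :: complex measure)"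
  using lborel_affine[of "-1" x] by (simp add: density_1)

lemma nn_integral_lborel_diff:
  assumes [measurable]: "g \<in> borel_measurable borel"
  shows "(\<integral>\<^sup>+y. g (x - y) \<partial>lborel) = (\<integral>\<^sup>+y. g (y::complex) \<partial>lborel)"
  by (subst (2) lborel_distr_diff[of x, symmetric]) (simp add: nn_integral_distr)

lemma integral_lborel_diff:
  fixes g :: "complex \<Rightarrow> 'b::{banach, second_countable_topology}"
  assumes [measurable]: "g \<in> borel_measurable borel"
  shows "(LINT y|lborel. g (x - y)) = (LINT y|lborel. g y)"
  by (subst (2) lborel_distr_diff[of x, symmetric]) (simp add: integral_distr)

lemma emeasure_lborel_cball_complex:
  "r \<ge> 0 \<Longrightarrow> emeasure lborel (cball (c::complex) r) = ennreal (pi * r\<^sup>2)"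
  using emeasure_cball[of r c] by (simp add: unit_ball_vol_2)

lemma dyadic_above:
  assumes "0 < x" "x \<le> (1::real)"
  obtains n where "(1/2) ^ Suc n < x" "x \<le> (1/2) ^ n"
proof -
  define m where "m = (LEAST m. (1/2) ^ m < x)"
  have ex: "\<exists>m. (1/2) ^ m < x" using real_arch_pow_inv[of x "1/2"] assms by auto
  have m: "(1/2) ^ m < x" unfolding m_def by (rule LeastI_ex[OF ex])
  then have "m \<noteq> 0" using assms by (intro notI) simp
  then obtain n where n: "m = Suc n" by (cases m) auto
  have "\<not> (1/2) ^ n < x"
    using not_less_Least[of n "\<lambda>m. (1/2) ^ m < x"] n unfolding m_def by auto
  then show ?thesis using that[of n] m n by auto
qed

lemma ennreal_le_suminf: "f n \<le> suminf f" for f :: "nat \<Rightarrow> ennreal"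
  using sum_le_suminf[of f "{n}"] by simp

text \<open>A dyadic decomposition replaces polar coordinates. A point with modulus between 2^-(n+1)
  and 2^-n is charged to the disc of radius 2^-n with weight \<open>c n\<close>, the kernel at the
  inner radius. The areas then give a geometric series of ratio 2^(s-2).\<close>

lemma nn_integral_pot_unit_disc:
  assumes "0 \<le> s" "s < 2"
  shows "(\<integral>\<^sup>+z. ennreal (indicator (cball 0 1) z * norm (z::complex) powr - s) \<partial>lborel) < \<infinity>"
proof -
  define c where "c n = ((1/2) ^ Suc n :: real) powr - s" for n :: nat
  have c0: "c n \<ge> 0" for n by (simp add: c_def)
  have "ennreal (indicator (cball 0 1) z * norm z powr - s)
      \<le> (\<Sum>n. ennreal (c n) * indicator (cball 0 ((1/2) ^ n)) z)" for z :: complex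
  proof (cases "z \<noteq> 0 \<and> norm z \<le> 1")
    case True
    then obtain n where n: "(1/2) ^ Suc n < norm z" "norm z \<le> (1/2) ^ n"
      using dyadic_above[of "norm z"] by auto
    have "ennreal (indicator (cball 0 1) z * norm z powr - s) \<le> ennreal (c n)"
      unfolding c_def using True n(1) assms
      by (intro ennreal_leI) (auto simp: powr_mono2' less_imp_le)
    also have "\<dots> = ennreal (c n) * indicator (cball 0 ((1/2) ^ n)) z"
      using n by simp
    also have "\<dots> \<le> (\<Sum>n. ennreal (c n) * indicator (cball 0 ((1/2) ^ n)) z)"
      by (rule ennreal_le_suminf)
    finally show ?thesis .
  \<comment> \<open>At \<open>z = 0\<close> the integrand vanishes, because \<open>0 powr t\<close>
    is 0 for every \<open>t\<close>.\<close>
  qed auto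
  then have "(\<integral>\<^sup>+z. ennreal (indicator (cball 0 1) z * norm (z::complex) powr - s) \<partial>lborel)
      \<le> (\<integral>\<^sup>+z. (\<Sum>n. ennreal (c n) * indicator (cball 0 ((1/2) ^ n)) z) \<partial>(lborel :: complex measure))"
    by (rule nn_integral_mono)
  also have "\<dots> = (\<Sum>n. ennreal (c n) * emeasure lborel (cball (0::complex) ((1/2) ^ n)))"
    by (subst nn_integral_suminf, measurable) (auto simp: nn_integral_cmult_indicator)
  also have "\<dots> = (\<Sum>n. ennreal (c n * (pi * ((1/2) ^ n)\<^sup>2)))"
    by (simp add: emeasure_lborel_cball_complex ennreal_mult c0 del: power_one_over)
  also have "(\<lambda>n. c n * (pi * ((1/2) ^ n)\<^sup>2)) = (\<lambda>n. (pi * 2 powr s) * (2 powr (s - 2)) ^ n)"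
  proof
    fix n :: nat
    have "c n = (2 powr s) ^ Suc n"
    proof -
      have "(1/2 :: real) ^ Suc n = 2 powr - real (Suc n)"
        by (simp add: powr_minus powr_realpow power_one_over inverse_eq_divide del: power_Suc of_nat_Suc)
      then have "c n = 2 powr (s * real (Suc n))"
        by (simp only: c_def powr_powr) (simp add: mult.commute del: of_nat_Suc)
      then show ?thesis
        using powr_realpow[of "2 powr s" "Suc n"] by (simp only: powr_powr) simp
    qed
    moreover have "((1/2::real) ^ n)\<^sup>2 = (1/4) ^ n"
    proof -
      have "((1/2::real) ^ n)\<^sup>2 = ((1/2)\<^sup>2) ^ n"
        by (simp only: power_mult[symmetric] mult.commute)
      then show ?thesis by (simp add: power2_eq_square)
    qed
    moreover have "(2::real) powr (s - 2) = 2 powr s * (1/4)"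
      by (simp add: powr_diff)
    ultimately show "c n * (pi * ((1/2) ^ n)\<^sup>2) = (pi * 2 powr s) * (2 powr (s - 2)) ^ n"
      by (simp only: power_mult_distrib power_Suc mult_ac)
  qed
  also have "(\<Sum>n. ennreal ((pi * 2 powr s) * (2 powr (s - 2)) ^ n)) < \<infinity>"
  proof -
    have "(2::real) powr (s - 2) < 1" using powr_less_mono[of "s - 2" 0 2] assms by simp
    then have "summable (\<lambda>n. (pi * 2 powr s) * (2 powr (s - 2)) ^ n)"
      by (intro summable_mult summable_geometric) simp
    then show ?thesis
      by (subst suminf_ennreal2) (auto simp: less_top[symmetric])
  qed
  finally show ?thesis .
qed

text \<open>What matters is uniformity in \<open>x\<close>. Where
  \<open>norm (x - y) \<le> 1\<close> the kernel is dominated by a translate of the integrable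
  kernel on the unit disc; elsewhere it is at most 1 and contributes at most the measure of
  \<open>S\<close>.\<close>

lemma pot_bound:
  fixes S :: "complex set"
  assumes "0 \<le> s" "s < 2" and [measurable]: "S \<in> sets borel" and "emeasure lborel S < \<infinity>"
  obtains M where "M \<ge> 0"
    "\<And>x::complex. (\<integral>\<^sup>+y. ennreal (indicator S y * norm (x - y) powr - s) \<partial>lborel) \<le> ennreal M"
proof -
  define N where "N = (\<integral>\<^sup>+z. ennreal (indicator (cball 0 1) z * norm (z::complex) powr - s) \<partial>lborel) + emeasure lborel S"
  have N: "N < \<infinity>"
    unfolding N_def using nn_integral_pot_unit_disc[OF assms(1,2)] assms(4) by simp
  have "(\<integral>\<^sup>+y. ennreal (indicator S y * norm (x - y) powr - s) \<partial>lborel) \<le> N" for x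
  proof -
    have "(\<integral>\<^sup>+y. ennreal (indicator S y * norm (x - y) powr - s) \<partial>lborel)
        \<le> (\<integral>\<^sup>+y. ennreal (indicator (cball 0 1) (x - y) * norm (x - y) powr - s) + indicator S y \<partial>lborel)"
    proof (rule nn_integral_mono)
      fix y
      have "norm (x - y) powr - s \<le> 1" if "norm (x - y) > 1"
        using powr_mono2'[of "- s" 1 "norm (x - y)"] that assms by simp
      then show "ennreal (indicator S y * norm (x - y) powr - s)
          \<le> ennreal (indicator (cball 0 1) (x - y) * norm (x - y) powr - s) + indicator S y"
        by (cases "norm (x - y) \<le> 1"; cases "y \<in> S") (auto simp: ennreal_le_1)
    qed
    also have "\<dots> = (\<integral>\<^sup>+y. ennreal (indicator (cball 0 1) (x - y) * norm (x - y) powr - s) \<partial>lborel) + emeasure lborel S"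
    proof (subst nn_integral_add)
      show "(\<lambda>y. ennreal (indicator (cball 0 1) (x - y) * norm (x - y) powr - s)) \<in> borel_measurable lborel"
        by (intro measurable_compose[OF _ measurable_ennreal] borel_measurable_times powr_real_measurable
            measurable_compose[of "\<lambda>y. x - y" lborel borel "indicator (cball 0 1)"]
              borel_measurable_indicator borel_closed closed_cball) auto
    qed auto
    also have "(\<integral>\<^sup>+y. ennreal (indicator (cball 0 1) (x - y) * norm (x - y) powr - s) \<partial>lborel)
        = (\<integral>\<^sup>+z. ennreal (indicator (cball 0 1) z * norm (z::complex) powr - s) \<partial>lborel)"
      by (rule nn_integral_lborel_diff[where g = "\<lambda>z. ennreal (indicator (cball 0 1) z * norm z powr - s)" and x = x])
        (intro measurable_compose[OF _ measurable_ennreal] borel_measurable_times powr_real_measurable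
          borel_measurable_indicator borel_closed closed_cball; simp)
    finally show ?thesis by (simp add: N_def)
  qed
  then show ?thesis
    using that[of "enn2real N"] N by simp
qed

lemma pot_bound_integral:
  fixes S :: "complex set"
  assumes "0 \<le> s" "s < 2" and [measurable]: "S \<in> sets borel" and "emeasure lborel S < \<infinity>"
  shows "\<exists>M\<ge>0. \<forall>x. integrable lborel (\<lambda>y. indicator S y * norm (x - y) powr - s) \<and>
    (LINT y|lborel. indicator S y * norm (x - y) powr - s) \<le> M"
proof -
  obtain M where M: "M \<ge> 0"
    "\<And>x::complex. (\<integral>\<^sup>+y. ennreal (indicator S y * norm (x - y) powr - s) \<partial>lborel) \<le> ennreal M"
    using pot_bound[OF assms] by blast
  have i: "integrable lborel (\<lambda>y. indicator S y * norm (x - y) powr - s)" for x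
    by (rule integrableI_nonneg) (auto intro: le_less_trans[OF M(2)])
  have "(LINT y|lborel. indicator S y * norm (x - y) powr - s) \<le> M" for x
    using M by (subst integral_eq_nn_integral) (auto intro!: enn2real_leI)
  with i M(1) show ?thesis by blast
qed

lemma reg_delta_integrable: "integrable lborel (reg_delta 1)"
proof (rule integrableI_nonneg)
  show [measurable]: "reg_delta 1 \<in> borel_measurable lborel"
    unfolding reg_delta_def[abs_def] by measurable
  show "AE z in lborel. 0 \<le> reg_delta 1 z" by (auto simp: reg_delta_def)
  \<comment> \<open>A point with 2^n \<le> |z| < 2^(n+1) needs the disc of radius 2^(n+1), while the
    decay |z|^-4 gives only 16^-n. The factor 16 absorbs this shift of index; \<open>n = 0\<close>
    serves the unit disc.\<close>
  define c where "c n = 16 * (1/16 :: real) ^ n" for n :: nat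
  have c0: "c n \<ge> 0" for n by (simp add: c_def)
  have "ennreal (reg_delta 1 z) \<le> (\<Sum>n. ennreal (c n) * indicator (cball 0 (2 ^ n)) z)" for z :: complex
  proof -
    have "\<exists>n. reg_delta 1 z \<le> c n \<and> norm z \<le> 2 ^ n"
    proof (cases "norm z \<le> 1")
      case True
      have "1 \<le> (1 + (norm z)\<^sup>2)\<^sup>2" by (simp add: one_le_power)
      then have "reg_delta 1 z \<le> 1" by (simp add: reg_delta_def add.commute divide_le_eq)
      then show ?thesis using True by (intro exI[of _ 0]) (simp add: c_def)
    next
      case False
      then have "0 < inverse (norm z)" "inverse (norm z) \<le> 1" by (auto simp: inverse_le_1_iff)
      then obtain n where n: "(1/2) ^ Suc n < inverse (norm z)" "inverse (norm z) \<le> (1/2) ^ n"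
        by (rule dyadic_above)
      have "inverse (inverse (norm z)) < inverse ((1/2) ^ Suc n)"
        by (rule less_imp_inverse_less[OF n(1)]) simp
      then have 1: "norm z \<le> 2 ^ Suc n" by (simp add: power_one_over)
      have "((norm z)\<^sup>2)\<^sup>2 \<le> ((norm z)\<^sup>2 + 1)\<^sup>2" "0 < ((norm z)\<^sup>2)\<^sup>2"
        by (intro power_mono; simp) (use False in \<open>intro zero_less_power; force\<close>)
      then have "reg_delta 1 z \<le> 1 / ((norm z)\<^sup>2)\<^sup>2"
        unfolding reg_delta_def one_power2 by (intro frac_le) auto
      also have "\<dots> = (inverse (norm z)) ^ 4" by (simp add: inverse_eq_divide power_one_over)
      also have "\<dots> \<le> ((1/2) ^ n) ^ 4"
        using n(2) by (intro power_mono) auto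
      also have "\<dots> = c (Suc n)"
      proof -
        have "((1/2::real) ^ n) ^ 4 = ((1/2) ^ 4) ^ n"
          by (simp only: power_mult[symmetric] mult.commute)
        then show ?thesis by (simp add: c_def power_one_over)
      qed
      finally show ?thesis using 1 by blast
    qed
    then obtain n where n: "reg_delta 1 z \<le> c n" "norm z \<le> 2 ^ n" by blast
    have "ennreal (reg_delta 1 z) \<le> ennreal (c n) * indicator (cball 0 (2 ^ n)) z"
      using n by (simp add: ennreal_leI)
    also have "\<dots> \<le> (\<Sum>n. ennreal (c n) * indicator (cball 0 (2 ^ n)) z)"
      by (rule ennreal_le_suminf)
    finally show ?thesis .
  qed
  then have "(\<integral>\<^sup>+z. ennreal (reg_delta 1 z) \<partial>lborel)
      \<le> (\<integral>\<^sup>+z. (\<Sum>n. ennreal (c n) * indicator (cball 0 (2 ^ n)) z) \<partial>(lborel :: complex measure))"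
    by (rule nn_integral_mono)
  also have "\<dots> = (\<Sum>n. ennreal (c n) * emeasure lborel (cball (0::complex) (2 ^ n)))"
    by (subst nn_integral_suminf, measurable) (auto simp: nn_integral_cmult_indicator)
  also have "\<dots> = (\<Sum>n. ennreal (c n * (pi * (2 ^ n)\<^sup>2)))"
    by (simp add: emeasure_lborel_cball_complex ennreal_mult c0)
  also have "(\<lambda>n. c n * (pi * (2 ^ n)\<^sup>2)) = (\<lambda>n. (pi * 16) * (1/4) ^ n)"
  proof
    fix n :: nat
    have "((2::real) ^ n)\<^sup>2 = (2\<^sup>2) ^ n"
      by (simp only: power_mult[symmetric] mult.commute)
    then have "((2::real) ^ n)\<^sup>2 = 4 ^ n" by simp
    moreover have "(1/16::real) ^ n * 4 ^ n = (1/4) ^ n"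
      by (simp add: power_mult_distrib[symmetric])
    ultimately show "c n * (pi * (2 ^ n)\<^sup>2) = (pi * 16) * (1/4) ^ n"
      by (simp add: c_def)
  qed
  also have "(\<Sum>n. ennreal ((pi * 16) * (1/4) ^ n)) < \<infinity>"
  proof -
    have "summable (\<lambda>n. (pi * 16) * (1/4::real) ^ n)"
      by (intro summable_mult summable_geometric) simp
    then show ?thesis
      by (subst suminf_ennreal2) (auto simp: less_top[symmetric])
  qed
  finally show "(\<integral>\<^sup>+z. ennreal (reg_delta 1 z) \<partial>lborel) < \<infinity>" .
qed

section \<open>The Cauchy transform\<close>

text \<open>The exponents in use: 1 for the Cauchy kernel; 3/2 for differences of Cauchy kernels and
  for the squared kernel against a density that vanishes to order 1/2; 7/4 for the error of
  difference quotients.\<close>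

lemma kernel_exponents:
  "(0::real) \<le> 1" "(1::real) < 2" "(0::real) \<le> 3/2" "(3/2::real) < 2" "(0::real) \<le> 7/4" "(7/4::real) < 2"
  by simp_all

text \<open>The classical Cauchy transform without its factor 1 / \<pi>.\<close>

definition cauchy :: "(complex \<Rightarrow> complex) \<Rightarrow> complex \<Rightarrow> complex" where
  "cauchy h x = (LINT y|lborel. h y / (x - y))"

lemma AE_lborel_neq: "AE y in lborel. y \<noteq> (x::complex)"
  by (rule AE_lborel_singleton)

lemma cauchy_integrable:
  fixes h :: "complex \<Rightarrow> complex"
  assumes [measurable]: "h \<in> borel_measurable borel" "S \<in> sets borel" and "emeasure lborel S < \<infinity>"
    and h: "\<And>y. norm (h y) \<le> C * indicator S y"
  shows "integrable lborel (\<lambda>y. h y / (x - y))"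
proof -
  obtain M where M0: "M \<ge> 0" and M: "\<forall>x::complex. integrable lborel (\<lambda>y. indicator S y * norm (x - y) powr - 1)
      \<and> (LINT y|lborel. indicator S y * norm (x - y) powr - 1) \<le> M"
    using pot_bound_integral[OF kernel_exponents(1,2) assms(2,3)] by (elim exE conjE)
  note Mi = M[THEN spec, THEN conjunct1] and Mb = M[THEN spec, THEN conjunct2]
  have "integrable lborel (\<lambda>y. C * (indicator S y * norm (x - y) powr - 1))"
    using Mi by (rule integrable_mult_right)
  then show ?thesis
  proof (rule Bochner_Integration.integrable_bound)
    have "norm (h y / (x - y)) \<le> norm (C * (indicator S y * norm (x - y) powr - 1))" if "y \<noteq> x" for y
    proof -
      have "norm (h y / (x - y)) = norm (h y) * norm (x - y) powr - 1"
        using that unfolding norm_divide by (simp add: powr_minus divide_inverse)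
      also have "\<dots> \<le> (C * indicator S y) * norm (x - y) powr - 1"
        by (intro mult_right_mono h) auto
      also have "\<dots> \<le> \<bar>(C * indicator S y) * norm (x - y) powr - 1\<bar>" by (rule abs_ge_self)
      finally show ?thesis by (simp add: mult.assoc)
    qed
    then show "AE y in lborel. norm (h y / (x - y)) \<le> norm (C * (indicator S y * norm (x - y) powr - 1))"
      using AE_lborel_neq[of x] by (auto elim: eventually_mono)
  qed measurable
qed

text \<open>The bound for the difference of two Cauchy kernels is interpolated so that both singular
  factors keep an exponent below \<open>2\<close>.\<close>

lemma cauchy_hoelder:
  assumes [measurable]: "h \<in> borel_measurable borel" "S \<in> sets borel" and S: "emeasure lborel S < \<infinity>"
    and h: "\<And>y. norm (h y) \<le> C * indicator S y" and "C \<ge> 0"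
  obtains K where "K \<ge> 0" "\<And>x x'. norm (cauchy h x - cauchy h x') \<le> K * norm (x - x') powr (1/2)"
proof -
  obtain M where M0: "M \<ge> 0" and M: "\<forall>x::complex. integrable lborel (\<lambda>y. indicator S y * norm (x - y) powr - (3/2))
      \<and> (LINT y|lborel. indicator S y * norm (x - y) powr - (3/2)) \<le> M"
    using pot_bound_integral[OF kernel_exponents(3,4) assms(2) S] by (elim exE conjE)
  note Mi = M[THEN spec, THEN conjunct1] and Mb = M[THEN spec, THEN conjunct2]
  have "norm (cauchy h x - cauchy h x') \<le> (C * 4 * M) * norm (x - x') powr (1/2)" if "x \<noteq> x'" for x x'
  proof -
    define d where "d = norm (x - x')"
    have d: "d > 0" using that by (simp add: d_def)
    let ?g = "\<lambda>y. (C * 2 * d powr (1/2)) * (indicator S y * norm (x - y) powr - (3/2) + indicator S y * norm (x' - y) powr - (3/2))"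
    have "norm (h y / (x - y) - h y / (x' - y)) \<le> ?g y" if y: "y \<noteq> x" "y \<noteq> x'" for y
    proof -
      define a b where "a = norm (x - y)" and "b = norm (x' - y)"
      have ab: "a > 0" "b > 0" using y by (auto simp: a_def b_def)
      have dab: "d \<le> a + b"
        using norm_triangle_ineq4[of "x - y" "x' - y"] by (simp add: d_def a_def b_def)
      have "h y / (x - y) - h y / (x' - y) = h y * (x' - x) / ((x - y) * (x' - y))"
        using y by (simp add: field_simps)
      then have "norm (h y / (x - y) - h y / (x' - y)) = norm (h y) * (d / (a * b))"
        by (simp add: norm_divide norm_mult d_def a_def b_def norm_minus_commute)
      \<comment> \<open>One half power of \<open>d\<close> is kept as the Hoelder gain. The other
        half is spent on lowering the total exponent 1 + 1 to 3/2.\<close>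
      also have "d / (a * b) = d powr (1/2) * (d powr (1/2) * (a powr - 1 * b powr - 1))"
      proof -
        have "d powr (1/2) * d powr (1/2) = d" using d by (simp add: powr_add[symmetric])
        moreover have "a powr - 1 = 1 / a" "b powr - 1 = 1 / b" using ab by (simp_all add: powr_minus divide_inverse)
        ultimately show ?thesis by (simp only: mult.assoc[symmetric]) simp
      qed
      also have "norm (h y) * \<dots> \<le> (C * indicator S y) * (d powr (1/2) * (2 * (a powr - (1 + 1 - 1/2) + b powr - (1 + 1 - 1/2))))"
        using ab d dab \<open>C \<ge> 0\<close> h[of y] by (intro mult_mono mult_left_mono kernel_product_le) auto
      also have "\<dots> = ?g y"
        by (simp add: a_def b_def algebra_simps)
      finally show ?thesis .
    qed
    then have ae: "AE y in lborel. norm (h y / (x - y) - h y / (x' - y)) \<le> ?g y"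
      using AE_lborel_neq[of x] AE_lborel_neq[of x'] by (auto elim: eventually_elim2)
    have i: "integrable lborel ?g"
      by (intro integrable_mult_right Bochner_Integration.integrable_add Mi)
    have "cauchy h x - cauchy h x' = (LINT y|lborel. h y / (x - y) - h y / (x' - y))"
      unfolding cauchy_def
      by (intro Bochner_Integration.integral_diff[symmetric] cauchy_integrable[of h S C] assms)
    also have "norm \<dots> \<le> (LINT y|lborel. ?g y)"
      by (rule order_trans[OF integral_norm_bound])
        (intro integral_mono_AE i ae integrable_norm Bochner_Integration.integrable_diff cauchy_integrable[of h S C] assms)
    also have "\<dots> = (C * 2 * d powr (1/2)) * ((LINT y|lborel. indicator S y * norm (x - y) powr - (3/2))
        + (LINT y|lborel. indicator S y * norm (x' - y) powr - (3/2)))"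
      by (simp only: integral_mult_right_zero Bochner_Integration.integral_add[OF Mi Mi])
    also have "\<dots> \<le> (C * 2 * d powr (1/2)) * (M + M)"
      using \<open>C \<ge> 0\<close> by (intro mult_left_mono add_mono Mb) simp
    finally show ?thesis by (simp add: d_def algebra_simps)
  qed
  then have "norm (cauchy h x - cauchy h x') \<le> (C * 4 * M) * norm (x - x') powr (1/2)" for x x'
    by (cases "x = x'") auto
  then show ?thesis using that[of "C * 4 * M"] \<open>C \<ge> 0\<close> M0 by simp
qed

text \<open>Vanishing of \<open>h\<close> at \<open>x\<close> to order 1/2 weakens the
  non-integrable kernel |x - y|^-2 to exponent 3/2, so the formal derivative converges absolutely.
  The difference quotient minus the formal derivative has kernel d / ((x - y)^2 (x + d - y)); after
  using the decay of \<open>h\<close> its exponents are 3/2 and 1. Spending |d|^(3/4) through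
  \<open>kernel_product_le\<close> leaves exponent 7/4, and the remaining |d|^(1/4) makes the error
  tend to 0.\<close>

lemma cauchy_differentiable:
  assumes [measurable]: "h \<in> borel_measurable borel" "S \<in> sets borel" and S: "emeasure lborel S < \<infinity>"
    and h: "\<And>y. norm (h y) \<le> C * indicator S y"
    and hx: "\<And>y. norm (h y) \<le> C * indicator S y * norm (x - y) powr (1/2)" and "C \<ge> 0"
  shows "(cauchy h has_field_derivative - (LINT y|lborel. h y / (x - y)\<^sup>2)) (at x)"
proof -
  obtain M where M0: "M \<ge> 0" and M: "\<forall>x::complex. integrable lborel (\<lambda>y. indicator S y * norm (x - y) powr - (7/4))
      \<and> (LINT y|lborel. indicator S y * norm (x - y) powr - (7/4)) \<le> M"
    using pot_bound_integral[OF kernel_exponents(5,6) assms(2) S] by (elim exE conjE)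
  note Mi = M[THEN spec, THEN conjunct1] and Mb = M[THEN spec, THEN conjunct2]
  obtain M' where M': "\<forall>x::complex. integrable lborel (\<lambda>y. indicator S y * norm (x - y) powr - (3/2))
      \<and> (LINT y|lborel. indicator S y * norm (x - y) powr - (3/2)) \<le> M'"
    using pot_bound_integral[OF kernel_exponents(3,4) assms(2) S] by (elim exE conjE)
  note Mi' = M'[THEN spec, THEN conjunct1]
  have hx': "norm (h y / (x - y)\<^sup>2) \<le> C * (indicator S y * norm (x - y) powr - (3/2))" if "y \<noteq> x" for y
  proof -
    have "norm (h y / (x - y)\<^sup>2) = norm (h y) / (norm (x - y))\<^sup>2"
      by (simp add: norm_divide norm_power)
    also have "\<dots> = norm (h y) * norm (x - y) powr - 2"
      using that by (simp add: powr_minus divide_inverse)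
    also have "\<dots> \<le> (C * indicator S y * norm (x - y) powr (1/2)) * norm (x - y) powr - 2"
      by (intro mult_right_mono hx) auto
    finally show ?thesis
      by (simp add: mult.assoc powr_add[symmetric])
  qed
  have i2: "integrable lborel (\<lambda>y. h y / (x - y)\<^sup>2)"
  proof (rule Bochner_Integration.integrable_bound)
    show "integrable lborel (\<lambda>y. C * (indicator S y * norm (x - y) powr - (3/2)))"
      using Mi' by (rule integrable_mult_right)
    show "AE y in lborel. norm (h y / (x - y)\<^sup>2) \<le> norm (C * (indicator S y * norm (x - y) powr - (3/2)))"
      using AE_lborel_neq[of x] hx' \<open>C \<ge> 0\<close> by (auto elim: eventually_mono)
  qed measurable
  have i1: "integrable lborel (\<lambda>y. h y / (x' - y))" for x'
    by (rule cauchy_integrable[of h S C]) (use assms in auto)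
  have bound: "norm ((cauchy h (x + d) - cauchy h x) / d - - (LINT y|lborel. h y / (x - y)\<^sup>2))
      \<le> (C * 4 * M) * norm d powr (1/4)" if d0: "d \<noteq> 0" for d
  proof -
    define e where "e = norm d"
    have e: "e > 0" using d0 by (simp add: e_def)
    let ?f = "\<lambda>y. (h y / (x + d - y) - h y / (x - y)) / d + h y / (x - y)\<^sup>2"
    let ?g = "\<lambda>y. (C * 2 * e powr (1/4)) * (indicator S y * norm (x - y) powr - (7/4) + indicator S y * norm (x + d - y) powr - (7/4))"
    have "norm (?f y) \<le> ?g y" if y: "y \<noteq> x" "y \<noteq> x + d" for y
    proof -
      define a b where "a = norm (x - y)" and "b = norm (x + d - y)"
      have ab: "a > 0" "b > 0" using y by (auto simp: a_def b_def algebra_simps)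
      have dab: "e \<le> a + b"
        using norm_triangle_ineq4[of "x + d - y" "x - y"] by (simp add: e_def a_def b_def)
      have nz: "x - y \<noteq> 0" "x + d - y \<noteq> 0" using y by (auto simp: algebra_simps)
      have "?f y = h y * d / ((x - y)\<^sup>2 * (x + d - y))"
      proof -
        have "(1 / (t + d) - 1 / t) / d + 1 / t\<^sup>2 = d / (t\<^sup>2 * (t + d))" if "t \<noteq> 0" "t + d \<noteq> 0" for t
          using that d0 by (simp add: divide_simps power2_eq_square)
        from this[of "x - y"] nz
        have "h y * ((1 / (x + d - y) - 1 / (x - y)) / d + 1 / (x - y)\<^sup>2) = h y * (d / ((x - y)\<^sup>2 * (x + d - y)))"
          by (simp add: algebra_simps)
        then show ?thesis by (simp add: algebra_simps diff_divide_distrib)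
      qed
      then have "norm (?f y) = norm (h y) * (e / (a\<^sup>2 * b))"
        by (simp add: norm_divide norm_mult norm_power e_def a_def b_def)
      also have "\<dots> \<le> (C * indicator S y * a powr (1/2)) * (e / (a\<^sup>2 * b))"
        using hx[of y] e ab by (intro mult_right_mono) (auto simp: a_def)
      also have "\<dots> = C * indicator S y * (e powr (1/4) * (e powr (3/4) * (a powr - (3/2) * b powr - 1)))"
      proof -
        have E: "e powr (1/4) * e powr (3/4) = e" using e by (simp add: powr_add[symmetric])
        have "a powr (1/2) / a\<^sup>2 = a powr - (3/2)"
          using ab powr_diff[of a "1/2" 2] by simp
        moreover have "b powr - 1 = 1 / b" using ab by (simp add: powr_minus divide_inverse)
        moreover have "a powr (1/2) * (e / (a\<^sup>2 * b)) = e * ((a powr (1/2) / a\<^sup>2) * (1 / b))" by simp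
        moreover have "e powr (1/4) * (e powr (3/4) * (a powr - (3/2) * b powr - 1)) = e * (a powr - (3/2) * b powr - 1)"
          by (simp only: mult.assoc[symmetric] E)
        ultimately show ?thesis by (simp only: mult.assoc)
      qed
      also have "\<dots> \<le> C * indicator S y * (e powr (1/4) * (2 * (a powr - (3/2 + 1 - 3/4) + b powr - (3/2 + 1 - 3/4))))"
        using ab e dab \<open>C \<ge> 0\<close> by (intro mult_left_mono kernel_product_le) auto
      also have "\<dots> = ?g y"
        by (simp add: a_def b_def algebra_simps)
      finally show ?thesis .
    qed
    then have ae: "AE y in lborel. norm (?f y) \<le> ?g y"
      using AE_lborel_neq[of x] AE_lborel_neq[of "x + d"] by (auto elim: eventually_elim2)
    have i: "integrable lborel ?g"
      by (intro integrable_mult_right Bochner_Integration.integrable_add Mi)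
    have eq: "(cauchy h (x + d) - cauchy h x) / d - - (LINT y|lborel. h y / (x - y)\<^sup>2) = (LINT y|lborel. ?f y)"
    proof -
      have "(LINT y|lborel. ?f y) = (LINT y|lborel. (h y / (x + d - y) - h y / (x - y)) / d) + (LINT y|lborel. h y / (x - y)\<^sup>2)"
        by (intro Bochner_Integration.integral_add integrable_divide Bochner_Integration.integrable_diff i1 i2)
      also have "(LINT y|lborel. (h y / (x + d - y) - h y / (x - y)) / d) = (cauchy h (x + d) - cauchy h x) / d"
        unfolding cauchy_def by (simp only: integral_divide_zero Bochner_Integration.integral_diff[OF i1 i1])
      finally show ?thesis by (simp only: diff_minus_eq_add)
    qed
    have "norm (LINT y|lborel. ?f y) \<le> (LINT y|lborel. ?g y)"
    proof -
      have "integrable lborel ?f"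
        by (intro Bochner_Integration.integrable_add integrable_divide Bochner_Integration.integrable_diff i1 i2)
      then show ?thesis
        by (rule order_trans[OF integral_norm_bound integral_mono_AE[OF integrable_norm i ae]])
    qed
    also have "\<dots> = (C * 2 * e powr (1/4)) * ((LINT y|lborel. indicator S y * norm (x - y) powr - (7/4))
        + (LINT y|lborel. indicator S y * norm (x + d - y) powr - (7/4)))"
      by (simp only: integral_mult_right_zero Bochner_Integration.integral_add[OF Mi Mi])
    also have "\<dots> \<le> (C * 2 * e powr (1/4)) * (M + M)"
      using \<open>C \<ge> 0\<close> by (intro mult_left_mono add_mono Mb) simp
    also have "\<dots> = (C * 4 * M) * e powr (1/4)" by simp
    finally show ?thesis unfolding eq e_def .
  qed
  have lim: "((\<lambda>d. (C * 4 * M) * norm d powr (1/4)) \<longlongrightarrow> 0) (at (0::complex))"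
    by (intro tendsto_mult_right_zero tendsto_zero_powrI[where b = "1/4"] tendsto_norm_zero tendsto_ident_at) auto
  have "((\<lambda>d. (cauchy h (x + d) - cauchy h x) / d - - (LINT y|lborel. h y / (x - y)\<^sup>2)) \<longlongrightarrow> 0) (at 0)"
    by (rule Lim_null_comparison[OF eventually_mono[OF eventually_neq_at_within[of 0]] lim]) (rule bound)
  then show ?thesis
    unfolding DERIV_def by (rule LIM_zero_cancel)
qed

text \<open>The substitution \<open>y = x - t\<close> moves the singularity to the fixed point
  \<open>t = 0\<close>. One integrable majorant then serves all \<open>x\<close> and dominated
  convergence applies.\<close>

lemma cauchy_kernel2_continuous:
  fixes h :: "complex \<Rightarrow> complex \<Rightarrow> complex"
  assumes U: "U \<subseteq> cball x0 \<rho>" and \<rho>: "\<rho> > 0" and C: "C \<ge> 0"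
    and meas: "\<And>x. x \<in> U \<Longrightarrow> h x \<in> borel_measurable borel"
    and bnd: "\<And>x y. x \<in> U \<Longrightarrow> norm (h x y) \<le> C * indicator (cball x0 \<rho>) y * norm (x - y) powr (1/2)"
    and cont: "\<And>t. continuous_on U (\<lambda>x. h x (x - t))"
  shows "continuous_on U (\<lambda>x. LINT y|lborel. h x y / (x - y)\<^sup>2)"
proof -
  define F where "F x t = h x (x - t) / t\<^sup>2" for x t
  have Fmeas: "F x \<in> borel_measurable borel" if "x \<in> U" for x
  proof -
    note [measurable] = meas[OF that]
    show ?thesis unfolding F_def[abs_def] by measurable
  qed
  have eq: "(LINT y|lborel. h x y / (x - y)\<^sup>2) = (LINT t|lborel. F x t)" if "x \<in> U" for x
    using integral_lborel_diff[OF Fmeas[OF that], of x] by (simp add: F_def)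
  \<comment> \<open>Radius \<open>2 * \<rho>\<close>: both \<open>x\<close> and \<open>x - t\<close>
    lie in the disc of radius \<open>\<rho>\<close> about \<open>x0\<close>.\<close>
  define w where "w t = C * (indicator (cball 0 (2 * \<rho>)) t * norm (0 - t) powr - (3/2))" for t :: complex
  have bd: "emeasure lborel (cball (0::complex) (2 * \<rho>)) < \<infinity>"
    by (rule emeasure_lborel_cball_finite)
  have w: "integrable lborel w"
  proof -
    obtain M where M: "\<forall>x::complex. integrable lborel (\<lambda>y. indicator (cball 0 (2 * \<rho>)) y * norm (x - y) powr - (3/2))
        \<and> (LINT y|lborel. indicator (cball 0 (2 * \<rho>)) y * norm (x - y) powr - (3/2)) \<le> M"
      using pot_bound_integral[OF kernel_exponents(3,4) _ bd] by auto
    show ?thesis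
      unfolding w_def[abs_def] by (rule integrable_mult_right[OF M[THEN spec, THEN conjunct1]])
  qed
  have Fw: "norm (F x t) \<le> w t" if x: "x \<in> U" for x t
  proof (cases "x - t \<in> cball x0 \<rho> \<and> t \<noteq> 0")
    case True
    have "norm t = dist x (x - t)" by (simp add: dist_norm)
    also have "\<dots> \<le> dist x x0 + dist x0 (x - t)" by (rule dist_triangle)
    also have "\<dots> \<le> \<rho> + \<rho>" using True x U by (intro add_mono) (auto simp: dist_commute)
    finally have t: "norm t \<le> 2 * \<rho>" by simp
    have "norm (F x t) = norm (h x (x - t)) / (norm t)\<^sup>2"
      by (simp add: F_def norm_divide norm_power)
    also have "\<dots> \<le> (C * norm t powr (1/2)) / (norm t)\<^sup>2"
      using bnd[OF x, of "x - t"] True by (intro divide_right_mono) auto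
    also have "\<dots> = C * (norm t powr (1/2) / (norm t)\<^sup>2)" by simp
    also have "norm t powr (1/2) / (norm t)\<^sup>2 = norm t powr - (3/2)"
      using True powr_diff[of "norm t" "1/2" 2] by simp
    finally show ?thesis using t by (simp add: w_def)
  next
    case False
    then have "F x t = 0"
      using bnd[OF x, of "x - t"] by (auto simp: F_def)
    then show ?thesis using C by (simp add: w_def)
  qed
  have "continuous_on U (\<lambda>x. LINT t|lborel. F x t)"
    unfolding continuous_on_sequentially comp_def
  proof (intro allI ballI impI, elim conjE)
    fix u a assume a: "a \<in> U" and u: "\<forall>n. u n \<in> U" "u \<longlonglongrightarrow> a"
    show "(\<lambda>n. LINT t|lborel. F (u n) t) \<longlonglongrightarrow> (LINT t|lborel. F a t)"
    proof (rule integral_dominated_convergence[OF _ _ w])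
      show "F a \<in> borel_measurable lborel" using Fmeas[OF a] by simp
      show "F (u n) \<in> borel_measurable lborel" for n using Fmeas u(1) by simp
      show "AE t in lborel. norm (F (u n) t) \<le> w t" for n
        using Fw u(1) by simp
      have "(\<lambda>n. F (u n) t) \<longlonglongrightarrow> F a t" for t
      proof (cases "t = 0")
        case False
        have "((\<lambda>n. h (u n) (u n - t)) \<longlonglongrightarrow> h a (a - t))"
          using cont[of t, unfolded continuous_on_sequentially comp_def] a u by blast
        then show ?thesis unfolding F_def using False by (intro tendsto_divide tendsto_const) auto
      qed (simp add: F_def)
      then show "AE t in lborel. (\<lambda>n. F (u n) t) \<longlonglongrightarrow> F a t" by simp
    qed
  qed
  then show ?thesis
    by (subst continuous_on_cong[OF refl eq])
qed

section \<open>The representation formula\<close>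

text \<open>Bounded support reduces closed sets to compact ones. Closed sets form an
  intersection-stable generator of the Borel sets, so a Dynkin argument gives vanishing integrals
  over all Borel sets, in particular over \<open>{x. 0 < s * f x}\<close> for \<open>s\<close> equal
  to 1 and to -1.\<close>

lemma AE_zero_if_compact_integrals_zero:
  fixes f :: "complex \<Rightarrow> real"
  assumes f: "integrable lborel f" and R: "\<And>x. x \<notin> cball 0 R \<Longrightarrow> f x = 0"
    and K: "\<And>K. compact K \<Longrightarrow> (LINT x:K|lborel. f x) = 0"
  shows "AE x in lborel. f x = 0"
proof -
  note [measurable] = borel_measurable_integrable[OF f]
  have si: "set_integrable lborel A f" if "A \<in> sets borel" for A
    using that unfolding set_integrable_def by (intro integrable_mult_indicator f) simp
  have closed: "(LINT x:A|lborel. f x) = 0" if "closed A" for A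
  proof -
    have "(LINT x:A|lborel. f x) = (LINT x:A \<inter> cball 0 R|lborel. f x)"
      unfolding set_lebesgue_integral_def
      by (rule Bochner_Integration.integral_cong[OF refl]) (use R in \<open>auto simp: indicator_def\<close>)
    then show ?thesis using K[of "A \<inter> cball 0 R"] that by (simp add: closed_Int_compact)
  qed
  have sb: "sets borel = sigma_sets UNIV (Collect (closed :: complex set \<Rightarrow> bool))"
  proof -
    have "sigma_sets UNIV (Collect (open :: complex set \<Rightarrow> bool)) = sigma_sets UNIV (Collect closed)"
    proof (rule sigma_sets_eqI)
      fix A :: "complex set" assume "A \<in> Collect open"
      then have "UNIV - (UNIV - A) \<in> sigma_sets UNIV (Collect closed)"
        by (intro sigma_sets.Compl sigma_sets.Basic) auto
      then show "A \<in> sigma_sets UNIV (Collect closed)" by (simp add: double_diff)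
    next
      fix A :: "complex set" assume "A \<in> Collect closed"
      then have "UNIV - (UNIV - A) \<in> sigma_sets UNIV (Collect open)"
        by (intro sigma_sets.Compl sigma_sets.Basic) auto
      then show "A \<in> sigma_sets UNIV (Collect open)" by (simp add: double_diff)
    qed
    then show ?thesis by (simp add: borel_def)
  qed
  have zero: "(LINT x:A|lborel. f x) = 0" if A: "A \<in> sets borel" for A
  proof -
    have st: "Int_stable (Collect (closed :: complex set \<Rightarrow> bool))"
      by (auto simp: Int_stable_def)
    show ?thesis
      using st _ A[unfolded sb]
    proof (rule sigma_sets_induct_disjoint)
      show "(LINT x:A|lborel. f x) = 0" if "A \<in> Collect closed" for A using that closed by simp
      show "(LINT x:{}|lborel. f x) = 0" by (simp add: set_lebesgue_integral_def)
      show "(LINT x:UNIV - A|lborel. f x) = 0"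
        if "A \<in> sigma_sets UNIV (Collect closed)" "(LINT x:A|lborel. f x) = 0" for A
      proof -
        have A: "A \<in> sets borel" using that sb by simp
        have "(LINT x:A \<union> (UNIV - A)|lborel. f x) = (LINT x:A|lborel. f x) + (LINT x:UNIV - A|lborel. f x)"
          using A by (intro set_integral_Un si) auto
        moreover have "(LINT x:A \<union> (UNIV - A)|lborel. f x) = 0"
          using closed[of UNIV] by simp
        ultimately show ?thesis using that by simp
      qed
      show "(LINT x:(\<Union>i::nat. A i)|lborel. f x) = 0"
        if A: "disjoint_family A" "range A \<subseteq> sigma_sets UNIV (Collect closed)" "\<And>i. (LINT x:A i|lborel. f x) = 0" for A
      proof -
        have Ab: "range A \<subseteq> sets borel" using A(2) unfolding sb .
        have "(LINT x:(\<Union>i. A i)|lborel. f x) = (\<Sum>i. (LINT x:(A i)|lborel. f x))"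
        proof (rule lebesgue_integral_countable_add)
          show "A i \<in> sets lborel" for i using Ab by auto
          show "A i \<inter> A j = {}" if "i \<noteq> j" for i j
            using A(1) that by (simp add: disjoint_family_on_def)
          show "set_integrable lborel (\<Union>i. A i) f"
            by (rule si[OF sets.countable_UN[OF Ab]])
        qed
        then show ?thesis using A(3) by simp
      qed
    qed auto
  qed
  have pos: "AE x in lborel. indicator {x. 0 < s * f x} x * (s * f x) = 0" for s :: real
  proof (subst integral_nonneg_eq_0_iff_AE[symmetric])
    have i: "integrable lborel (\<lambda>x. s * (indicator {x. 0 < s * f x} x * f x))"
      using si[of "{x. 0 < s * f x}"] unfolding set_integrable_def by (intro integrable_mult_right) simp
    then show "integrable lborel (\<lambda>x. indicator {x. 0 < s * f x} x * (s * f x))"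
      by (simp add: mult_ac)
    have "(LINT x|lborel. s * (indicator {x. 0 < s * f x} x * f x)) = s * (LINT x:{x. 0 < s * f x}|lborel. f x)"
      by (simp add: set_lebesgue_integral_def)
    also have "\<dots> = 0" by (subst zero) auto
    finally show "(LINT x|lborel. indicator {x. 0 < s * f x} x * (s * f x)) = 0"
      by (simp add: mult_ac)
    show "AE x in lborel. 0 \<le> indicator {x. 0 < s * f x} x * (s * f x)"
      by (auto simp: indicator_def)
  qed
  have "AE x in lborel. f x \<le> 0"
    using pos[of 1] by eventually_elim (auto simp: indicator_def split: if_splits)
  moreover have "AE x in lborel. 0 \<le> f x"
    using pos[of "-1"] by eventually_elim (auto simp: indicator_def split: if_splits)
  ultimately show ?thesis by eventually_elim simp
qed

lemma AE_zero_if_test_integrals_zero: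
  fixes D :: "complex \<Rightarrow> complex"
  assumes D: "\<And>R. integrable lborel (\<lambda>x. indicator (cball 0 R) x *\<^sub>R D x)"
    and zero: "\<And>\<psi> R. continuous_on UNIV \<psi> \<Longrightarrow> (\<And>x. R < norm x \<Longrightarrow> \<psi> x = 0) \<Longrightarrow> (\<And>x. \<bar>\<psi> x\<bar> \<le> 1) \<Longrightarrow>
      (LINT x|lborel. \<psi> x *\<^sub>R D x) = 0"
  shows "AE x in lborel. D x = 0"
proof -
  have K: "(LINT x|lborel. indicator K x *\<^sub>R D x) = 0" if K: "compact K" for K
  proof (cases "K = {}")
    case False
    obtain R where "\<forall>x\<in>K. norm x \<le> R" using compact_imp_bounded[OF K] unfolding bounded_iff by blast
    then have R: "K \<subseteq> cball 0 R" by auto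
    \<comment> \<open>Continuous cut-offs decreasing to the indicator of \<open>K\<close>. With
      \<open>Suc n\<close> in place of \<open>n\<close> even the first of them vanishes at distance
      1 from \<open>K\<close>, hence outside the disc of radius \<open>R + 1\<close>.\<close>
    define \<psi> where "\<psi> n x = max 0 (1 - real (Suc n) * infdist x K)" for n x
    have cont: "continuous_on UNIV (\<psi> n)" for n
      unfolding \<psi>_def[abs_def] by (intro continuous_intros continuous_on_infdist)
    have supp: "\<psi> n x = 0" if x: "R + 1 < norm x" for n x
    proof -
      obtain k where k: "k \<in> K" "infdist x K = dist x k"
        using infdist_attains_inf[of K x] K False by (auto simp: compact_imp_closed)
      have "norm k \<le> R" using k R by auto
      moreover have "norm x \<le> norm k + dist x k"
        using norm_triangle_sub[of x k] by (simp add: dist_norm)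
      ultimately have "1 \<le> infdist x K" using x k by simp
      then have "1 * 1 \<le> real (Suc n) * infdist x K" by (intro mult_mono) auto
      then show ?thesis by (simp add: \<psi>_def)
    qed
    have bd: "\<bar>\<psi> n x\<bar> \<le> 1" for n x
      by (simp add: \<psi>_def infdist_nonneg)
    have lim: "(\<lambda>n. \<psi> n x) \<longlonglongrightarrow> indicator K x" for x
    proof (cases "x \<in> K")
      case True
      then show ?thesis by (simp add: \<psi>_def)
    next
      case F: False
      then have "infdist x K > 0"
        using in_closed_iff_infdist_zero[of K x] K False infdist_nonneg[of x K]
        by (auto simp: compact_imp_closed less_le)
      then obtain N where N: "1 < real N * infdist x K"
        using reals_Archimedean3 by blast
      have "\<psi> n x = 0" if "n \<ge> N" for n
      proof -
        have "real N * infdist x K \<le> real (Suc n) * infdist x K"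
          using that by (intro mult_right_mono infdist_nonneg) auto
        then show ?thesis using N by (simp add: \<psi>_def)
      qed
      then show ?thesis using F
        by (intro tendsto_eventually eventually_sequentiallyI[of N]) simp
    qed
    have "(\<lambda>n. LINT x|lborel. \<psi> n x *\<^sub>R D x) \<longlonglongrightarrow> (LINT x|lborel. indicator K x *\<^sub>R D x)"
    proof (rule integral_dominated_convergence)
      note dm = borel_measurable_integrable[OF D]
      have DR: "\<psi> n x *\<^sub>R D x = \<psi> n x *\<^sub>R (indicator (cball 0 (R + 1)) x *\<^sub>R D x)" for n x
        using supp[of x n] by (cases "norm x \<le> R + 1") auto
      have KR: "indicator K x *\<^sub>R D x = indicator K x *\<^sub>R (indicator (cball 0 (R + 1)) x *\<^sub>R D x)" for x
        using R by (cases "x \<in> K") auto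
      show "integrable lborel (\<lambda>x. norm (indicator (cball 0 (R + 1)) x *\<^sub>R D x))"
        by (rule integrable_norm[OF D])
      show "(\<lambda>x. indicator K x *\<^sub>R D x) \<in> borel_measurable lborel"
        unfolding KR using K
        by (intro borel_measurable_scaleR borel_measurable_indicator dm) (auto simp: borel_compact)
      show "(\<lambda>x. \<psi> n x *\<^sub>R D x) \<in> borel_measurable lborel" for n
        unfolding DR
        by (intro borel_measurable_scaleR dm) (simp add: borel_measurable_continuous_onI cont)
      show "AE x in lborel. (\<lambda>n. \<psi> n x *\<^sub>R D x) \<longlonglongrightarrow> indicator K x *\<^sub>R D x"
        by (intro always_eventually allI tendsto_scaleR lim tendsto_const)
      show "AE x in lborel. norm (\<psi> n x *\<^sub>R D x) \<le> norm (indicator (cball 0 (R + 1)) x *\<^sub>R D x)" for n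
      proof (intro always_eventually allI)
        fix x
        show "norm (\<psi> n x *\<^sub>R D x) \<le> norm (indicator (cball 0 (R + 1)) x *\<^sub>R D x)"
          unfolding DR norm_scaleR[of "\<psi> n x"] using bd[of n x] by (intro mult_left_le_one_le) auto
      qed
    qed
    moreover have "(LINT x|lborel. \<psi> n x *\<^sub>R D x) = 0" for n
      by (rule zero[OF cont supp bd])
    ultimately show ?thesis by (simp add: LIMSEQ_const_iff)
  qed simp
  have ball: "AE x in lborel. indicator (cball 0 R) x *\<^sub>R D x = 0" for R
  proof -
    let ?E = "\<lambda>x. indicator (cball 0 R) x *\<^sub>R D x"
    have KE: "(LINT x|lborel. indicator K x *\<^sub>R ?E x) = 0" if "compact K" for K
    proof -
      have "(LINT x|lborel. indicator K x *\<^sub>R ?E x) = (LINT x|lborel. indicator (K \<inter> cball 0 R) x *\<^sub>R D x)"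
        by (rule Bochner_Integration.integral_cong[OF refl]) (auto simp: indicator_def)
      then show ?thesis using \<open>compact K\<close> K by (simp add: compact_Int)
    qed
    have iK: "integrable lborel (\<lambda>x. indicator K x *\<^sub>R ?E x)" if "compact K" for K
      by (rule integrable_mult_indicator[OF _ D]) (use that in \<open>simp add: borel_compact\<close>)
    have "AE x in lborel. Re (?E x) = 0"
    proof (rule AE_zero_if_compact_integrals_zero[of _ R])
      show "integrable lborel (\<lambda>x. Re (?E x))" by (rule integrable_Re[OF D])
      show "(LINT x:K|lborel. Re (?E x)) = 0" if "compact K" for K
        using integral_Re[OF iK[OF that]] KE[OF that] by (simp add: set_lebesgue_integral_def mult.assoc)
    qed simp
    moreover have "AE x in lborel. Im (?E x) = 0"
    proof (rule AE_zero_if_compact_integrals_zero[of _ R])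
      show "integrable lborel (\<lambda>x. Im (?E x))" by (rule integrable_Im[OF D])
      show "(LINT x:K|lborel. Im (?E x)) = 0" if "compact K" for K
        using integral_Im[OF iK[OF that]] KE[OF that] by (simp add: set_lebesgue_integral_def mult.assoc)
    qed simp
    ultimately show ?thesis by eventually_elim (simp add: complex_eq_iff)
  qed
  have "AE x in lborel. \<forall>n::nat. indicator (cball 0 (real n)) x *\<^sub>R D x = 0"
    by (subst AE_all_countable) (intro allI ball)
  then show ?thesis
  proof eventually_elim
    case (elim x)
    obtain n :: nat where "norm x \<le> real n" using real_arch_simple by blast
    with elim show ?case by (auto simp: indicator_def split: if_splits)
  qed
qed

lemma integrable_mult_continuous:
  fixes f q :: "complex \<Rightarrow> complex"
  assumes f: "integrable lborel f" and K: "compact K" "\<And>x. x \<notin> K \<Longrightarrow> f x = 0" and q: "continuous_on UNIV q"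
  shows "integrable lborel (\<lambda>x. f x * q x)"
proof -
  have cq: "compact (q ` K)"
    by (rule compact_continuous_image[OF continuous_on_subset[OF q] K(1)]) simp
  obtain B where B: "\<forall>z\<in>q ` K. norm z \<le> B"
    using compact_imp_bounded[OF cq, unfolded bounded_iff] by blast
  have [measurable]: "q \<in> borel_measurable borel" by (rule borel_measurable_continuous_onI[OF q])
  note [measurable] = borel_measurable_integrable[OF f]
  show ?thesis
  proof (rule Bochner_Integration.integrable_bound)
    show "integrable lborel (\<lambda>x. B * norm (f x))" by (intro integrable_mult_right integrable_norm f)
    have "norm (f x * q x) \<le> norm (B * norm (f x))" for x
    proof (cases "x \<in> K")
      case True
      then have "norm (q x) \<le> \<bar>B\<bar>" using B by force
      then have "norm (f x) * norm (q x) \<le> norm (f x) * \<bar>B\<bar>" by (rule mult_left_mono) simp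
      then show ?thesis by (simp add: norm_mult abs_mult mult.commute)
    qed (simp add: K)
    then show "AE x in lborel. norm (f x * q x) \<le> norm (B * norm (f x))" by simp
  qed measurable
qed

section \<open>Cauchy transforms of integrable functions and the approximate identity\<close>

text \<open>For a merely integrable \<open>H\<close> the Cauchy integral may diverge at some points.
  Integrating first in \<open>x\<close> over a bounded disc, with the uniform bound for exponent 1,
  gives joint integrability and therefore convergence at almost every \<open>x\<close>.\<close>

lemma cauchy_L1:
  fixes H :: "complex \<Rightarrow> complex"
  assumes H: "integrable lborel H"
  shows "integrable (lborel \<Otimes>\<^sub>M lborel) (\<lambda>(x, y). indicator (cball 0 R) x *\<^sub>R (H y / (x - y)))"
proof (rule integrableI_bounded)
  note Hm [measurable] = borel_measurable_integrable[OF H, simplified]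
  have [measurable]: "cball (0::complex) R \<in> sets borel" by simp
  show meas [measurable]: "(\<lambda>(x, y). indicator (cball 0 R) x *\<^sub>R (H y / (x - y))) \<in> borel_measurable (lborel \<Otimes>\<^sub>M lborel)"
    by measurable
  have bd: "emeasure lborel (cball (0::complex) R) < \<infinity>" by (rule emeasure_lborel_cball_finite)
  obtain M where M: "M \<ge> 0"
    "\<And>x::complex. (\<integral>\<^sup>+y. ennreal (indicator (cball 0 R) y * norm (x - y) powr - 1) \<partial>lborel) \<le> ennreal M"
    using pot_bound[OF kernel_exponents(1,2) _ bd] by auto
  have "(\<integral>\<^sup>+p. ennreal (norm (case p of (x, y) \<Rightarrow> indicator (cball 0 R) x *\<^sub>R (H y / (x - y)))) \<partial>(lborel \<Otimes>\<^sub>M lborel))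
      = (\<integral>\<^sup>+y. (\<integral>\<^sup>+x. ennreal (norm (indicator (cball 0 R) x *\<^sub>R (H y / (x - y)))) \<partial>lborel) \<partial>lborel)"
    by (subst lborel_pair.nn_integral_snd[symmetric]) simp_all
  also have "\<dots> \<le> (\<integral>\<^sup>+y. ennreal (norm (H y)) * ennreal M \<partial>lborel)"
  proof (rule nn_integral_mono)
    fix y
    have "(\<integral>\<^sup>+x. ennreal (norm (indicator (cball 0 R) x *\<^sub>R (H y / (x - y)))) \<partial>lborel)
        = (\<integral>\<^sup>+x. ennreal (norm (H y)) * ennreal (indicator (cball 0 R) x * norm (y - x) powr - 1) \<partial>lborel)"
    proof (rule nn_integral_cong)
      fix x
      have "norm (indicator (cball 0 R) x *\<^sub>R (H y / (x - y))) = norm (H y) * (indicator (cball 0 R) x * norm (y - x) powr - 1)"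
      proof (cases "x = y")
        case False
        then have "norm (y - x) powr - 1 = 1 / norm (x - y)"
          by (simp add: powr_minus divide_inverse norm_minus_commute)
        then show ?thesis by (simp add: norm_divide)
      qed simp
      then show "ennreal (norm (indicator (cball 0 R) x *\<^sub>R (H y / (x - y))))
          = ennreal (norm (H y)) * ennreal (indicator (cball 0 R) x * norm (y - x) powr - 1)"
        by (simp only: ennreal_mult' norm_ge_zero)
    qed
    also have "\<dots> = ennreal (norm (H y)) * (\<integral>\<^sup>+x. ennreal (indicator (cball 0 R) x * norm (y - x) powr - 1) \<partial>lborel)"
      by (rule nn_integral_cmult)
        (intro measurable_compose[OF _ measurable_ennreal] borel_measurable_times powr_real_measurable
          borel_measurable_indicator borel_closed closed_cball; simp)
    also have "\<dots> \<le> ennreal (norm (H y)) * ennreal M" by (rule mult_left_mono[OF M(2)]) simp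
    finally show "(\<integral>\<^sup>+x. ennreal (norm (indicator (cball 0 R) x *\<^sub>R (H y / (x - y)))) \<partial>lborel) \<le> ennreal (norm (H y)) * ennreal M" .
  qed
  also have "\<dots> = (\<integral>\<^sup>+y. ennreal (norm (H y)) \<partial>lborel) * ennreal M"
    by (rule nn_integral_multc) simp
  also have "\<dots> < \<infinity>"
    using H unfolding integrable_iff_bounded by (simp add: ennreal_mult_less_top)
  finally show "(\<integral>\<^sup>+p. ennreal (norm (case p of (x, y) \<Rightarrow> indicator (cball 0 R) x *\<^sub>R (H y / (x - y)))) \<partial>(lborel \<Otimes>\<^sub>M lborel)) < \<infinity>" .
qed

text \<open>Its value is \<pi>, the factor left out of \<open>cauchy\<close>; the sequel relies on
  positivity alone.\<close>

definition delta_mass :: real where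
  "delta_mass = (LINT z|lborel. reg_delta 1 z)"

lemma delta_mass_pos: "delta_mass > 0"
proof -
  have p: "reg_delta 1 z > 0" for z
  proof -
    have "(norm z)\<^sup>2 + 1\<^sup>2 > 0" by (rule add_nonneg_pos) simp_all
    then show ?thesis unfolding reg_delta_def by (intro divide_pos_pos zero_less_power) simp_all
  qed
  have "delta_mass \<noteq> 0"
  proof
    assume "delta_mass = 0"
    then have "AE z in lborel. reg_delta 1 z = 0"
      unfolding delta_mass_def
      by (subst (asm) integral_nonneg_eq_0_iff_AE[OF reg_delta_integrable]) (simp_all add: p less_imp_le)
    then have "AE z in (lborel :: complex measure). False"
      by (rule eventually_mono) (use p in \<open>metis less_irrefl\<close>)
    then have "emeasure lborel (UNIV :: complex set) = 0"
      by (simp add: AE_iff_null null_sets_def)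
    then show False by simp
  qed
  moreover have "delta_mass \<ge> 0"
    unfolding delta_mass_def by (rule Bochner_Integration.integral_nonneg) (simp add: p less_imp_le)
  ultimately show ?thesis by simp
qed

text \<open>The scaling law of an approximate identity; \<epsilon>^2 is the Jacobian of a dilation
  of the plane. The parameter now sits in the argument of the continuous \<open>\<psi>\<close>,
  where it can tend to 0.\<close>

lemma reg_delta_substitution:
  fixes \<psi> :: "complex \<Rightarrow> real"
  assumes [measurable]: "\<psi> \<in> borel_measurable borel" and e: "\<epsilon> > 0"
  shows "(LINT x|lborel. \<psi> x * reg_delta \<epsilon> (x - y)) = (LINT t|lborel. \<psi> (y + \<epsilon> *\<^sub>R t) * reg_delta 1 t)"
proof -
  let ?f = "\<lambda>x. \<psi> x * reg_delta \<epsilon> (x - y)"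
  have f [measurable]: "?f \<in> borel_measurable borel"
    unfolding reg_delta_def by measurable
  have "(LINT x|lborel. ?f x) = (LINT x|density (distr lborel borel (\<lambda>t. y + \<epsilon> *\<^sub>R t)) (\<lambda>_. ennreal (\<epsilon>\<^sup>2)). ?f x)"
    using lborel_affine[of \<epsilon> y] e by (simp add: ennreal_power)
  also have "\<dots> = (LINT x|distr lborel borel (\<lambda>t. y + \<epsilon> *\<^sub>R t). \<epsilon>\<^sup>2 *\<^sub>R ?f x)"
    by (rule integral_density) simp_all
  also have "\<dots> = (LINT t|lborel. \<epsilon>\<^sup>2 *\<^sub>R ?f (y + \<epsilon> *\<^sub>R t))"
    by (rule integral_distr) simp_all
  also have "(\<lambda>t. \<epsilon>\<^sup>2 *\<^sub>R ?f (y + \<epsilon> *\<^sub>R t)) = (\<lambda>t. \<psi> (y + \<epsilon> *\<^sub>R t) * reg_delta 1 t)"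
  proof
    fix t :: complex
    have p: "(norm t)\<^sup>2 + 1 \<noteq> 0" using zero_le_power2[of "norm t"] by linarith
    have "(norm (\<epsilon> *\<^sub>R t))\<^sup>2 + \<epsilon>\<^sup>2 = \<epsilon>\<^sup>2 * ((norm t)\<^sup>2 + 1)"
      by (simp add: power_mult_distrib algebra_simps)
    then have "\<epsilon>\<^sup>2 * reg_delta \<epsilon> (\<epsilon> *\<^sub>R t) = \<epsilon>\<^sup>2 * (\<epsilon>\<^sup>2 / (\<epsilon>\<^sup>2 * ((norm t)\<^sup>2 + 1))\<^sup>2)"
      by (simp only: reg_delta_def)
    also have "\<dots> = reg_delta 1 t"
      using e p by (simp add: reg_delta_def power_mult_distrib power2_eq_square)
    finally have "\<epsilon>\<^sup>2 * reg_delta \<epsilon> (\<epsilon> *\<^sub>R t) = reg_delta 1 t" .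
    then show "\<epsilon>\<^sup>2 *\<^sub>R ?f (y + \<epsilon> *\<^sub>R t) = \<psi> (y + \<epsilon> *\<^sub>R t) * reg_delta 1 t"
      by (simp add: mult.left_commute)
  qed
  finally show ?thesis .
qed

lemma reg_delta_nonneg: "reg_delta \<epsilon> z \<ge> 0"
  by (simp add: reg_delta_def)

lemma reg_delta_le:
  assumes "\<epsilon> > 0"
  shows "reg_delta \<epsilon> z \<le> 1 / \<epsilon>\<^sup>2"
proof -
  have "(\<epsilon>\<^sup>2)\<^sup>2 \<le> ((norm z)\<^sup>2 + \<epsilon>\<^sup>2)\<^sup>2" by (rule power_mono) simp_all
  then have "reg_delta \<epsilon> z \<le> \<epsilon>\<^sup>2 / (\<epsilon>\<^sup>2)\<^sup>2"
    unfolding reg_delta_def using assms by (intro frac_le) simp_all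
  also have "\<dots> = 1 / \<epsilon>\<^sup>2" using assms by (simp add: power2_eq_square)
  finally show ?thesis .
qed

text \<open>Letting \<open>\<epsilon>\<close> tend to \<open>0\<close> against continuous weights avoids pointwise
  convergence of the regularizations of the merely integrable \<open>G\<close>.\<close>

lemma cauchy_of_reg_identity:
  fixes G H :: "complex \<Rightarrow> complex"
  assumes G: "integrable lborel G" and H: "integrable lborel H"
    and eq: "\<And>x \<epsilon>. \<epsilon> > 0 \<Longrightarrow>
      (LINT y|lborel. G y * of_real (reg_delta \<epsilon> (x - y))) = (LINT y|lborel. H y * reg_kernel \<epsilon> (x - y))"
  shows "AE x in lborel. of_real delta_mass * G x = cauchy H x"
proof -
  note Gm [measurable] = borel_measurable_integrable[OF G, simplified]
  note Hm [measurable] = borel_measurable_integrable[OF H, simplified]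
  have dm [measurable]: "reg_delta \<epsilon> \<in> borel_measurable borel" for \<epsilon>
    unfolding reg_delta_def[abs_def] by measurable
  have km [measurable]: "reg_kernel \<epsilon> \<in> borel_measurable borel" for \<epsilon>
    unfolding reg_kernel_def[abs_def] by (intro borel_measurable_divide borel_measurable_of_real borel_measurable_continuous_onI continuous_intros)
  define D where "D x = of_real delta_mass * G x - cauchy H x" for x
  have icH: "integrable lborel (\<lambda>x. indicator (cball 0 R) x *\<^sub>R cauchy H x)" for R
    using lborel_pair.integrable_fst'[OF cauchy_L1[OF H, of R]]
    by (simp add: cauchy_def)
  have icn: "integrable lborel (\<lambda>x. indicator (cball 0 R) x * (LINT y|lborel. norm (H y / (x - y))))" for R
    using lborel_pair.integrable_fst'[OF integrable_norm[OF cauchy_L1[OF H, of R]]]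
    by (simp add: split_beta')
  have aeH: "AE x in lborel. integrable lborel (\<lambda>y. H y / (x - y))"
  proof -
    have "AE x in lborel. \<forall>n::nat. integrable lborel (\<lambda>y. indicator (cball 0 (real n)) x *\<^sub>R (H y / (x - y)))"
      by (subst AE_all_countable) (intro allI lborel_pair.AE_integrable_fst'[OF cauchy_L1[OF H], simplified prod.case])
    then show ?thesis
    proof eventually_elim
      case (elim x)
      obtain n :: nat where n: "norm x \<le> real n" using real_arch_simple by blast
      from elim[rule_format, of n] n show ?case by simp
    qed
  qed
  have iGD: "integrable lborel (\<lambda>x. indicator (cball 0 R) x *\<^sub>R (of_real delta_mass * G x))" for R
    by (rule integrable_mult_indicator) (simp_all add: G integrable_mult_right)
  have "AE x in lborel. D x = 0"
  proof (rule AE_zero_if_test_integrals_zero)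
    show "integrable lborel (\<lambda>x. indicator (cball 0 R) x *\<^sub>R D x)" for R
      using Bochner_Integration.integrable_diff[OF iGD icH] unfolding D_def scaleR_diff_right .
  next
    fix \<psi> :: "complex \<Rightarrow> real" and R
    assume c: "continuous_on UNIV \<psi>" and supp: "\<And>x. R < norm x \<Longrightarrow> \<psi> x = 0" and bd: "\<And>x. \<bar>\<psi> x\<bar> \<le> 1"
    have pm [measurable]: "\<psi> \<in> borel_measurable borel" by (rule borel_measurable_continuous_onI[OF c])
    have bdi: "\<bar>\<psi> x\<bar> \<le> indicator (cball 0 R) x" for x
      using supp[of x] bd[of x] by (cases "norm x \<le> R") auto
    define e where "e n = 1 / real (Suc n)" for n
    let ?K = "\<lambda>n x. LINT y|lborel. H y * reg_kernel (e n) (x - y)"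
    let ?N = "\<lambda>x. LINT y|lborel. norm (H y / (x - y))"
    let ?d = "\<lambda>n x y. complex_of_real (reg_delta (e n) (x - y))"
    let ?P = "\<lambda>\<epsilon> y. LINT t|lborel. \<psi> (y + \<epsilon> *\<^sub>R t) * reg_delta 1 t"
    have e0: "e n > 0" for n by (simp add: e_def)
    have e_lim: "e \<longlonglongrightarrow> 0" unfolding e_def[abs_def] using LIMSEQ_Suc[OF lim_1_over_n] by simp
    \<comment> \<open>The limit of \<open>a\<close> is computed twice: through \<open>eq\<close>,
      which leads to the transform of \<open>H\<close>, and through Fubini, which moves the
      approximate identity from \<open>G\<close> onto \<open>\<psi>\<close>.\<close>
    define a where "a n = (LINT x|lborel. \<psi> x *\<^sub>R (LINT y|lborel. G y * ?d n x y))" for n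
    have "a \<longlonglongrightarrow> (LINT x|lborel. \<psi> x *\<^sub>R cauchy H x)"
    proof -
      have "a = (\<lambda>n. LINT x|lborel. \<psi> x *\<^sub>R ?K n x)"
        unfolding a_def[abs_def] eq[OF e0] ..
      also have "\<dots> \<longlonglongrightarrow> (LINT x|lborel. \<psi> x *\<^sub>R cauchy H x)"
      proof (rule integral_dominated_convergence[OF _ _ icn[of R]])
        show "(\<lambda>x. \<psi> x *\<^sub>R cauchy H x) \<in> borel_measurable lborel"
          unfolding cauchy_def by measurable
        show "(\<lambda>x. \<psi> x *\<^sub>R ?K n x) \<in> borel_measurable lborel" for n
          by measurable
        have kb: "norm (H y * reg_kernel \<epsilon> (x - y)) \<le> norm (H y / (x - y))" for x y \<epsilon>
          using mult_left_mono[OF norm_reg_kernel_le[of \<epsilon> "x - y"], of "norm (H y)"]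
          by (simp add: norm_mult norm_divide)
        show "AE x in lborel. (\<lambda>n. \<psi> x *\<^sub>R ?K n x) \<longlonglongrightarrow> \<psi> x *\<^sub>R cauchy H x"
          using aeH
        proof eventually_elim
          case (elim x)
          have "(\<lambda>n. LINT y|lborel. H y * reg_kernel (e n) (x - y)) \<longlonglongrightarrow> (LINT y|lborel. H y * (1 / (x - y)))"
          proof (rule integral_dominated_convergence[OF _ _ integrable_norm[OF elim]])
            show "AE y in lborel. (\<lambda>n. H y * reg_kernel (e n) (x - y)) \<longlonglongrightarrow> H y * (1 / (x - y))"
              by (intro always_eventually allI tendsto_mult tendsto_const reg_kernel_tendsto e_lim)
            show "AE y in lborel. norm (H y * reg_kernel (e n) (x - y)) \<le> norm (H y / (x - y))" for n
              by (intro always_eventually allI kb)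
          qed measurable
          then show ?case by (intro tendsto_scaleR tendsto_const) (simp add: cauchy_def)
        qed
        show "AE x in lborel. norm (\<psi> x *\<^sub>R ?K n x)
            \<le> indicator (cball 0 R) x * ?N x" for n
          using aeH
        proof eventually_elim
          case (elim x)
          have i: "integrable lborel (\<lambda>y. H y * reg_kernel (e n) (x - y))"
            by (rule Bochner_Integration.integrable_bound[OF elim]) (measurable, intro always_eventually allI kb)
          have "norm (?K n x) \<le> (LINT y|lborel. norm (H y * reg_kernel (e n) (x - y)))"
            by (rule integral_norm_bound)
          also have "\<dots> \<le> ?N x"
            by (rule integral_mono[OF integrable_norm[OF i] integrable_norm[OF elim] kb])
          finally have 1: "norm (?K n x) \<le> ?N x" .
          show ?case
            unfolding norm_scaleR by (rule mult_mono[OF bdi 1]) simp_all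
        qed
      qed
      finally show ?thesis .
    qed
    moreover have "a \<longlonglongrightarrow> (LINT y|lborel. G y * of_real (delta_mass * \<psi> y))"
    proof -
      have i\<psi>: "integrable lborel \<psi>"
      proof (rule Bochner_Integration.integrable_bound)
        show "integrable lborel (indicator (cball 0 R) :: complex \<Rightarrow> real)"
          by (rule integrable_real_indicator[OF _ emeasure_lborel_cball_finite]) simp
        show "AE x in lborel. norm (\<psi> x) \<le> norm (indicator (cball 0 R) x :: real)"
          using bdi by (auto intro!: always_eventually order_trans[OF _ abs_ge_self])
      qed simp
      have aeq: "a n = (LINT y|lborel. G y * of_real (?P (e n) y))" for n
      proof -
        have iGp: "integrable (lborel \<Otimes>\<^sub>M lborel) (\<lambda>(x, y). \<psi> x *\<^sub>R G y)"
        proof (rule lborel_pair.Fubini_integrable)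
          show "AE x in lborel. integrable lborel (\<lambda>y. case (x, y) of (x, y) \<Rightarrow> \<psi> x *\<^sub>R G y)"
            by (simp add: G)
          have "integrable lborel (\<lambda>x. \<bar>\<psi> x\<bar> * (LINT y|lborel. norm (G y)))"
            by (intro integrable_mult_left integrable_abs i\<psi>)
          then show "integrable lborel (\<lambda>x. LINT y|lborel. norm (case (x, y) of (x, y) \<Rightarrow> \<psi> x *\<^sub>R G y))"
            by simp
        qed measurable
        have iP: "integrable (lborel \<Otimes>\<^sub>M lborel) (\<lambda>(x, y). \<psi> x *\<^sub>R (G y * ?d n x y))"
        proof (rule Bochner_Integration.integrable_bound)
          show "integrable (lborel \<Otimes>\<^sub>M lborel) (\<lambda>p. (1 / (e n)\<^sup>2) *\<^sub>R (case p of (x, y) \<Rightarrow> \<psi> x *\<^sub>R G y))"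
            by (rule integrable_scaleR_right) (rule iGp)
          have "norm (\<psi> x *\<^sub>R (G y * ?d n x y)) \<le> norm ((1 / (e n)\<^sup>2) *\<^sub>R (\<psi> x *\<^sub>R G y))" for x y
          proof -
            have "norm (\<psi> x *\<^sub>R (G y * ?d n x y)) = (\<bar>\<psi> x\<bar> * norm (G y)) * reg_delta (e n) (x - y)"
              by (simp add: norm_mult reg_delta_nonneg)
            also have "\<dots> \<le> (\<bar>\<psi> x\<bar> * norm (G y)) * (1 / (e n)\<^sup>2)"
              by (intro mult_left_mono reg_delta_le e0) simp
            finally show ?thesis by (simp add: mult.commute)
          qed
          then show "AE p in lborel \<Otimes>\<^sub>M lborel. norm (case p of (x, y) \<Rightarrow> \<psi> x *\<^sub>R (G y * ?d n x y))
              \<le> norm ((1 / (e n)\<^sup>2) *\<^sub>R (case p of (x, y) \<Rightarrow> \<psi> x *\<^sub>R G y))"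
            by (intro always_eventually allI) (simp add: split_beta')
        qed measurable
        have "a n = (LINT x|lborel. LINT y|lborel. \<psi> x *\<^sub>R (G y * ?d n x y))"
          unfolding a_def by simp
        also have "\<dots> = (LINT y|lborel. LINT x|lborel. \<psi> x *\<^sub>R (G y * ?d n x y))"
          by (rule lborel_pair.Fubini_integral[OF iP, symmetric])
        also have "\<dots> = (LINT y|lborel. G y * of_real (LINT x|lborel. \<psi> x * reg_delta (e n) (x - y)))"
        proof (rule Bochner_Integration.integral_cong[OF refl])
          fix y
          have "(LINT x|lborel. \<psi> x *\<^sub>R (G y * ?d n x y))
              = (LINT x|lborel. G y * of_real (\<psi> x * reg_delta (e n) (x - y)))"
            by (rule Bochner_Integration.integral_cong[OF refl]) (simp add: scaleR_conv_of_real)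
          also have "\<dots> = G y * (LINT x|lborel. of_real (\<psi> x * reg_delta (e n) (x - y)))"
            by (rule integral_mult_right_zero)
          also have "(LINT x|lborel. complex_of_real (\<psi> x * reg_delta (e n) (x - y))) = of_real (LINT x|lborel. \<psi> x * reg_delta (e n) (x - y))"
            by (rule integral_complex_of_real)
          finally show "(LINT x|lborel. \<psi> x *\<^sub>R (G y * ?d n x y))
              = G y * of_real (LINT x|lborel. \<psi> x * reg_delta (e n) (x - y))" .
        qed
        finally show ?thesis
          by (simp only: reg_delta_substitution[OF pm e0])
      qed
      have cb: "\<bar>?P \<epsilon> y\<bar> \<le> delta_mass" for y \<epsilon>
      proof -
        have b: "\<bar>\<psi> (y + \<epsilon> *\<^sub>R t) * reg_delta 1 t\<bar> \<le> reg_delta 1 t" for t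
          using mult_right_mono[OF bd reg_delta_nonneg, of "y + \<epsilon> *\<^sub>R t" 1 t]
          by (simp add: abs_mult reg_delta_nonneg)
        have i: "integrable lborel (\<lambda>t. \<psi> (y + \<epsilon> *\<^sub>R t) * reg_delta 1 t)"
          by (rule Bochner_Integration.integrable_bound[OF reg_delta_integrable])
            (measurable, use b in \<open>auto simp: reg_delta_nonneg\<close>)
        have "\<bar>?P \<epsilon> y\<bar> \<le> (LINT t|lborel. \<bar>\<psi> (y + \<epsilon> *\<^sub>R t) * reg_delta 1 t\<bar>)"
          by (rule integral_abs_bound)
        also have "\<dots> \<le> delta_mass"
          unfolding delta_mass_def by (rule integral_mono[OF integrable_abs[OF i] reg_delta_integrable b])
        finally show ?thesis .
      qed
      have "(\<lambda>n. LINT y|lborel. G y * of_real (?P (e n) y))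
          \<longlonglongrightarrow> (LINT y|lborel. G y * of_real (delta_mass * \<psi> y))"
      proof (rule integral_dominated_convergence)
        show "integrable lborel (\<lambda>y. norm (G y) * delta_mass)"
          by (intro integrable_mult_left integrable_norm G)
        show "AE y in lborel. norm (G y * of_real (?P (e n) y)) \<le> norm (G y) * delta_mass" for n
          unfolding norm_mult norm_of_real
          by (intro always_eventually allI mult_left_mono cb) simp
        show "AE y in lborel. (\<lambda>n. G y * of_real (?P (e n) y))
            \<longlonglongrightarrow> G y * of_real (delta_mass * \<psi> y)"
        proof (intro always_eventually allI tendsto_mult tendsto_const tendsto_of_real)
          fix y
          have "(\<lambda>n. LINT t|lborel. \<psi> (y + e n *\<^sub>R t) * reg_delta 1 t) \<longlonglongrightarrow> (LINT t|lborel. \<psi> y * reg_delta 1 t)"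
          proof (rule integral_dominated_convergence[OF _ _ reg_delta_integrable])
            have "(\<lambda>n. \<psi> (y + e n *\<^sub>R t)) \<longlonglongrightarrow> \<psi> y" for t
            proof -
              have "(\<lambda>n. y + e n *\<^sub>R t) \<longlonglongrightarrow> y + 0 *\<^sub>R t" by (intro tendsto_intros e_lim)
              then have "(\<lambda>n. y + e n *\<^sub>R t) \<longlonglongrightarrow> y" by simp
              moreover have "isCont \<psi> y" using c by (simp add: continuous_on_eq_continuous_at)
              ultimately show ?thesis by (rule isCont_tendsto_compose[rotated])
            qed
            then show "AE t in lborel. (\<lambda>n. \<psi> (y + e n *\<^sub>R t) * reg_delta 1 t) \<longlonglongrightarrow> \<psi> y * reg_delta 1 t"
              by (intro always_eventually allI tendsto_mult tendsto_const)
            have "norm (\<psi> (y + e n *\<^sub>R t) * reg_delta 1 t) \<le> reg_delta 1 t" for n t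
              using mult_right_mono[OF bd reg_delta_nonneg, of "y + e n *\<^sub>R t" 1 t]
              by (simp add: abs_mult reg_delta_nonneg)
            then show "AE t in lborel. norm (\<psi> (y + e n *\<^sub>R t) * reg_delta 1 t) \<le> reg_delta 1 t" for n
              by (intro always_eventually allI)
          qed measurable
          also have "(LINT t|lborel. \<psi> y * reg_delta 1 t) = delta_mass * \<psi> y"
            by (simp add: delta_mass_def)
          finally show "(\<lambda>n. LINT t|lborel. \<psi> (y + e n *\<^sub>R t) * reg_delta 1 t) \<longlonglongrightarrow> delta_mass * \<psi> y" .
        qed
      qed measurable
      then show ?thesis unfolding aeq[abs_def, symmetric] .
    qed
    ultimately have lim: "(LINT y|lborel. G y * of_real (delta_mass * \<psi> y)) = (LINT x|lborel. \<psi> x *\<^sub>R cauchy H x)"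
      by (rule LIMSEQ_unique[rotated])
    have bi: "indicator (cball 0 R) x * \<psi> x = \<psi> x" for x
      using supp[of x] by (cases "norm x \<le> R") auto
    have ip: "integrable lborel (\<lambda>x. \<psi> x *\<^sub>R E x)" if E: "integrable lborel (\<lambda>x. indicator (cball 0 R) x *\<^sub>R E x)" for E :: "complex \<Rightarrow> complex"
    proof (rule Bochner_Integration.integrable_bound[OF E])
      have eq: "\<psi> x *\<^sub>R E x = \<psi> x *\<^sub>R (indicator (cball 0 R) x *\<^sub>R E x)" for x
        using bi[of x] by (simp add: mult.commute)
      show "(\<lambda>x. \<psi> x *\<^sub>R E x) \<in> borel_measurable lborel"
        unfolding eq by (intro borel_measurable_scaleR borel_measurable_integrable[OF E]) simp
      have "norm (\<psi> x *\<^sub>R E x) \<le> norm (indicator (cball 0 R) x *\<^sub>R E x)" for x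
        unfolding eq norm_scaleR[of "\<psi> x"] using bd[of x] by (intro mult_left_le_one_le) simp_all
      then show "AE x in lborel. norm (\<psi> x *\<^sub>R E x) \<le> norm (indicator (cball 0 R) x *\<^sub>R E x)"
        by (intro always_eventually allI)
    qed
    have "(LINT x|lborel. \<psi> x *\<^sub>R D x) = (LINT x|lborel. \<psi> x *\<^sub>R (of_real delta_mass * G x)) - (LINT x|lborel. \<psi> x *\<^sub>R cauchy H x)"
      unfolding D_def scaleR_diff_right
      by (rule Bochner_Integration.integral_diff[OF ip[OF iGD] ip[OF icH]])
    also have "(LINT x|lborel. \<psi> x *\<^sub>R (of_real delta_mass * G x)) = (LINT y|lborel. G y * of_real (delta_mass * \<psi> y))"
      by (rule Bochner_Integration.integral_cong[OF refl]) (simp add: scaleR_conv_of_real)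
    finally show "(LINT x|lborel. \<psi> x *\<^sub>R D x) = 0" using lim by simp
  qed
  then show ?thesis by (simp add: D_def)
qed

section \<open>Weak derivatives and the localised Cauchy-Pompeiu formula\<close>

text \<open>Integration over the whole plane with Borel measure is harmless, since test functions
  vanish off \<open>\<Omega>\<close>. Integrability is kept apart in
  \<open>locally_integrable\<close>: a divergent integral would count as 0.\<close>

definition weak_cdbar :: "complex set \<Rightarrow> (complex \<Rightarrow> complex) \<Rightarrow> (complex \<Rightarrow> complex) \<Rightarrow> bool" where
  "weak_cdbar \<Omega> g h \<longleftrightarrow>
    (\<forall>\<phi>\<in>test_space \<Omega>. (LINT z|lborel. g z * cdbar \<phi> z) = - (LINT z|lborel. h z * \<phi> z))"

definition locally_integrable :: "complex set \<Rightarrow> (complex \<Rightarrow> complex) \<Rightarrow> bool" where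
  "locally_integrable \<Omega> g \<longleftrightarrow>
    (\<forall>K. compact K \<and> K \<subseteq> \<Omega> \<longrightarrow> integrable lborel (\<lambda>z. indicator K z *\<^sub>R g z))"

lemma continuous_locally_integrable:
  "continuous_on \<Omega> g \<Longrightarrow> locally_integrable \<Omega> g"
  unfolding locally_integrable_def
  by (auto intro!: borel_integrable_compact elim: continuous_on_subset)

lemma locally_integrable_mult:
  assumes g: "locally_integrable \<Omega> g" and K: "compact K" "K \<subseteq> \<Omega>"
    and q: "continuous_on UNIV q" "\<And>x. x \<notin> K \<Longrightarrow> q x = 0"
  shows "integrable lborel (\<lambda>z. g z * q z)"
proof -
  have "integrable lborel (\<lambda>z. (indicator K z *\<^sub>R g z) * q z)"
    using g K by (intro integrable_mult_continuous[OF _ K(1) _ q(1)]) (auto simp: locally_integrable_def)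
  also have "(\<lambda>z. (indicator K z *\<^sub>R g z) * q z) = (\<lambda>z. g z * q z)"
    using q(2) by (fastforce simp: indicator_def)
  finally show ?thesis .
qed

lemma test_spaceE:
  assumes "\<phi> \<in> test_space \<Omega>"
  obtains K where "compact K" "K \<subseteq> \<Omega>" "\<And>z. z \<notin> K \<Longrightarrow> \<phi> z = 0" "\<And>z. z \<notin> K \<Longrightarrow> cdbar \<phi> z = 0"
    "continuous_on UNIV \<phi>" "continuous_on UNIV (cdbar \<phi>)"
proof -
  let ?K = "closure {z. \<phi> z \<noteq> 0}"
  have sm: "\<And>k. \<phi> \<in> Ck_space k UNIV" and K: "compact ?K" "?K \<subseteq> \<Omega>"
    using assms by (auto simp: test_space_def)
  have "\<phi> \<in> test_space ?K" using sm K by (simp add: test_space_def)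
  note z = cdbar_test_space_eq_0[OF this]
  show ?thesis
    by (rule that[OF K z(1) z(2) smooth_continuous[OF sm] smooth_continuous[OF cdbar_smooth[OF sm]]])
qed

lemma weak_cdbar_lin:
  assumes "weak_cdbar \<Omega> g h" "weak_cdbar \<Omega> g' h'"
    and "locally_integrable \<Omega> g" "locally_integrable \<Omega> h" "locally_integrable \<Omega> g'" "locally_integrable \<Omega> h'"
  shows "weak_cdbar \<Omega> (\<lambda>z. g z - c * g' z) (\<lambda>z. h z - c * h' z)"
  unfolding weak_cdbar_def
proof
  fix \<phi> assume \<phi>: "\<phi> \<in> test_space \<Omega>"
  obtain K where K: "compact K" "K \<subseteq> \<Omega>" "\<And>z. z \<notin> K \<Longrightarrow> \<phi> z = 0" "\<And>z. z \<notin> K \<Longrightarrow> cdbar \<phi> z = 0"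
    "continuous_on UNIV \<phi>" "continuous_on UNIV (cdbar \<phi>)"
    by (rule test_spaceE[OF \<phi>]) (rule that)
  have i: "integrable lborel (\<lambda>z. f z * cdbar \<phi> z)" if "locally_integrable \<Omega> f" for f
    by (rule locally_integrable_mult[OF that K(1,2,6)]) (rule K(4))
  have i': "integrable lborel (\<lambda>z. f z * \<phi> z)" if "locally_integrable \<Omega> f" for f
    by (rule locally_integrable_mult[OF that K(1,2,5)]) (rule K(3))
  have "(LINT z|lborel. (g z - c * g' z) * cdbar \<phi> z) = (LINT z|lborel. g z * cdbar \<phi> z - c * (g' z * cdbar \<phi> z))"
    by (simp add: algebra_simps)
  also have "\<dots> = (LINT z|lborel. g z * cdbar \<phi> z) - c * (LINT z|lborel. g' z * cdbar \<phi> z)"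
    by (subst Bochner_Integration.integral_diff[OF i[OF assms(3)] integrable_mult_right[OF i[OF assms(5)]]])
      (simp only: integral_mult_right_zero)
  also have "\<dots> = - ((LINT z|lborel. h z * \<phi> z) - c * (LINT z|lborel. h' z * \<phi> z))"
    using assms(1,2) \<phi> by (simp add: weak_cdbar_def)
  also have "(LINT z|lborel. h z * \<phi> z) - c * (LINT z|lborel. h' z * \<phi> z) = (LINT z|lborel. h z * \<phi> z - c * (h' z * \<phi> z))"
    by (subst Bochner_Integration.integral_diff[OF i'[OF assms(4)] integrable_mult_right[OF i'[OF assms(6)]]])
      (simp only: integral_mult_right_zero)
  also have "\<dots> = (LINT z|lborel. (h z - c * h' z) * \<phi> z)"
    by (simp add: algebra_simps)
  finally show "(LINT z|lborel. (g z - c * g' z) * cdbar \<phi> z) = - (LINT z|lborel. (h z - c * h' z) * \<phi> z)" .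
qed

text \<open>By the product rule this is the weak derivative of \<open>bump x0 \<rho> z * g z\<close>
  when \<open>h\<close> is that of \<open>g\<close>.\<close>

definition localized :: "complex \<Rightarrow> real \<Rightarrow> (complex \<Rightarrow> complex) \<Rightarrow> (complex \<Rightarrow> complex) \<Rightarrow> complex \<Rightarrow> complex" where
  "localized x0 \<rho> g h z = bump x0 \<rho> z * h z + cdbar (bump x0 \<rho>) z * g z"

text \<open>The Cauchy-Pompeiu formula without boundary term. Testing the weak equation with the
  bump times the regularised kernel, the derivative of the kernel smooths the localised
  \<open>g\<close>, while the other two terms combine to the localised right-hand side against the
  kernel.\<close>

lemma weak_cdbar_representation:
  assumes \<rho>: "\<rho> > 0" "cball x0 \<rho> \<subseteq> \<Omega>"
    and g: "locally_integrable \<Omega> g" and h: "locally_integrable \<Omega> h" and w: "weak_cdbar \<Omega> g h"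
  shows "AE x in lborel. of_real delta_mass * (bump x0 \<rho> x * g x) = cauchy (localized x0 \<rho> g h) x"
proof -
  let ?b = "bump x0 \<rho>"
  have b0: "?b z = 0" "cdbar ?b z = 0" if "z \<notin> cball x0 \<rho>" for z
    using that bump_nonzero_iff[OF \<rho>(1), of x0 z] cdbar_bump_eq_0[OF \<rho>(1) that] by auto
  have bc: "continuous_on UNIV ?b" "continuous_on UNIV (cdbar ?b)"
    by (rule smooth_continuous[OF bump_smooth], rule smooth_continuous[OF cdbar_smooth[OF bump_smooth]])
  have bh: "integrable lborel (\<lambda>z. h z * (?b z * q z))" if "continuous_on UNIV q" for q
    by (rule locally_integrable_mult[OF h compact_cball \<rho>(2)]) (use b0 bc that in \<open>auto intro!: continuous_intros\<close>)
  have bg: "integrable lborel (\<lambda>z. g z * (?b z * q z))" if "continuous_on UNIV q" for q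
    by (rule locally_integrable_mult[OF g compact_cball \<rho>(2)]) (use b0 bc that in \<open>auto intro!: continuous_intros\<close>)
  have dg: "integrable lborel (\<lambda>z. g z * (cdbar ?b z * q z))" if "continuous_on UNIV q" for q
    by (rule locally_integrable_mult[OF g compact_cball \<rho>(2)]) (use b0 bc that in \<open>auto intro!: continuous_intros\<close>)
  have c1: "continuous_on UNIV (\<lambda>_. 1 :: complex)" by simp
  show ?thesis
  proof (rule cauchy_of_reg_identity)
    show "integrable lborel (\<lambda>x. ?b x * g x)" using bg[OF c1] by (simp add: mult.commute)
    show "integrable lborel (localized x0 \<rho> g h)"
      using Bochner_Integration.integrable_add[OF bh[OF c1] dg[OF c1]]
      by (simp add: localized_def[abs_def] mult.commute)
  next
    fix x :: complex and \<epsilon> :: real assume e: "\<epsilon> > 0"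
    then have e': "\<epsilon> \<noteq> 0" by simp
    let ?k = "\<lambda>y. reg_kernel \<epsilon> (x - y)" and ?d = "\<lambda>y. complex_of_real (reg_delta \<epsilon> (x - y))"
    have kc: "continuous_on UNIV ?k" by (rule smooth_continuous[OF reg_kernel_smooth[OF e']])
    have d_eq: "?d = (\<lambda>y. - cdbar ?k y)" by (simp add: cdbar_reg_kernel[OF e'])
    have dc: "continuous_on UNIV ?d"
      unfolding d_eq by (intro continuous_on_minus smooth_continuous[OF cdbar_smooth[OF reg_kernel_smooth[OF e']]])
    have t: "(\<lambda>y. ?b y * ?k y) \<in> test_space \<Omega>"
      by (rule bump_mult_test[OF \<rho> reg_kernel_smooth[OF e']])
    have cd: "cdbar (\<lambda>y. ?b y * ?k y) y = cdbar ?b y * ?k y - ?b y * ?d y" for y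
      by (simp add: cdbar_mult[OF smooth_differentiable[OF bump_smooth] smooth_differentiable[OF reg_kernel_smooth[OF e']]]
          cdbar_reg_kernel[OF e'])
    have "(LINT y|lborel. g y * (cdbar ?b y * ?k y)) - (LINT y|lborel. g y * (?b y * ?d y))
        = (LINT y|lborel. g y * cdbar (\<lambda>y. ?b y * ?k y) y)"
      unfolding cd right_diff_distrib
      by (rule Bochner_Integration.integral_diff[OF dg[OF kc] bg[OF dc], symmetric])
    also have "\<dots> = - (LINT y|lborel. h y * (?b y * ?k y))"
      using w t by (simp add: weak_cdbar_def)
    finally have "(LINT y|lborel. g y * (?b y * ?d y)) = (LINT y|lborel. h y * (?b y * ?k y)) + (LINT y|lborel. g y * (cdbar ?b y * ?k y))"
      by (simp add: algebra_simps)
    also have "\<dots> = (LINT y|lborel. h y * (?b y * ?k y) + g y * (cdbar ?b y * ?k y))"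
      by (rule Bochner_Integration.integral_add[OF bh[OF kc] dg[OF kc], symmetric])
    finally show "(LINT y|lborel. ?b y * g y * ?d y) = (LINT y|lborel. localized x0 \<rho> g h y * ?k y)"
      by (simp add: localized_def algebra_simps)
  qed
qed

subsection \<open>Classical solutions are weak solutions\<close>

lemma integral_lborel_add:
  fixes g :: "complex \<Rightarrow> 'b::{banach, second_countable_topology}"
  assumes [measurable]: "g \<in> borel_measurable borel"
  shows "(LINT y|lborel. g (c + y)) = (LINT y|lborel. g y)"
  by (subst (2) lborel_distr_plus[of c, symmetric]) (simp add: integral_distr)

lemma integrable_continuous_compact_support:
  fixes q :: "complex \<Rightarrow> complex"
  assumes "continuous_on UNIV q" "compact K" "\<And>x. x \<notin> K \<Longrightarrow> q x = 0"
  shows "integrable lborel q"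
proof -
  have "integrable lborel (\<lambda>z. 1 * q z)"
    by (rule locally_integrable_mult[of UNIV]) (use assms in \<open>auto intro: continuous_locally_integrable\<close>)
  then show ?thesis by simp
qed

lemma Ck1_lipschitz:
  assumes g: "g \<in> Ck_space (Suc 0) \<Omega>" and S: "S \<subseteq> \<Omega>" "convex S"
    and B: "\<And>z. z \<in> S \<Longrightarrow> norm (dir_deriv 1 g z) \<le> B1" "\<And>z. z \<in> S \<Longrightarrow> norm (dir_deriv \<i> g z) \<le> B2"
    and xy: "x \<in> S" "y \<in> S"
  shows "norm (g x - g y) \<le> (B1 + B2) * norm (x - y)"
proof (rule differentiable_bound[OF S(2) _ _ xy])
  fix z assume z: "z \<in> S"
  let ?d = "\<lambda>v. of_real (Re v) * dir_deriv 1 g z + of_real (Im v) * dir_deriv \<i> g z"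
  show "(g has_derivative ?d) (at z within S)"
    using Ck_Suc_has_derivative[OF g subsetD[OF S(1) z]] by (rule has_derivative_at_withinI)
  show "onorm ?d \<le> B1 + B2"
  proof (rule onorm_le)
    fix v
    have "norm (?d v) \<le> \<bar>Re v\<bar> * norm (dir_deriv 1 g z) + \<bar>Im v\<bar> * norm (dir_deriv \<i> g z)"
      by (rule order_trans[OF norm_triangle_ineq]) (simp add: norm_mult)
    also have "\<dots> \<le> norm v * B1 + norm v * B2"
      by (intro add_mono mult_mono B z abs_Re_le_cmod abs_Im_le_cmod) simp_all
    finally show "norm (?d v) \<le> (B1 + B2) * norm v"
      by (simp add: algebra_simps)
  qed
qed

text \<open>Translation invariance makes every difference quotient integrate to 0. The global
  Lipschitz bound dominates the quotients, on a disc of radius \<open>R + 1\<close> because the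
  increments have length at most 1.\<close>

lemma integral_dir_deriv_eq_0:
  assumes F: "F \<in> Ck_space (Suc 0) UNIV" and R: "\<And>z. R < norm z \<Longrightarrow> F z = 0" and e: "e = 1 \<or> e = \<i>"
  shows "(LINT z|lborel. dir_deriv e F z) = 0"
proof -
  have dc: "continuous_on UNIV (dir_deriv 1 F)" "continuous_on UNIV (dir_deriv \<i> F)"
    using Ck_space_dir_deriv[OF F] by simp_all
  have D: "(F has_derivative (\<lambda>v. of_real (Re v) * dir_deriv 1 F z + of_real (Im v) * dir_deriv \<i> F z)) (at z)" for z
    by (rule Ck_Suc_has_derivative[OF F]) simp
  have d0: "dir_deriv e' F z = 0" if "R < norm z" for e' z
    by (rule dir_deriv_eq_0[of "{z. R < norm z}"]) (use that R in \<open>auto intro!: open_Collect_less continuous_intros\<close>)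
  have "\<exists>B. \<forall>z. norm (dir_deriv e' F z) \<le> B" if "continuous_on UNIV (dir_deriv e' F)" for e'
  proof -
    have c: "compact (dir_deriv e' F ` cball 0 R)"
      by (rule compact_continuous_image[OF continuous_on_subset[OF that] compact_cball]) simp
    obtain B where B: "\<forall>z\<in>dir_deriv e' F ` cball 0 R. norm z \<le> B"
      using compact_imp_bounded[OF c, unfolded bounded_iff] by blast
    have "norm (dir_deriv e' F z) \<le> max B 0" for z
      using B d0[of z e'] by (cases "norm z \<le> R") (force simp: le_max_iff_disj)+
    then show ?thesis by blast
  qed
  from this[OF dc(1)] this[OF dc(2)] obtain B1 B2 where B: "\<And>z. norm (dir_deriv 1 F z) \<le> B1" "\<And>z. norm (dir_deriv \<i> F z) \<le> B2"
    by blast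
  have lip: "norm (F x - F y) \<le> (B1 + B2) * norm (x - y)" for x y
    by (rule Ck1_lipschitz[OF F subset_UNIV convex_UNIV B]) simp_all
  have Fc: "continuous_on UNIV F"
    using Ck_space_SucD[OF F] by simp
  then have [measurable]: "F \<in> borel_measurable borel" by (rule borel_measurable_continuous_onI)
  have iF: "integrable lborel F"
    by (rule integrable_continuous_compact_support[OF Fc compact_cball[of 0 R]]) (use R in auto)
  have em: "dir_deriv e F \<in> borel_measurable borel"
    using e dc by (auto intro: borel_measurable_continuous_onI)
  have ne: "norm e = 1" using e by auto
  define t where "t n = 1 / real (Suc n)" for n
  have t0: "t n > 0" "t n \<le> 1" for n by (simp_all add: t_def)
  have t_lim: "t \<longlonglongrightarrow> 0" unfolding t_def[abs_def] using LIMSEQ_Suc[OF lim_1_over_n] by simp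
  have "(\<lambda>n. LINT z|lborel. (F (t n *\<^sub>R e + z) - F z) /\<^sub>R t n) \<longlonglongrightarrow> (LINT z|lborel. dir_deriv e F z)"
  proof (rule integral_dominated_convergence)
    have "integrable lborel (\<lambda>z. indicator (cball (0::complex) (R + 1)) z :: real)"
      by (rule integrable_real_indicator[OF _ emeasure_lborel_cball_finite]) simp
    then show "integrable lborel (\<lambda>z. (B1 + B2) * indicator (cball (0::complex) (R + 1)) z)"
      by (rule integrable_mult_right)
    show "AE z in lborel. (\<lambda>n. (F (t n *\<^sub>R e + z) - F z) /\<^sub>R t n) \<longlonglongrightarrow> dir_deriv e F z"
    proof (intro always_eventually allI)
      fix z
      have "((\<lambda>s. F (z + s *\<^sub>R e)) has_vector_derivative dir_deriv e F z) (at 0)"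
      proof -
        have "((\<lambda>s. z + s *\<^sub>R e) has_derivative (\<lambda>s. s *\<^sub>R e)) (at 0)"
          by (auto intro!: derivative_eq_intros)
        moreover have "(F has_derivative (\<lambda>v. of_real (Re v) * dir_deriv 1 F z + of_real (Im v) * dir_deriv \<i> F z)) (at (z + 0 *\<^sub>R e))"
          using D by simp
        ultimately have "((\<lambda>s. F (z + s *\<^sub>R e)) has_derivative (\<lambda>s. of_real (Re (s *\<^sub>R e)) * dir_deriv 1 F z + of_real (Im (s *\<^sub>R e)) * dir_deriv \<i> F z)) (at 0)"
          by (rule has_derivative_compose)
        then show ?thesis
          unfolding has_vector_derivative_def
          by (rule has_derivative_eq_rhs) (use e in \<open>auto simp: scaleR_conv_of_real\<close>)
      qed
      then have "((\<lambda>s. (1 / norm (s - 0)) *\<^sub>R (F (z + s *\<^sub>R e) - (F (z + 0 *\<^sub>R e) + (s - 0) *\<^sub>R dir_deriv e F z))) \<longlongrightarrow> 0) (at 0)"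
        unfolding has_vector_derivative_def has_derivative_within by blast
      moreover have "filterlim t (at 0) sequentially"
        by (rule filterlim_atI[OF t_lim]) (use t0(1) in \<open>auto intro!: always_eventually simp: less_imp_neq[symmetric]\<close>)
      ultimately have "(\<lambda>n. (1 / norm (t n - 0)) *\<^sub>R (F (z + t n *\<^sub>R e) - (F (z + 0 *\<^sub>R e) + (t n - 0) *\<^sub>R dir_deriv e F z))) \<longlonglongrightarrow> 0"
        by (rule filterlim_compose)
      also have "(\<lambda>n. (1 / norm (t n - 0)) *\<^sub>R (F (z + t n *\<^sub>R e) - (F (z + 0 *\<^sub>R e) + (t n - 0) *\<^sub>R dir_deriv e F z)))
          = (\<lambda>n. (F (t n *\<^sub>R e + z) - F z) /\<^sub>R t n - dir_deriv e F z)"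
      proof
        fix n
        have "norm (t n) = t n" "t n \<noteq> 0" using t0(1)[of n] by simp_all
        then show "(1 / norm (t n - 0)) *\<^sub>R (F (z + t n *\<^sub>R e) - (F (z + 0 *\<^sub>R e) + (t n - 0) *\<^sub>R dir_deriv e F z))
          = (F (t n *\<^sub>R e + z) - F z) /\<^sub>R t n - dir_deriv e F z"
          by (simp add: scaleR_diff_right scaleR_add_right divide_inverse add.commute)
      qed
      finally show "(\<lambda>n. (F (t n *\<^sub>R e + z) - F z) /\<^sub>R t n) \<longlonglongrightarrow> dir_deriv e F z"
        by (rule LIM_zero_cancel)
    qed
    show "AE z in lborel. norm ((F (t n *\<^sub>R e + z) - F z) /\<^sub>R t n) \<le> (B1 + B2) * indicator (cball (0::complex) (R + 1)) z" for n
    proof (intro always_eventually allI)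
      fix z
      have nt: "norm (t n *\<^sub>R e) = t n" using t0[of n] ne by simp
      show "norm ((F (t n *\<^sub>R e + z) - F z) /\<^sub>R t n) \<le> (B1 + B2) * indicator (cball 0 (R + 1)) z"
      proof (cases "norm z \<le> R + 1")
        case True
        have "norm (F (t n *\<^sub>R e + z) - F z) \<le> (B1 + B2) * t n"
          using lip[of "t n *\<^sub>R e + z" z] nt by simp
        then have "norm (F (t n *\<^sub>R e + z) - F z) / t n \<le> B1 + B2"
          using t0[of n] by (simp add: pos_divide_le_eq)
        then show ?thesis using True t0[of n] by (simp add: divide_inverse mult.commute)
      next
        case False
        have "norm z \<le> norm (t n *\<^sub>R e + z) + norm (t n *\<^sub>R e)"
          using norm_triangle_ineq4[of "t n *\<^sub>R e + z" "t n *\<^sub>R e"] by simp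
        then have "R < norm (t n *\<^sub>R e + z)" "R < norm z"
          using False nt t0(2)[of n] by linarith+
        then show ?thesis using R False by simp
      qed
    qed
  qed (use em in measurable)
  moreover have "(LINT z|lborel. (F (t n *\<^sub>R e + z) - F z) /\<^sub>R t n) = 0" for n
  proof -
    have i: "integrable lborel (\<lambda>z. F (t n *\<^sub>R e + z))"
      by (rule integrable_continuous_compact_support[OF _ compact_cball[of "- t n *\<^sub>R e" R]])
        (use Fc R in \<open>auto intro!: continuous_intros continuous_on_compose2[OF Fc] simp: dist_norm norm_minus_commute add.commute\<close>)
    have "(LINT z|lborel. F (t n *\<^sub>R e + z) - F z) = (LINT z|lborel. F (t n *\<^sub>R e + z)) - (LINT z|lborel. F z)"
      by (rule Bochner_Integration.integral_diff[OF i iF])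
    also have "\<dots> = 0" by (simp add: integral_lborel_add)
    finally show ?thesis by simp
  qed
  ultimately have "(\<lambda>n::nat. 0) \<longlonglongrightarrow> (LINT z|lborel. dir_deriv e F z)"
    by (simp only:)
  then show ?thesis by (rule LIMSEQ_unique[OF _ tendsto_const])
qed

lemma continuous_on_zero_extension:
  fixes q :: "complex \<Rightarrow> complex"
  assumes "open \<Omega>" "closed S" "S \<subseteq> \<Omega>" "continuous_on \<Omega> q" "\<And>z. z \<notin> S \<Longrightarrow> q z = 0"
  shows "continuous_on UNIV q"
proof -
  have "continuous_on (- S) q"
    by (subst continuous_on_cong[OF refl, of _ _ "\<lambda>_. 0"]) (use assms in auto)
  then have "continuous_on (\<Omega> \<union> - S) q"
    using assms by (intro continuous_on_open_Un) auto
  moreover have "\<Omega> \<union> - S = UNIV" using assms by auto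
  ultimately show ?thesis by simp
qed

text \<open>\<open>P\<close> is controlled only on \<open>\<Omega>\<close>, but
  \<open>P * \<phi>\<close> is a C^1 function on the plane with compact support: outside the support
  of \<open>\<phi>\<close> it is locally 0. Its derivatives integrate to 0, which is the integration
  by parts.\<close>

lemma weak_cdbar_C1:
  assumes \<Omega>: "open \<Omega>" and P: "P \<in> Ck_space (Suc 0) \<Omega>"
  shows "weak_cdbar \<Omega> P (cdbar P)"
  unfolding weak_cdbar_def
proof
  fix \<phi> assume \<phi>: "\<phi> \<in> test_space \<Omega>"
  define K where "K = closure {z. \<phi> z \<noteq> 0}"
  have sm: "\<And>k. \<phi> \<in> Ck_space k UNIV" and K: "compact K" "K \<subseteq> \<Omega>"
    using \<phi> by (auto simp: test_space_def K_def)
  have \<phi>0: "\<phi> z = 0" if "z \<notin> K" for z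
    using that subsetD[OF closure_subset[of "{z. \<phi> z \<noteq> 0}"]] unfolding K_def by blast
  have oK: "open (- K)" unfolding K_def by (rule open_Compl[OF closed_closure])
  have d0: "dir_deriv e \<phi> z = 0" if "z \<notin> K" for e z
    by (rule dir_deriv_eq_0[OF oK]) (use that \<phi>0 in blast)+
  have c\<phi>: "continuous_on UNIV \<phi>" "continuous_on UNIV (dir_deriv 1 \<phi>)" "continuous_on UNIV (dir_deriv \<i> \<phi>)"
    using sm[of 0] Ck_space_dir_deriv[OF sm[of "Suc 0"]] by simp_all
  have cP: "continuous_on \<Omega> P" "continuous_on \<Omega> (dir_deriv 1 P)" "continuous_on \<Omega> (dir_deriv \<i> P)"
    using Ck_space_SucD[OF P] Ck_space_dir_deriv[OF P] by simp_all
  let ?F = "\<lambda>z. P z * \<phi> z"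
  let ?F' = "\<lambda>z v. P z * (of_real (Re v) * dir_deriv 1 \<phi> z + of_real (Im v) * dir_deriv \<i> \<phi> z)
      + (of_real (Re v) * dir_deriv 1 P z + of_real (Im v) * dir_deriv \<i> P z) * \<phi> z"
  have D: "(?F has_derivative ?F' z) (at z)" for z
  proof (cases "z \<in> \<Omega>")
    case True
    show ?thesis
      by (rule has_derivative_mult[OF Ck_Suc_has_derivative[OF P True] Ck_Suc_has_derivative[OF sm UNIV_I]])
  next
    case False
    then have zK: "z \<notin> K" using K(2) by blast
    then have z: "z \<in> - K" by (simp only: Compl_iff not_False_eq_True)
    have "((\<lambda>_. 0) has_derivative (\<lambda>_. 0)) (at z)" by simp
    then have "(?F has_derivative (\<lambda>_. 0)) (at z)"
      by (rule has_derivative_transform_within_open[OF _ oK z]) (simp add: \<phi>0)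
    moreover have "?F' z = (\<lambda>_. 0)"
      by (simp only: \<phi>0[OF zK] d0[OF zK] mult_zero_right add_0)
    ultimately show ?thesis by simp
  qed
  have all0: "\<forall>z. z \<notin> K \<longrightarrow> \<phi> z = 0" "\<forall>z. z \<notin> K \<longrightarrow> dir_deriv e \<phi> z = 0"
    "\<forall>z. z \<notin> K \<longrightarrow> cdbar \<phi> z = 0" for e
    using \<phi>0 d0 by (simp_all add: cdbar_def)
  have cont: "continuous_on UNIV (\<lambda>z. Q z * \<psi> z)"
    if "continuous_on \<Omega> Q" "continuous_on UNIV \<psi>" "\<forall>z. z \<notin> K \<longrightarrow> \<psi> z = 0" for Q \<psi> :: "complex \<Rightarrow> complex"
    by (rule continuous_on_zero_extension[OF \<Omega> compact_imp_closed[OF K(1)] K(2)])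
      (intro continuous_on_mult that(1) continuous_on_subset[OF that(2) subset_UNIV], simp add: that(3))
  have FC: "?F \<in> Ck_space (Suc 0) UNIV"
  proof (rule Ck_UNIV_SucI[OF D])
    show "(\<lambda>z. ?F' z 1) \<in> Ck_space 0 UNIV"
      using continuous_on_add[OF cont[OF cP(1) c\<phi>(2) all0(2)] cont[OF cP(2) c\<phi>(1) all0(1)]] by simp
    show "(\<lambda>z. ?F' z \<i>) \<in> Ck_space 0 UNIV"
      using continuous_on_add[OF cont[OF cP(1) c\<phi>(3) all0(2)] cont[OF cP(3) c\<phi>(1) all0(1)]] by simp
  qed
  obtain R where R: "\<forall>z\<in>K. norm z \<le> R"
    using compact_imp_bounded[OF K(1), unfolded bounded_iff] by blast
  have FR: "?F z = 0" if "R < norm z" for z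
    using that R \<phi>0[of z] by force
  have iF: "integrable lborel (dir_deriv e ?F)" if "e = 1 \<or> e = \<i>" for e
  proof (rule integrable_continuous_compact_support[OF _ K(1)])
    show "continuous_on UNIV (dir_deriv e ?F)"
      using that Ck_space_dir_deriv[OF FC] by auto
    show "dir_deriv e ?F z = 0" if "z \<notin> K" for z
      by (rule dir_deriv_eq_0[OF oK]) (use that \<phi>0 in force)+
  qed
  have "(LINT z|lborel. cdbar ?F z) = 0"
  proof -
    have "(LINT z|lborel. dir_deriv 1 ?F z + \<i> * dir_deriv \<i> ?F z) = (LINT z|lborel. dir_deriv 1 ?F z) + (LINT z|lborel. \<i> * dir_deriv \<i> ?F z)"
      by (rule Bochner_Integration.integral_add) (simp_all add: iF)
    also have "\<dots> = 0"
      using integral_dir_deriv_eq_0[OF FC FR] by simp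
    finally show ?thesis by (simp add: cdbar_def)
  qed
  moreover have "cdbar ?F z = P z * cdbar \<phi> z + cdbar P z * \<phi> z" for z
    unfolding cdbar_has_derivative[OF D] by (simp add: cdbar_def algebra_simps add_divide_distrib)
  moreover have "integrable lborel (\<lambda>z. P z * cdbar \<phi> z)"
    by (rule integrable_continuous_compact_support[OF cont[OF cP(1) smooth_continuous[OF cdbar_smooth[OF sm]] all0(3)] K(1)])
      (simp add: all0)
  moreover have "integrable lborel (\<lambda>z. cdbar P z * \<phi> z)"
  proof (rule integrable_continuous_compact_support[OF cont[OF _ c\<phi>(1) all0(1)] K(1)])
    show "continuous_on \<Omega> (cdbar P)"
      unfolding cdbar_def[abs_def] by (intro continuous_intros cP) simp
  qed (simp_all add: \<phi>0)
  ultimately have "(LINT z|lborel. P z * cdbar \<phi> z) + (LINT z|lborel. cdbar P z * \<phi> z) = 0"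
    by (simp add: Bochner_Integration.integral_add)
  then show "(LINT z|lborel. P z * cdbar \<phi> z) = - (LINT z|lborel. cdbar P z * \<phi> z)"
    by (simp add: eq_neg_iff_add_eq_0)
qed

section \<open>Local boundedness\<close>

text \<open>A truncated Riesz potential. Values in \<open>ennreal\<close> allow it to be iterated,
  and integrals to be interchanged, before anything is known to be finite.\<close>

definition pot :: "real \<Rightarrow> complex set \<Rightarrow> (complex \<Rightarrow> ennreal) \<Rightarrow> complex \<Rightarrow> ennreal" where
  "pot s S v x = (\<integral>\<^sup>+y. ennreal (indicator S y * norm (x - y) powr - s) * v y \<partial>lborel)"

lemma pot_kernel_measurable:
  fixes S :: "complex set"
  assumes "S \<in> sets borel"
  shows "(\<lambda>y. ennreal (indicator S y * norm (x - y) powr - s)) \<in> borel_measurable borel"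
    "(\<lambda>p. ennreal (indicator S (snd p) * norm (fst p - snd p) powr - s)) \<in> borel_measurable (lborel \<Otimes>\<^sub>M lborel)"
proof -
  note [measurable] = assms
  show "(\<lambda>y. ennreal (indicator S y * norm (x - y) powr - s)) \<in> borel_measurable borel" by measurable
  show "(\<lambda>p. ennreal (indicator S (snd p) * norm (fst p - snd p) powr - s)) \<in> borel_measurable (lborel \<Otimes>\<^sub>M lborel)"
    by measurable
qed

lemma pot_measurable:
  assumes S [measurable]: "S \<in> sets borel" and v [measurable]: "v \<in> borel_measurable borel"
  shows "pot s S v \<in> borel_measurable borel"
proof -
  have "(\<lambda>x. \<integral>\<^sup>+y. ennreal (indicator S y * norm (x - y) powr - s) * v y \<partial>lborel) \<in> borel_measurable lborel"
    by measurable
  then show ?thesis by (simp add: pot_def[abs_def])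
qed

lemma pot_mono_AE:
  assumes [measurable]: "S \<in> sets borel" "v' \<in> borel_measurable borel"
    and "AE y in lborel. y \<in> S \<longrightarrow> v y \<le> c * v' y"
  shows "pot s S v x \<le> c * pot s S v' x"
proof -
  have "pot s S v x \<le> (\<integral>\<^sup>+y. c * (ennreal (indicator S y * norm (x - y) powr - s) * v' y) \<partial>lborel)"
    unfolding pot_def
  proof (rule nn_integral_mono_AE)
    show "AE y in lborel. ennreal (indicator S y * norm (x - y) powr - s) * v y
        \<le> c * (ennreal (indicator S y * norm (x - y) powr - s) * v' y)"
      using assms(3)
    proof eventually_elim
      case (elim y)
      show ?case
      proof (cases "y \<in> S")
        case True
        then show ?thesis
          using mult_left_mono[OF elim[rule_format, OF True], of "ennreal (indicator S y * norm (x - y) powr - s)"]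
          by (simp add: mult.left_commute)
      qed simp
    qed
  qed
  also have "\<dots> = c * pot s S v' x"
    unfolding pot_def by (rule nn_integral_cmult) (use pot_kernel_measurable(1)[OF assms(1)] in measurable)
  finally show ?thesis .
qed

text \<open>By Tonelli the composite kernel is the integral of |x - y|^-p |y - z|^-q over
  \<open>S\<close>. Extracting |x - z|^-t with \<open>kernel_product_le\<close> leaves exponent
  \<open>p + q - t\<close>, whose integral is bounded uniformly. For \<open>p = q = 1\<close> the
  condition excludes \<open>t = 0\<close>, the logarithmic case.\<close>

lemma pot_pot_le:
  fixes S :: "complex set"
  assumes S [measurable]: "S \<in> sets borel" and fin: "emeasure lborel S < \<infinity>"
    and t: "0 \<le> t" "t \<le> 1" "t \<le> p" "t \<le> q" "p + q - t < 2"
  obtains M where "M \<ge> 0"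
    "\<And>S' v x. S' \<in> sets borel \<Longrightarrow> v \<in> borel_measurable borel \<Longrightarrow>
      pot p S (pot q S' v) x \<le> ennreal M * pot t S' v x"
proof -
  let ?s = "p + q - t"
  let ?k = "\<lambda>s x y. ennreal (indicator S y * norm (x - y) powr - s)"
  let ?n = "\<lambda>y z. ennreal (norm (y - z) powr - q)"
  let ?I = "\<lambda>x z. \<integral>\<^sup>+y. ?k p x y * ?n y z \<partial>lborel"
  have s: "0 \<le> ?s" using t by simp
  obtain M where M: "M \<ge> 0"
    "\<And>x::complex. (\<integral>\<^sup>+y. ?k ?s x y \<partial>lborel) \<le> ennreal M"
    by (rule pot_bound[OF s t(5) S fin]) (rule that)
  note km = pot_kernel_measurable(1)[OF S, of _ ?s]
  have inner: "?I x z
      \<le> ennreal (4 * M) * ennreal (norm (x - z) powr - t)" if xz: "x \<noteq> z" for x z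
  proof -
    define d where "d = norm (x - z)"
    have d: "d > 0" using xz by (simp add: d_def)
    have pw: "?k p x y * ?n y z
        \<le> ennreal (2 * d powr - t) * (?k ?s x y + ?k ?s z y)"
      if y: "y \<noteq> x" "y \<noteq> z" for y
    proof (cases "y \<in> S")
      case True
      define a b where "a = norm (x - y)" and "b = norm (y - z)"
      have ab: "0 < a" "0 < b" using y by (simp_all add: a_def b_def)
      have dab: "d \<le> a + b"
        using norm_triangle_ineq[of "x - y" "y - z"] by (simp add: d_def a_def b_def)
      have "a powr - p * b powr - q = d powr - t * (d powr t * (a powr - p * b powr - q))"
        using d by (simp add: powr_minus)
      also have "\<dots> \<le> d powr - t * (2 * (a powr - ?s + b powr - ?s))"
        using kernel_product_le[OF ab less_imp_le[OF d] dab t(1,2,3,4)] by (intro mult_left_mono) simp_all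
      finally have le: "a powr - p * b powr - q \<le> (2 * d powr - t) * (a powr - ?s + b powr - ?s)"
        by (simp only: mult_ac)
      have "?k p x y * ?n y z = ennreal (a powr - p * b powr - q)"
        using True by (simp add: a_def b_def ennreal_mult')
      also have "\<dots> \<le> ennreal ((2 * d powr - t) * (a powr - ?s + b powr - ?s))"
        by (rule ennreal_leI[OF le])
      also have "\<dots> = ennreal (2 * d powr - t) * (ennreal (a powr - ?s) + ennreal (b powr - ?s))"
        by (simp only: ennreal_mult' ennreal_plus powr_ge_zero mult_nonneg_nonneg zero_le_numeral)
      finally show ?thesis using True by (simp add: a_def b_def norm_minus_commute[of z y])
    qed simp
    have "?I x z
      \<le> (\<integral>\<^sup>+y. ennreal (2 * d powr - t) * (?k ?s x y + ?k ?s z y) \<partial>lborel)"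
    proof (rule nn_integral_mono_AE)
      show "AE y in lborel. ?k p x y * ?n y z
        \<le> ennreal (2 * d powr - t) * (?k ?s x y + ?k ?s z y)"
        using AE_lborel_neq[of x] AE_lborel_neq[of z] by eventually_elim (rule pw)
    qed
    also have "\<dots> = ennreal (2 * d powr - t) * ((\<integral>\<^sup>+y. ?k ?s x y \<partial>lborel)
        + (\<integral>\<^sup>+y. ?k ?s z y \<partial>lborel))"
      using km by (simp add: nn_integral_cmult nn_integral_add)
    also have "\<dots> \<le> ennreal (2 * d powr - t) * (ennreal M + ennreal M)"
      by (intro mult_left_mono add_mono M(2)) simp
    also have "\<dots> = ennreal (2 * d powr - t * (M + M))"
      by (simp only: ennreal_mult' ennreal_plus[OF M(1) M(1)] mult_nonneg_nonneg powr_ge_zero zero_le_numeral)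
    also have "\<dots> = ennreal ((4 * M) * d powr - t)" by (simp add: algebra_simps)
    also have "\<dots> = ennreal (4 * M) * ennreal (d powr - t)" using M(1) by (simp add: ennreal_mult')
    finally show ?thesis by (simp only: d_def)
  qed
  show ?thesis
  proof (rule that[of "4 * M"])
    show "4 * M \<ge> 0" using M(1) by simp
    fix S' :: "complex set" and v :: "complex \<Rightarrow> ennreal" and x
    assume S' [measurable]: "S' \<in> sets borel" and v [measurable]: "v \<in> borel_measurable borel"
    have "pot p S (pot q S' v) x
        = (\<integral>\<^sup>+y. (\<integral>\<^sup>+z. ?k p x y * (ennreal (indicator S' z * norm (y - z) powr - q) * v z) \<partial>lborel) \<partial>lborel)"
      unfolding pot_def by (rule nn_integral_cong, rule nn_integral_cmult[symmetric]) measurable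
    also have "\<dots> = (\<integral>\<^sup>+z. (\<integral>\<^sup>+y. ?k p x y * (ennreal (indicator S' z * norm (y - z) powr - q) * v z) \<partial>lborel) \<partial>lborel)"
      by (rule lborel_pair.Fubini'[symmetric]) measurable
    also have "\<dots> = (\<integral>\<^sup>+z. (indicator S' z * v z) * ?I x z \<partial>lborel)"
    proof (rule nn_integral_cong)
      fix z
      have "(\<integral>\<^sup>+y. ?k p x y * (ennreal (indicator S' z * norm (y - z) powr - q) * v z) \<partial>lborel)
          = (\<integral>\<^sup>+y. (indicator S' z * v z) * (?k p x y * ?n y z) \<partial>lborel)"
        by (rule nn_integral_cong) (simp add: indicator_def mult_ac)
      also have "\<dots> = (indicator S' z * v z) * ?I x z"
        by (rule nn_integral_cmult) measurable
      finally show "(\<integral>\<^sup>+y. ?k p x y * (ennreal (indicator S' z * norm (y - z) powr - q) * v z) \<partial>lborel)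
          = (indicator S' z * v z) * ?I x z" .
    qed
    also have "\<dots> \<le> (\<integral>\<^sup>+z. ennreal (4 * M) * (ennreal (indicator S' z * norm (x - z) powr - t) * v z) \<partial>lborel)"
    proof (rule nn_integral_mono_AE)
      show "AE z in lborel. (indicator S' z * v z) * ?I x z
          \<le> ennreal (4 * M) * (ennreal (indicator S' z * norm (x - z) powr - t) * v z)"
        using AE_lborel_neq[of x]
      proof eventually_elim
        case (elim z)
        have "(indicator S' z * v z) * ?I x z
          \<le> (indicator S' z * v z) * (ennreal (4 * M) * ennreal (norm (x - z) powr - t))"
          using elim by (intro mult_left_mono inner) auto
        also have "\<dots> = ennreal (4 * M) * (ennreal (indicator S' z * norm (x - z) powr - t) * v z)"
          by (simp add: indicator_def mult_ac)
        finally show ?case .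
      qed
    qed
    also have "\<dots> = ennreal (4 * M) * pot t S' v x"
      unfolding pot_def by (rule nn_integral_cmult) measurable
    finally show "pot p S (pot q S' v) x \<le> ennreal (4 * M) * pot t S' v x" .
  qed
qed

text \<open>The end of the iteration: the kernel has lost its dependence on \<open>x\<close>, and
  the local integral of \<open>v\<close> is a uniform bound.\<close>

lemma pot_0_le: "pot 0 S v x \<le> (\<integral>\<^sup>+y. indicator S y * v y \<partial>lborel)"
  unfolding pot_def
  by (rule nn_integral_mono) (simp add: indicator_def)

lemma norm_cauchy_le:
  assumes "\<And>y. ennreal (norm (h y)) \<le> ennreal C * (indicator S y * w y)" and "w \<in> borel_measurable borel" "S \<in> sets borel"
  shows "ennreal (norm (cauchy h x)) \<le> ennreal C * pot 1 S w x"
proof -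
  have "ennreal (norm (cauchy h x)) \<le> (\<integral>\<^sup>+y. ennreal (norm (h y / (x - y))) \<partial>lborel)"
  proof (cases "integrable lborel (\<lambda>y. h y / (x - y))")
    case True
    then show ?thesis unfolding cauchy_def by (rule integral_norm_bound_ennreal)
  next
    \<comment> \<open>A Bochner integral that does not exist is 0 by convention, so the bound is
      trivial in this case.\<close>
    case False
    then have "cauchy h x = 0" unfolding cauchy_def by (rule not_integrable_integral_eq)
    then show ?thesis by simp
  qed
  also have "\<dots> \<le> (\<integral>\<^sup>+y. ennreal C * (ennreal (indicator S y * norm (x - y) powr - 1) * w y) \<partial>lborel)"
  proof (rule nn_integral_mono)
    fix y
    have "norm (h y / (x - y)) = norm (h y) * norm (x - y) powr - 1"
    proof (cases "x = y")
      case False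
      then show ?thesis unfolding norm_divide by (simp add: powr_minus divide_inverse)
    qed simp
    then have "ennreal (norm (h y / (x - y))) = ennreal (norm (h y)) * ennreal (norm (x - y) powr - 1)"
      by (simp only: ennreal_mult' norm_ge_zero)
    also have "\<dots> \<le> (ennreal C * (indicator S y * w y)) * ennreal (norm (x - y) powr - 1)"
      by (rule mult_right_mono[OF assms(1)]) simp
    also have "\<dots> = ennreal C * (ennreal (indicator S y * norm (x - y) powr - 1) * w y)"
      by (simp add: indicator_def mult_ac)
    finally show "ennreal (norm (h y / (x - y))) \<le> ennreal C * (ennreal (indicator S y * norm (x - y) powr - 1) * w y)" .
  qed
  also have "\<dots> = ennreal C * pot 1 S w x"
    unfolding pot_def by (rule nn_integral_cmult) (use pot_kernel_measurable(1)[OF assms(3)] assms(2) in measurable)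
  finally show ?thesis .
qed

lemma compact_norm_bound:
  fixes q :: "complex \<Rightarrow> complex"
  assumes "continuous_on K q" "compact K"
  obtains B where "B \<ge> 0" "\<And>z. z \<in> K \<Longrightarrow> norm (q z) \<le> B"
proof -
  obtain B where B: "\<forall>z\<in>q ` K. norm z \<le> B"
    using compact_imp_bounded[OF compact_continuous_image[OF assms], unfolded bounded_iff] by blast
  have "norm (q z) \<le> max 0 B" if "z \<in> K" for z
    using B that by (simp add: le_max_iff_disj)
  then show ?thesis using that[of "max 0 B"] by simp
qed

lemma continuous_bump: "continuous_on S (bump x0 \<rho>)" "continuous_on S (cdbar (bump x0 \<rho>))"
  by (rule continuous_on_subset[OF smooth_continuous[OF bump_smooth] subset_UNIV],
      rule continuous_on_subset[OF smooth_continuous[OF cdbar_smooth[OF bump_smooth]] subset_UNIV])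

lemma localized_outside:
  assumes "\<rho> > 0" "z \<notin> cball x0 \<rho>"
  shows "localized x0 \<rho> g h z = 0"
proof -
  have "bump x0 \<rho> z = 0" using assms bump_nonzero_iff[OF assms(1), of x0 z] by auto
  then show ?thesis using cdbar_bump_eq_0[OF assms] by (simp add: localized_def)
qed

lemma bump_lower_bound:
  assumes "0 < r" "r < \<rho>"
  obtains c where "c > 0" "\<And>z. z \<in> cball x0 r \<Longrightarrow> c \<le> norm (bump x0 \<rho> z)"
proof -
  have nz: "bump x0 \<rho> z \<noteq> 0" if "z \<in> cball x0 r" for z
    using that assms bump_nonzero_iff[of \<rho> x0 z] by auto
  have "continuous_on (cball x0 r) (\<lambda>z. inverse (bump x0 \<rho> z))"
    by (rule continuous_on_inverse[OF continuous_bump(1)]) (use nz in blast)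
  then obtain B where B: "B \<ge> 0" "\<And>z. z \<in> cball x0 r \<Longrightarrow> norm (inverse (bump x0 \<rho> z)) \<le> B"
    by (rule compact_norm_bound[OF _ compact_cball]) (rule that)
  show ?thesis
  proof (rule that[of "1 / (B + 1)"])
    show "1 / (B + 1) > 0" using B(1) by simp
    fix z assume z: "z \<in> cball x0 r"
    have "inverse (norm (bump x0 \<rho> z)) \<le> B + 1"
      using B(2)[OF z] by (simp add: norm_inverse)
    then have "inverse (B + 1) \<le> inverse (inverse (norm (bump x0 \<rho> z)))"
      by (rule le_imp_inverse_le) (use nz[OF z] in simp)
    then show "1 / (B + 1) \<le> norm (bump x0 \<rho> z)" by (simp add: inverse_eq_divide)
  qed
qed

text \<open>One round of the bootstrap. The estimate lives on a smaller disc than the potential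
  because the bump function has to be divided out, and it is bounded below only away from the
  boundary of its support.\<close>

lemma weak_cdbar_pot_estimate:
  assumes r: "0 < r" "r < \<rho>" "cball x0 \<rho> \<subseteq> \<Omega>"
    and g: "locally_integrable \<Omega> g" and h: "locally_integrable \<Omega> h" and w: "weak_cdbar \<Omega> g h"
    and v [measurable]: "v \<in> borel_measurable borel"
    and gv: "\<And>z. z \<in> cball x0 \<rho> \<Longrightarrow> ennreal (norm (g z)) \<le> v z"
    and hv: "\<And>z. z \<in> cball x0 \<rho> \<Longrightarrow> ennreal (norm (h z)) \<le> ennreal B * v z" and B: "B \<ge> 0"
  obtains C where "C \<ge> 0"
    "AE x in lborel. x \<in> cball x0 r \<longrightarrow> ennreal (norm (g x)) \<le> ennreal C * pot 1 (cball x0 \<rho>) v x"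
proof -
  have \<rho>: "\<rho> > 0" using r by simp
  obtain c where c: "c > 0" "\<And>z. z \<in> cball x0 r \<Longrightarrow> c \<le> norm (bump x0 \<rho> z)"
    by (rule bump_lower_bound[OF r(1,2)]) (rule that)
  obtain B1 where B1: "B1 \<ge> 0" "\<And>z. z \<in> cball x0 \<rho> \<Longrightarrow> norm (bump x0 \<rho> z) \<le> B1"
    by (rule compact_norm_bound[OF continuous_bump(1) compact_cball]) (rule that)
  obtain B2 where B2: "B2 \<ge> 0" "\<And>z. z \<in> cball x0 \<rho> \<Longrightarrow> norm (cdbar (bump x0 \<rho>) z) \<le> B2"
    by (rule compact_norm_bound[OF continuous_bump(2) compact_cball]) (rule that)
  define C1 where "C1 = B1 * B + B2"
  have C1: "C1 \<ge> 0" using B B1 B2 by (simp add: C1_def)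
  have hb: "ennreal (norm (localized x0 \<rho> g h z)) \<le> ennreal C1 * (indicator (cball x0 \<rho>) z * v z)" for z
  proof (cases "z \<in> cball x0 \<rho>")
    case True
    have "norm (localized x0 \<rho> g h z) \<le> B1 * norm (h z) + B2 * norm (g z)"
      unfolding localized_def
      by (rule order_trans[OF norm_triangle_ineq])
        (simp add: norm_mult add_mono mult_right_mono B1(2)[OF True] B2(2)[OF True])
    then have "ennreal (norm (localized x0 \<rho> g h z)) \<le> ennreal (B1 * norm (h z) + B2 * norm (g z))"
      by (rule ennreal_leI)
    also have "\<dots> = ennreal B1 * ennreal (norm (h z)) + ennreal B2 * ennreal (norm (g z))"
      using B1(1) B2(1) by (simp add: ennreal_mult')
    also have "\<dots> \<le> ennreal B1 * (ennreal B * v z) + ennreal B2 * v z"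
      by (intro add_mono mult_left_mono hv gv True) simp_all
    also have "\<dots> = ennreal C1 * v z"
      using B1(1) B2(1) B by (simp add: C1_def ennreal_mult' distrib_right mult.assoc)
    finally show ?thesis using True by simp
  next
    case False
    then show ?thesis by (simp add: localized_outside[OF \<rho>])
  qed
  have ae: "AE x in lborel. of_real delta_mass * (bump x0 \<rho> x * g x) = cauchy (localized x0 \<rho> g h) x"
    by (rule weak_cdbar_representation[OF \<rho> r(3) g h w])
  let ?C = "C1 / (delta_mass * c)"
  show ?thesis
  proof (rule that[of ?C])
    show "?C \<ge> 0" using C1 c(1) delta_mass_pos by simp
    show "AE x in lborel. x \<in> cball x0 r \<longrightarrow> ennreal (norm (g x)) \<le> ennreal ?C * pot 1 (cball x0 \<rho>) v x"
      using ae
    proof eventually_elim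
      case (elim x)
      show ?case
      proof
        assume x: "x \<in> cball x0 r"
        have mc: "delta_mass * c > 0" using c(1) delta_mass_pos by simp
        have "(delta_mass * c) * norm (g x) \<le> (delta_mass * norm (bump x0 \<rho> x)) * norm (g x)"
          using c(2)[OF x] delta_mass_pos by (intro mult_right_mono mult_left_mono) simp_all
        also have "\<dots> = norm (cauchy (localized x0 \<rho> g h) x)"
          unfolding elim[symmetric] using delta_mass_pos by (simp add: norm_mult)
        finally have "norm (g x) \<le> (1 / (delta_mass * c)) * norm (cauchy (localized x0 \<rho> g h) x)"
          using mc by (simp add: pos_le_divide_eq mult.commute)
        then have "ennreal (norm (g x)) \<le> ennreal ((1 / (delta_mass * c)) * norm (cauchy (localized x0 \<rho> g h) x))"
          by (rule ennreal_leI)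
        also have "\<dots> = ennreal (1 / (delta_mass * c)) * ennreal (norm (cauchy (localized x0 \<rho> g h) x))"
          by (rule ennreal_mult') (use mc in simp)
        also have "\<dots> \<le> ennreal (1 / (delta_mass * c)) * (ennreal C1 * pot 1 (cball x0 \<rho>) v x)"
          by (intro mult_left_mono norm_cauchy_le hb v) simp_all
        also have "\<dots> = ennreal ?C * pot 1 (cball x0 \<rho>) v x"
        proof -
          have "ennreal ?C = ennreal (1 / (delta_mass * c) * C1)" by simp
          also have "\<dots> = ennreal (1 / (delta_mass * c)) * ennreal C1"
            by (rule ennreal_mult') (use mc in simp)
          finally show ?thesis by (simp only: mult.assoc)
        qed
        finally show "ennreal (norm (g x)) \<le> ennreal ?C * pot 1 (cball x0 \<rho>) v x" .
      qed
    qed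
  qed
qed

text \<open>The sum \<open>v\<close> of the two moduli dominates both unknowns and, up to the factor
  \<open>M\<close>, both right-hand sides. The coupled system thus becomes a single inequality
  between \<open>v\<close> and its potential of exponent 1, which is inserted into itself.\<close>

lemma weak_system_locally_bounded:
  assumes R: "R > 0" "cball x0 R \<subseteq> \<Omega>"
    and Am [measurable]: "A \<in> borel_measurable borel" and Bm [measurable]: "B \<in> borel_measurable borel"
    and loc: "locally_integrable \<Omega> A" "locally_integrable \<Omega> B" "locally_integrable \<Omega> HA" "locally_integrable \<Omega> HB"
    and weak: "weak_cdbar \<Omega> A HA" "weak_cdbar \<Omega> B HB"
    and HA: "\<And>z. z \<in> cball x0 R \<Longrightarrow> norm (HA z) \<le> M * norm (B z)"
    and HB: "\<And>z. z \<in> cball x0 R \<Longrightarrow> norm (HB z) \<le> M * norm (A z)" and M: "M \<ge> 0"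
  obtains C where "AE x in lborel. x \<in> cball x0 (R / 4) \<longrightarrow> norm (A x) \<le> C \<and> norm (B x) \<le> C"
proof -
  define v where "v z = ennreal (norm (A z)) + ennreal (norm (B z))" for z
  have v [measurable]: "v \<in> borel_measurable borel" unfolding v_def[abs_def] by measurable
  have step: "\<exists>C\<ge>0. AE x in lborel. x \<in> cball x0 r \<longrightarrow> v x \<le> ennreal C * pot 1 (cball x0 \<rho>) v x"
    if r: "0 < r" "r < \<rho>" "\<rho> \<le> R" for r \<rho>
  proof -
    have sub: "cball x0 \<rho> \<subseteq> \<Omega>" using R r subset_cball[of \<rho> R x0] by blast
    have zR: "z \<in> cball x0 R" if "z \<in> cball x0 \<rho>" for z using that r by auto
    have hA: "ennreal (norm (HA z)) \<le> ennreal M * v z" if "z \<in> cball x0 \<rho>" for z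
    proof -
      have "ennreal (norm (HA z)) \<le> ennreal (M * norm (B z))" by (rule ennreal_leI[OF HA[OF zR[OF that]]])
      also have "\<dots> = ennreal M * ennreal (norm (B z))" by (rule ennreal_mult'[OF M])
      also have "\<dots> \<le> ennreal M * v z" unfolding v_def by (intro mult_left_mono) simp_all
      finally show ?thesis .
    qed
    have hB: "ennreal (norm (HB z)) \<le> ennreal M * v z" if "z \<in> cball x0 \<rho>" for z
    proof -
      have "ennreal (norm (HB z)) \<le> ennreal (M * norm (A z))" by (rule ennreal_leI[OF HB[OF zR[OF that]]])
      also have "\<dots> = ennreal M * ennreal (norm (A z))" by (rule ennreal_mult'[OF M])
      also have "\<dots> \<le> ennreal M * v z" unfolding v_def by (intro mult_left_mono) simp_all
      finally show ?thesis .
    qed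
    have vA: "ennreal (norm (A z)) \<le> v z" and vB: "ennreal (norm (B z)) \<le> v z" for z
      unfolding v_def by simp_all
    obtain C1 where C1: "C1 \<ge> 0" "AE x in lborel. x \<in> cball x0 r \<longrightarrow> ennreal (norm (A x)) \<le> ennreal C1 * pot 1 (cball x0 \<rho>) v x"
      by (rule weak_cdbar_pot_estimate[OF r(1,2) sub loc(1,3) weak(1) v vA hA M]) (assumption, rule that)
    obtain C2 where C2: "C2 \<ge> 0" "AE x in lborel. x \<in> cball x0 r \<longrightarrow> ennreal (norm (B x)) \<le> ennreal C2 * pot 1 (cball x0 \<rho>) v x"
      by (rule weak_cdbar_pot_estimate[OF r(1,2) sub loc(2,4) weak(2) v vB hB M]) (assumption, rule that)
    have "AE x in lborel. x \<in> cball x0 r \<longrightarrow> v x \<le> ennreal (C1 + C2) * pot 1 (cball x0 \<rho>) v x"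
      using C1(2) C2(2)
    proof eventually_elim
      case (elim x)
      show ?case
      proof
        assume x: "x \<in> cball x0 r"
        show "v x \<le> ennreal (C1 + C2) * pot 1 (cball x0 \<rho>) v x"
          using add_mono[OF elim(1)[rule_format, OF x] elim(2)[rule_format, OF x]]
          unfolding v_def ennreal_plus[OF C1(1) C2(1)] distrib_right .
      qed
    qed
    then show ?thesis using C1(1) C2(1) by (intro exI[of _ "C1 + C2"]) simp
  qed
  \<comment> \<open>Each of the three rounds costs one shrinking of the disc, hence four radii from
    \<open>R / 4\<close> to \<open>R\<close>.\<close>
  define S where "S k = cball x0 (real k * R / 4)" for k :: nat
  have Sm [measurable]: "S k \<in> sets borel" for k by (simp add: S_def)
  have Sf: "emeasure lborel (S k) < \<infinity>" for k unfolding S_def by (rule emeasure_lborel_cball_finite)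
  have st: "\<exists>C\<ge>0. AE x in lborel. x \<in> S k \<longrightarrow> v x \<le> ennreal C * pot 1 (S (Suc k)) v x" if "k \<in> {1,2,3}" for k
    unfolding S_def by (rule step) (use that R in auto)
  obtain C1 where C1: "C1 \<ge> 0" "AE x in lborel. x \<in> S 1 \<longrightarrow> v x \<le> ennreal C1 * pot 1 (S 2) v x"
    using st[of 1] by (auto simp: numeral_2_eq_2)
  obtain C2 where C2: "C2 \<ge> 0" "AE x in lborel. x \<in> S 2 \<longrightarrow> v x \<le> ennreal C2 * pot 1 (S 3) v x"
    using st[of 2] by (auto simp: numeral_3_eq_3 numeral_2_eq_2)
  obtain C3 where C3: "C3 \<ge> 0" "AE x in lborel. x \<in> S 3 \<longrightarrow> v x \<le> ennreal C3 * pot 1 (S 4) v x"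
    using st[of 3] by auto
  \<comment> \<open>Two compositions lower the exponent from 1 to 1/2 and from 1/2 to 0. A direct
    passage from 1 to 0 would need the excluded value 1 + 1 - 0 = 2.\<close>
  have ex: "(0::real) \<le> 1/2" "(1/2::real) \<le> 1" "(1 + 1 - 1/2 :: real) < 2" "(0::real) \<le> 0" "(0::real) \<le> 1"
    "(1/2 + 1 - 0 :: real) < 2" by simp_all
  obtain M1 where M1: "M1 \<ge> 0"
    "\<And>S' v x. S' \<in> sets borel \<Longrightarrow> v \<in> borel_measurable borel \<Longrightarrow> pot 1 (S 2) (pot 1 S' v) x \<le> ennreal M1 * pot (1/2) S' v x"
    by (rule pot_pot_le[OF Sm Sf ex(1,2,2,2,3)]) (rule that)
  obtain M2 where M2: "M2 \<ge> 0"
    "\<And>S' v x. S' \<in> sets borel \<Longrightarrow> v \<in> borel_measurable borel \<Longrightarrow> pot (1/2) (S 3) (pot 1 S' v) x \<le> ennreal M2 * pot 0 S' v x"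
    by (rule pot_pot_le[OF Sm Sf ex(4,5,1,5,6)]) (rule that)
  define I where "I = (\<integral>\<^sup>+y. indicator (S 4) y * v y \<partial>lborel)"
  define T where "T = ennreal C1 * (ennreal C2 * (ennreal M1 * (ennreal C3 * (ennreal M2 * I))))"
  have pm: "pot s (S k) v \<in> borel_measurable borel" for s k by (rule pot_measurable[OF Sm v])
  have p2: "pot 1 (S 2) v x \<le> ennreal C2 * (ennreal M1 * (ennreal C3 * (ennreal M2 * I)))" for x
  proof -
    have "pot 1 (S 2) v x \<le> ennreal C2 * pot 1 (S 2) (pot 1 (S 3) v) x"
      by (rule pot_mono_AE[OF Sm pm C2(2)])
    also have "\<dots> \<le> ennreal C2 * (ennreal M1 * pot (1/2) (S 3) v x)"
      by (intro mult_left_mono M1(2) Sm v) simp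
    also have "\<dots> \<le> ennreal C2 * (ennreal M1 * (ennreal C3 * pot (1/2) (S 3) (pot 1 (S 4) v) x))"
      by (intro mult_left_mono pot_mono_AE[OF Sm pm C3(2)]) simp_all
    also have "\<dots> \<le> ennreal C2 * (ennreal M1 * (ennreal C3 * (ennreal M2 * pot 0 (S 4) v x)))"
      by (intro mult_left_mono M2(2) Sm v) simp_all
    also have "\<dots> \<le> ennreal C2 * (ennreal M1 * (ennreal C3 * (ennreal M2 * I)))"
      unfolding I_def by (intro mult_left_mono pot_0_le) simp_all
    finally show ?thesis .
  qed
  have vT: "AE x in lborel. x \<in> S 1 \<longrightarrow> v x \<le> T"
    using C1(2)
  proof eventually_elim
    case (elim x)
    show ?case
    proof
      assume "x \<in> S 1"
      with elim have "v x \<le> ennreal C1 * pot 1 (S 2) v x" by blast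
      also have "\<dots> \<le> T" unfolding T_def by (rule mult_left_mono[OF p2]) simp
      finally show "v x \<le> T" .
    qed
  qed
  \<comment> \<open>Local integrability of the solution enters here; only now do the preceding
    inequalities become bounds by a real number.\<close>
  have "I < \<infinity>"
  proof -
    have S4: "S 4 = cball x0 R" by (simp add: S_def)
    have i: "integrable lborel (\<lambda>z. indicator (S 4) z *\<^sub>R A z)" "integrable lborel (\<lambda>z. indicator (S 4) z *\<^sub>R B z)"
      using loc(1,2) R(2) unfolding S4 locally_integrable_def by simp_all
    have "I = (\<integral>\<^sup>+z. ennreal (norm (indicator (S 4) z *\<^sub>R A z)) + ennreal (norm (indicator (S 4) z *\<^sub>R B z)) \<partial>lborel)"
      unfolding I_def v_def by (rule nn_integral_cong) (simp add: indicator_def)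
    also have "\<dots> = (\<integral>\<^sup>+z. ennreal (norm (indicator (S 4) z *\<^sub>R A z)) \<partial>lborel) + (\<integral>\<^sup>+z. ennreal (norm (indicator (S 4) z *\<^sub>R B z)) \<partial>lborel)"
      by (rule nn_integral_add) measurable
    also have "\<dots> < \<infinity>" using i unfolding integrable_iff_bounded by simp
    finally show ?thesis .
  qed
  then have T: "T < \<infinity>" unfolding T_def by (simp add: ennreal_mult_less_top)
  show ?thesis
  proof (rule that[of "enn2real T"])
    show "AE x in lborel. x \<in> cball x0 (R / 4) \<longrightarrow> norm (A x) \<le> enn2real T \<and> norm (B x) \<le> enn2real T"
      using vT
    proof eventually_elim
      case (elim x)
      show ?case
      proof
        assume "x \<in> cball x0 (R / 4)"
        then have vx: "v x \<le> T" using elim by (simp add: S_def)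
        have Te: "T = ennreal (enn2real T)" using T by simp
        have "ennreal (norm (A x)) \<le> ennreal (enn2real T)" "ennreal (norm (B x)) \<le> ennreal (enn2real T)"
          unfolding Te[symmetric] by (rule order_trans[OF _ vx], simp add: v_def)+
        then show "norm (A x) \<le> enn2real T \<and> norm (B x) \<le> enn2real T" by simp
      qed
    qed
  qed
qed

section \<open>Hoelder representatives\<close>

text \<open>The exponent is fixed at the value that \<open>cauchy_hoelder\<close> produces and
  \<open>cauchy_differentiable\<close> consumes.\<close>

definition hoelder_on :: "complex set \<Rightarrow> (complex \<Rightarrow> complex) \<Rightarrow> bool" where
  "hoelder_on S g \<longleftrightarrow> (\<exists>L\<ge>0. \<forall>x\<in>S. \<forall>y\<in>S. norm (g x - g y) \<le> L * norm (x - y) powr (1/2))"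

lemma hoelder_onI:
  "L \<ge> 0 \<Longrightarrow> (\<And>x y. x \<in> S \<Longrightarrow> y \<in> S \<Longrightarrow> norm (g x - g y) \<le> L * norm (x - y) powr (1/2)) \<Longrightarrow> hoelder_on S g"
  unfolding hoelder_on_def by blast

lemma hoelder_onE:
  assumes "hoelder_on S g"
  obtains L where "L \<ge> 0" "\<And>x y. x \<in> S \<Longrightarrow> y \<in> S \<Longrightarrow> norm (g x - g y) \<le> L * norm (x - y) powr (1/2)"
  using assms unfolding hoelder_on_def by blast

lemma hoelder_on_subset: "hoelder_on S g \<Longrightarrow> T \<subseteq> S \<Longrightarrow> hoelder_on T g"
  unfolding hoelder_on_def by blast

lemma hoelder_imp_continuous_on:
  assumes "hoelder_on S g"
  shows "continuous_on S g"
proof -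
  obtain L where L: "L \<ge> 0" "\<And>x y. x \<in> S \<Longrightarrow> y \<in> S \<Longrightarrow> norm (g x - g y) \<le> L * norm (x - y) powr (1/2)"
    by (rule hoelder_onE[OF assms]) (rule that)
  show ?thesis
    unfolding continuous_on
  proof
    fix x assume x: "x \<in> S"
    have "((\<lambda>y. L * norm (y - x) powr (1/2)) \<longlongrightarrow> 0) (at x within S)"
      by (intro tendsto_mult_right_zero tendsto_zero_powrI[where b = "1/2"] tendsto_norm_zero LIM_zero tendsto_ident_at) auto
    moreover have "\<forall>\<^sub>F y in at x within S. norm (g y - g x) \<le> L * norm (y - x) powr (1/2)"
      using L(2)[OF _ x] by (simp add: eventually_at_filter)
    ultimately have "((\<lambda>y. g y - g x) \<longlongrightarrow> 0) (at x within S)"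
      by (rule Lim_null_comparison[rotated])
    then show "(g \<longlongrightarrow> g x) (at x within S)" by (rule LIM_zero_cancel)
  qed
qed

lemma hoelder_on_mult:
  assumes "compact S" "hoelder_on S g" "hoelder_on S h"
  shows "hoelder_on S (\<lambda>x. g x * h x)"
proof -
  obtain L where L: "L \<ge> 0" "\<And>x y. x \<in> S \<Longrightarrow> y \<in> S \<Longrightarrow> norm (g x - g y) \<le> L * norm (x - y) powr (1/2)"
    by (rule hoelder_onE[OF assms(2)]) (rule that)
  obtain L' where L': "L' \<ge> 0" "\<And>x y. x \<in> S \<Longrightarrow> y \<in> S \<Longrightarrow> norm (h x - h y) \<le> L' * norm (x - y) powr (1/2)"
    by (rule hoelder_onE[OF assms(3)]) (rule that)
  obtain B where B: "B \<ge> 0" "\<And>z. z \<in> S \<Longrightarrow> norm (g z) \<le> B"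
    by (rule compact_norm_bound[OF hoelder_imp_continuous_on[OF assms(2)] assms(1)]) (rule that)
  obtain B' where B': "B' \<ge> 0" "\<And>z. z \<in> S \<Longrightarrow> norm (h z) \<le> B'"
    by (rule compact_norm_bound[OF hoelder_imp_continuous_on[OF assms(3)] assms(1)]) (rule that)
  show ?thesis
  proof (rule hoelder_onI[of "L * B' + B * L'"])
    fix x y assume xy: "x \<in> S" "y \<in> S"
    have "g x * h x - g y * h y = (g x - g y) * h x + g y * (h x - h y)" by (simp add: algebra_simps)
    then have "norm (g x * h x - g y * h y) \<le> norm (g x - g y) * norm (h x) + norm (g y) * norm (h x - h y)"
      by (metis norm_triangle_ineq norm_mult)
    also have "\<dots> \<le> (L * norm (x - y) powr (1/2)) * B' + B * (L' * norm (x - y) powr (1/2))"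
      using xy L L' B B' by (intro add_mono mult_mono) simp_all
    finally show "norm (g x * h x - g y * h y) \<le> (L * B' + B * L') * norm (x - y) powr (1/2)"
      by (simp add: algebra_simps)
  qed (use L L' B B' in simp)
qed

section \<open>First-order calculus relative to a set\<close>

lemma Ck1_restrict:
  "g \<in> Ck_space (Suc 0) \<Omega> \<Longrightarrow> S \<subseteq> \<Omega> \<Longrightarrow> g \<in> Ck_space (Suc 0) S"
  unfolding Ck_Suc_iff Ck_space.simps(1) mem_Collect_eq by (blast intro: continuous_on_subset)

lemma Ck1_intro:
  assumes "\<And>z. z \<in> \<Omega> \<Longrightarrow> (g has_derivative g' z) (at z)"
    and "continuous_on \<Omega> (\<lambda>z. g' z 1)" "continuous_on \<Omega> (\<lambda>z. g' z \<i>)"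
  shows "g \<in> Ck_space (Suc 0) \<Omega>"
proof -
  have "dir_deriv e g z = g' z e" if "z \<in> \<Omega>" for e z
    by (rule dir_deriv_has_derivative[OF assms(1)[OF that]])
  then have "continuous_on \<Omega> (dir_deriv 1 g)" "continuous_on \<Omega> (dir_deriv \<i> g)"
    using assms(2,3) by (simp_all cong: continuous_on_cong)
  then show ?thesis
    using assms(1) unfolding Ck_Suc_iff Ck_space.simps(1) differentiable_def by blast
qed

lemma Ck1_mult:
  assumes g: "g \<in> Ck_space (Suc 0) \<Omega>" and h: "h \<in> Ck_space (Suc 0) \<Omega>"
  shows "(\<lambda>z. g z * h z) \<in> Ck_space (Suc 0) \<Omega>"
proof (rule Ck1_intro[OF has_derivative_mult[OF Ck_Suc_has_derivative[OF g] Ck_Suc_has_derivative[OF h]]])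
  have c: "continuous_on \<Omega> g" "continuous_on \<Omega> h" "continuous_on \<Omega> (dir_deriv 1 g)" "continuous_on \<Omega> (dir_deriv \<i> g)"
    "continuous_on \<Omega> (dir_deriv 1 h)" "continuous_on \<Omega> (dir_deriv \<i> h)"
    using Ck_space_SucD[OF g] Ck_space_SucD[OF h] Ck_space_dir_deriv[OF g] Ck_space_dir_deriv[OF h] by simp_all
  show "continuous_on \<Omega> (\<lambda>z. g z * (of_real (Re 1) * dir_deriv 1 h z + of_real (Im 1) * dir_deriv \<i> h z)
      + (of_real (Re 1) * dir_deriv 1 g z + of_real (Im 1) * dir_deriv \<i> g z) * h z)"
    by (intro continuous_intros c)
  show "continuous_on \<Omega> (\<lambda>z. g z * (of_real (Re \<i>) * dir_deriv 1 h z + of_real (Im \<i>) * dir_deriv \<i> h z)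
      + (of_real (Re \<i>) * dir_deriv 1 g z + of_real (Im \<i>) * dir_deriv \<i> g z) * h z)"
    by (intro continuous_intros c)
qed

lemma Ck1_inverse:
  assumes g: "g \<in> Ck_space (Suc 0) \<Omega>" and nz: "\<And>z. z \<in> \<Omega> \<Longrightarrow> g z \<noteq> 0"
  shows "(\<lambda>z. inverse (g z)) \<in> Ck_space (Suc 0) \<Omega>"
proof (rule Ck1_intro[OF Deriv.has_derivative_inverse[OF nz Ck_Suc_has_derivative[OF g]]])
  have c: "continuous_on \<Omega> g" "continuous_on \<Omega> (dir_deriv 1 g)" "continuous_on \<Omega> (dir_deriv \<i> g)"
    using Ck_space_SucD[OF g] Ck_space_dir_deriv[OF g] by simp_all
  have ci: "continuous_on \<Omega> (\<lambda>z. inverse (g z))"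
    by (rule continuous_on_inverse[OF c(1)]) (use nz in blast)
  show "continuous_on \<Omega> (\<lambda>z. - (inverse (g z) * (of_real (Re 1) * dir_deriv 1 g z + of_real (Im 1) * dir_deriv \<i> g z) * inverse (g z)))"
    by (intro continuous_on_minus continuous_on_mult continuous_on_add continuous_on_const c ci)
  show "continuous_on \<Omega> (\<lambda>z. - (inverse (g z) * (of_real (Re \<i>) * dir_deriv 1 g z + of_real (Im \<i>) * dir_deriv \<i> g z) * inverse (g z)))"
    by (intro continuous_on_minus continuous_on_mult continuous_on_add continuous_on_const c ci)
qed

lemma Ck1_const: "(\<lambda>z. c) \<in> Ck_space (Suc 0) \<Omega>"
  by (rule Ck1_restrict[OF Ck_const subset_UNIV])

lemma Ck1_hoelder:
  assumes g: "g \<in> Ck_space (Suc 0) \<Omega>" and S: "cball x0 r \<subseteq> \<Omega>"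
  shows "hoelder_on (cball x0 r) g"
proof -
  have c: "continuous_on (cball x0 r) (dir_deriv 1 g)" "continuous_on (cball x0 r) (dir_deriv \<i> g)"
    using Ck_space_dir_deriv[OF Ck1_restrict[OF g S]] by simp_all
  obtain B1 where B1: "B1 \<ge> 0" "\<And>z. z \<in> cball x0 r \<Longrightarrow> norm (dir_deriv 1 g z) \<le> B1"
    by (rule compact_norm_bound[OF c(1) compact_cball]) (rule that)
  obtain B2 where B2: "B2 \<ge> 0" "\<And>z. z \<in> cball x0 r \<Longrightarrow> norm (dir_deriv \<i> g z) \<le> B2"
    by (rule compact_norm_bound[OF c(2) compact_cball]) (rule that)
  have lip: "norm (g x - g y) \<le> (B1 + B2) * norm (x - y)" if "x \<in> cball x0 r" "y \<in> cball x0 r" for x y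
    by (rule Ck1_lipschitz[OF g S convex_cball B1(2) B2(2) that])
  show ?thesis
  proof (rule hoelder_onI[of "(B1 + B2) * (2 * \<bar>r\<bar>) powr (1/2)"])
    fix x y assume xy: "x \<in> cball x0 r" "y \<in> cball x0 r"
    have "norm (x - y) = dist x y" by (simp add: dist_norm)
    also have "\<dots> \<le> dist x x0 + dist x0 y" by (rule dist_triangle)
    also have "\<dots> \<le> 2 * \<bar>r\<bar>" using xy by (simp add: dist_commute)
    finally have d: "norm (x - y) \<le> 2 * \<bar>r\<bar>" .
    have "norm (x - y) = norm (x - y) powr (1/2) * norm (x - y) powr (1/2)"
      by (simp add: powr_half_sqrt)
    also have "\<dots> \<le> (2 * \<bar>r\<bar>) powr (1/2) * norm (x - y) powr (1/2)"
      by (intro mult_right_mono powr_mono2 d) simp_all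
    finally have "(B1 + B2) * norm (x - y) \<le> (B1 + B2) * ((2 * \<bar>r\<bar>) powr (1/2) * norm (x - y) powr (1/2))"
      using B1(1) B2(1) by (intro mult_left_mono) simp_all
    then show "norm (g x - g y) \<le> (B1 + B2) * (2 * \<bar>r\<bar>) powr (1/2) * norm (x - y) powr (1/2)"
      using lip[OF xy] by (simp only: mult.assoc)
  qed (use B1(1) B2(1) in simp)
qed

section \<open>Hoelder representatives, locally and glued together\<close>

text \<open>Bounded data have a Hoelder continuous transform. Dividing by the bump, which is C^1 and
  non-zero on the disc of half the radius, turns it into a representative of
  \<open>g\<close>.\<close>

lemma bounded_weak_solution_hoelder:
  assumes r: "0 < r" "cball x0 r \<subseteq> \<Omega>"
    and loc: "locally_integrable \<Omega> g" "locally_integrable \<Omega> h" and weak: "weak_cdbar \<Omega> g h"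
    and meas [measurable]: "g \<in> borel_measurable borel" "h \<in> borel_measurable borel"
    and bd: "AE x in lborel. x \<in> cball x0 r \<longrightarrow> norm (g x) \<le> C \<and> norm (h x) \<le> C"
  obtains G where "hoelder_on (cball x0 (r / 2)) G" "AE x in lborel. x \<in> cball x0 (r / 2) \<longrightarrow> g x = G x"
proof -
  let ?H = "localized x0 r g h"
  have [measurable]: "bump x0 r \<in> borel_measurable borel" "cdbar (bump x0 r) \<in> borel_measurable borel"
    using continuous_bump[of UNIV] by (auto intro: borel_measurable_continuous_onI)
  have Hm [measurable]: "?H \<in> borel_measurable borel"
    unfolding localized_def[abs_def] by measurable
  obtain B1 where B1: "B1 \<ge> 0" "\<And>z. z \<in> cball x0 r \<Longrightarrow> norm (bump x0 r z) \<le> B1"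
    by (rule compact_norm_bound[OF continuous_bump(1) compact_cball]) (rule that)
  obtain B2 where B2: "B2 \<ge> 0" "\<And>z. z \<in> cball x0 r \<Longrightarrow> norm (cdbar (bump x0 r) z) \<le> B2"
    by (rule compact_norm_bound[OF continuous_bump(2) compact_cball]) (rule that)
  define C' where "C' = B1 * \<bar>C\<bar> + B2 * \<bar>C\<bar>"
  have C': "C' \<ge> 0" using B1(1) B2(1) by (simp add: C'_def)
  \<comment> \<open>\<open>cauchy_hoelder\<close> asks for a bound at every point. The truncation
    changes the density on a null set only, hence does not change its transform.\<close>
  define H' where "H' z = (if norm (?H z) \<le> C' then ?H z else 0)" for z
  have H'm [measurable]: "H' \<in> borel_measurable borel" unfolding H'_def[abs_def] by measurable
  have H'b: "norm (H' z) \<le> C' * indicator (cball x0 r) z" for z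
    using C' localized_outside[OF r(1), of z x0 g h] by (cases "z \<in> cball x0 r") (auto simp: H'_def)
  have aeH: "AE z in lborel. ?H z = H' z"
    using bd
  proof eventually_elim
    case (elim z)
    show ?case
    proof (cases "z \<in> cball x0 r")
      case True
      then have gh: "norm (g z) \<le> \<bar>C\<bar>" "norm (h z) \<le> \<bar>C\<bar>" using elim by auto
      have "norm (?H z) \<le> norm (bump x0 r z) * norm (h z) + norm (cdbar (bump x0 r) z) * norm (g z)"
        unfolding localized_def by (rule order_trans[OF norm_triangle_ineq]) (simp add: norm_mult)
      also have "\<dots> \<le> C'"
        unfolding C'_def by (intro add_mono mult_mono B1 B2 True gh) simp_all
      finally show ?thesis by (simp add: H'_def)
    next
      case False
      then show ?thesis by (simp add: H'_def localized_outside[OF r(1)])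
    qed
  qed
  have ceq: "cauchy ?H x = cauchy H' x" for x
    unfolding cauchy_def
    by (rule integral_cong_AE) (measurable, use aeH in \<open>auto elim: eventually_mono\<close>)
  obtain K where K: "K \<ge> 0" "\<And>x x'. norm (cauchy H' x - cauchy H' x') \<le> K * norm (x - x') powr (1/2)"
    by (rule cauchy_hoelder[OF H'm borel_closed[OF closed_cball] emeasure_lborel_cball_finite H'b C']) (rule that)
  have ch: "hoelder_on S (cauchy H')" for S
    by (rule hoelder_onI[OF K])
  have bnz: "bump x0 r z \<noteq> 0" if "z \<in> ball x0 r" for z
    using that bump_nonzero_iff[OF r(1)] by blast
  have sub: "cball x0 (r / 2) \<subseteq> ball x0 r" using r(1) by auto
  have cancel: "y = (c * (b * y)) * (inverse c * inverse b)" if "b \<noteq> 0" "c \<noteq> 0" for y b c :: complex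
    using that by (simp add: field_simps)
  define G where "G x = cauchy H' x * (inverse (of_real delta_mass) * inverse (bump x0 r x))" for x
  have binv: "(\<lambda>x. inverse (of_real delta_mass) * inverse (bump x0 r x)) \<in> Ck_space (Suc 0) (ball x0 r)"
    by (intro Ck1_mult Ck1_const Ck1_inverse Ck1_restrict[OF bump_smooth subset_UNIV] bnz)
  show ?thesis
  proof (rule that[of G])
    show "hoelder_on (cball x0 (r / 2)) G"
      unfolding G_def[abs_def]
      by (rule hoelder_on_mult[OF compact_cball ch Ck1_hoelder[OF binv sub]])
    show "AE x in lborel. x \<in> cball x0 (r / 2) \<longrightarrow> g x = G x"
      using weak_cdbar_representation[OF r loc weak]
    proof eventually_elim
      case (elim x)
      show ?case
      proof
        assume "x \<in> cball x0 (r / 2)"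
        then have "bump x0 r x \<noteq> 0" using sub bnz by blast
        moreover have "complex_of_real delta_mass \<noteq> 0" using delta_mass_pos by simp
        ultimately show "g x = G x"
          unfolding G_def ceq[symmetric] elim[symmetric] by (rule cancel)
      qed
    qed
  qed
qed

lemma continuous_AE_eq_open:
  fixes g h :: "complex \<Rightarrow> complex"
  assumes T: "open T" and c: "continuous_on T g" "continuous_on T h"
    and ae: "AE x in lborel. x \<in> T \<longrightarrow> g x = h x" and x: "x \<in> T"
  shows "g x = h x"
proof (rule ccontr)
  assume ne: "g x \<noteq> h x"
  define S where "S = T \<inter> (\<lambda>x. g x - h x) -` (- {0})"
  have "open S"
    unfolding S_def by (rule continuous_open_preimage[OF continuous_on_diff[OF c] T open_Compl[OF closed_singleton]])
  moreover have "x \<in> S" using x ne by (simp add: S_def)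
  ultimately have "\<not> negligible S" using open_not_negligible by blast
  moreover have "S \<in> null_sets lborel"
  proof -
    have "S \<in> sets lborel" using \<open>open S\<close> by simp
    moreover have "AE x in lborel. x \<notin> S"
      using ae by eventually_elim (simp add: S_def)
    ultimately show ?thesis by (simp add: AE_iff_null_sets)
  qed
  then have "negligible S"
    using null_sets_completionI negligible_iff_null_sets by blast
  ultimately show False by blast
qed

text \<open>Two local representatives agree on overlaps, being continuous and almost everywhere
  equal to \<open>A\<close>, so reading off each one at the centre of its own disc gives a
  consistent function. A Lindelof subcover keeps the exceptional null sets countable in
  number.\<close>

lemma glue_hoelder:
  fixes A :: "complex \<Rightarrow> complex"
  assumes loc: "\<And>x. x \<in> \<Omega> \<Longrightarrow> \<exists>r>0. \<exists>G. cball x r \<subseteq> \<Omega> \<and> hoelder_on (cball x r) G \<and>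
      (AE z in lborel. z \<in> cball x r \<longrightarrow> A z = G z)"
  obtains G where "\<And>x. x \<in> \<Omega> \<Longrightarrow> \<exists>r>0. cball x r \<subseteq> \<Omega> \<and> hoelder_on (cball x r) G"
    "AE z in lborel. z \<in> \<Omega> \<longrightarrow> A z = G z"
proof -
  have "\<forall>x\<in>\<Omega>. \<exists>r. r > 0 \<and> (\<exists>G. cball x r \<subseteq> \<Omega> \<and> hoelder_on (cball x r) G \<and>
      (AE z in lborel. z \<in> cball x r \<longrightarrow> A z = G z))"
    by (intro ballI loc)
  from bchoice[OF this] obtain r where r: "\<forall>x\<in>\<Omega>. r x > 0 \<and> (\<exists>G. cball x (r x) \<subseteq> \<Omega> \<and> hoelder_on (cball x (r x)) G \<and>
      (AE z in lborel. z \<in> cball x (r x) \<longrightarrow> A z = G z))" by (elim exE)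
  then have "\<forall>x\<in>\<Omega>. \<exists>G. cball x (r x) \<subseteq> \<Omega> \<and> hoelder_on (cball x (r x)) G \<and>
      (AE z in lborel. z \<in> cball x (r x) \<longrightarrow> A z = G z)" by blast
  from bchoice[OF this] obtain g where g: "\<forall>x\<in>\<Omega>. cball x (r x) \<subseteq> \<Omega> \<and> hoelder_on (cball x (r x)) (g x) \<and>
      (AE z in lborel. z \<in> cball x (r x) \<longrightarrow> A z = g x z)" by (elim exE)
  have rg: "\<And>x. x \<in> \<Omega> \<Longrightarrow> r x > 0" "\<And>x. x \<in> \<Omega> \<Longrightarrow> cball x (r x) \<subseteq> \<Omega>"
    "\<And>x. x \<in> \<Omega> \<Longrightarrow> hoelder_on (cball x (r x)) (g x)"
    "\<And>x. x \<in> \<Omega> \<Longrightarrow> AE z in lborel. z \<in> cball x (r x) \<longrightarrow> A z = g x z"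
    using r g by blast+
  define G where "G z = g z z" for z
  have eq: "G z = g x z" if x: "x \<in> \<Omega>" and z: "z \<in> ball x (r x)" for x z
  proof -
    have zO: "z \<in> \<Omega>" using z rg(2)[OF x] by auto
    let ?T = "ball x (r x) \<inter> ball z (r z)"
    have "g z z = g x z"
    proof (rule continuous_AE_eq_open[of ?T "g z" "g x" z])
      show "continuous_on ?T (g z)"
        by (rule continuous_on_subset[OF hoelder_imp_continuous_on[OF rg(3)[OF zO]]]) auto
      show "continuous_on ?T (g x)"
        by (rule continuous_on_subset[OF hoelder_imp_continuous_on[OF rg(3)[OF x]]]) auto
      show "AE w in lborel. w \<in> ?T \<longrightarrow> g z w = g x w"
        using rg(4)[OF x] rg(4)[OF zO] by eventually_elim auto
      show "z \<in> ?T" using z rg(1)[OF zO] by simp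
    qed auto
    then show ?thesis by (simp add: G_def)
  qed
  show ?thesis
  proof (rule that[of G])
    fix x assume x: "x \<in> \<Omega>"
    have sub: "cball x (r x / 2) \<subseteq> ball x (r x)" using rg(1)[OF x] by auto
    have "hoelder_on (cball x (r x / 2)) (g x)"
      by (rule hoelder_on_subset[OF rg(3)[OF x]]) (use rg(1)[OF x] in auto)
    then have "hoelder_on (cball x (r x / 2)) G"
      unfolding hoelder_on_def using eq[OF x subsetD[OF sub]] by simp
    moreover have "cball x (r x / 2) \<subseteq> \<Omega>" using sub rg(2)[OF x] ball_subset_cball by blast
    ultimately show "\<exists>r>0. cball x r \<subseteq> \<Omega> \<and> hoelder_on (cball x r) G"
      using rg(1)[OF x] by (intro exI[of _ "r x / 2"]) simp
  next
    obtain F where F: "F \<subseteq> (\<lambda>x. ball x (r x)) ` \<Omega>" "countable F" "\<Union>F = \<Union>((\<lambda>x. ball x (r x)) ` \<Omega>)"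
      using Lindelof[of "(\<lambda>x. ball x (r x)) ` \<Omega>"] by auto
    have "AE z in lborel. z \<in> U \<longrightarrow> A z = G z" if UF: "U \<in> F" for U
    proof -
      obtain x where x: "x \<in> \<Omega>" "U = ball x (r x)" using F(1) UF by blast
      show ?thesis
        using rg(4)[OF x(1)] by eventually_elim (simp add: x eq[OF x(1)])
    qed
    then have "AE z in lborel. \<forall>U\<in>F. z \<in> U \<longrightarrow> A z = G z"
      unfolding AE_ball_countable[OF F(2)] by blast
    then show "AE z in lborel. z \<in> \<Omega> \<longrightarrow> A z = G z"
    proof eventually_elim
      case (elim z)
      show ?case
      proof
        assume z: "z \<in> \<Omega>"
        then have "z \<in> \<Union>F" unfolding F(3) using rg(1)[OF z] by (intro UN_I[of z]) simp_all
        then show "A z = G z" using elim by blast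
      qed
    qed
  qed
qed

section \<open>Continuous differentiability\<close>

lemma continuous_localized:
  assumes \<Omega>: "open \<Omega>" and \<rho>: "\<rho> > 0" "cball x0 \<rho> \<subseteq> \<Omega>"
    and g: "continuous_on \<Omega> g" and h: "continuous_on \<Omega> h"
  shows "continuous_on UNIV (localized x0 \<rho> g h)"
proof (rule continuous_on_zero_extension[OF \<Omega> closed_cball \<rho>(2)])
  show "continuous_on \<Omega> (localized x0 \<rho> g h)"
    unfolding localized_def[abs_def] by (intro continuous_on_add continuous_on_mult continuous_bump g h)
qed (rule localized_outside[OF \<rho>(1)])

lemma localized_lin:
  "localized x0 \<rho> (\<lambda>z. g z - c1 * p1 z - c2 * p2 z) (\<lambda>z. h z - c1 * q1 z - c2 * q2 z) z =
    localized x0 \<rho> g h z - c1 * localized x0 \<rho> p1 q1 z - c2 * localized x0 \<rho> p2 q2 z"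
  by (simp add: localized_def algebra_simps)

text \<open>Subtracting from \<open>A\<close> the combination of the regular solutions \<open>P1\<close>, \<open>P2\<close> that agrees with
  it at \<open>x\<close> leaves a solution whose right-hand side vanishes at \<open>x\<close> to order \<open>1/2\<close>, so
  its Cauchy transform is complex differentiable there.\<close>

lemma weak_solution_C1:
  assumes \<Omega>: "open \<Omega>" and \<rho>: "\<rho> > 0" "cball x0 \<rho> \<subseteq> \<Omega>"
    and P: "P1 \<in> Ck_space (Suc 0) \<Omega>" "P2 \<in> Ck_space (Suc 0) \<Omega>"
    and cA: "continuous_on \<Omega> A" and cH: "continuous_on \<Omega> H" "continuous_on \<Omega> H1" "continuous_on \<Omega> H2"
    and weak: "weak_cdbar \<Omega> A H" "weak_cdbar \<Omega> P1 H1" "weak_cdbar \<Omega> P2 H2"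
    and c: "continuous_on (ball x0 \<rho>) c1" "continuous_on (ball x0 \<rho>) c2"
    and bA: "\<And>x y. x \<in> ball x0 \<rho> \<Longrightarrow> y \<in> cball x0 \<rho> \<Longrightarrow>
      norm (A y - c1 x * P1 y - c2 x * P2 y) \<le> C * norm (x - y) powr (1/2)"
    and bH: "\<And>x y. x \<in> ball x0 \<rho> \<Longrightarrow> y \<in> cball x0 \<rho> \<Longrightarrow>
      norm (H y - c1 x * H1 y - c2 x * H2 y) \<le> C * norm (x - y) powr (1/2)" and C: "C \<ge> 0"
  shows "A \<in> Ck_space (Suc 0) (ball x0 \<rho>)"
    "\<And>x. x \<in> ball x0 \<rho> \<Longrightarrow> cdbar A x = c1 x * cdbar P1 x + c2 x * cdbar P2 x"
proof -
  let ?U = "ball x0 \<rho>"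
  have UO: "?U \<subseteq> \<Omega>" using \<rho>(2) ball_subset_cball by blast
  have cP: "continuous_on \<Omega> P1" "continuous_on \<Omega> P2"
    using P[THEN Ck_space_SucD] by simp_all
  note li = continuous_locally_integrable
  define g where "g x y = A y - c1 x * P1 y - c2 x * P2 y" for x y
  define h where "h x y = H y - c1 x * H1 y - c2 x * H2 y" for x y
  define L where "L x = localized x0 \<rho> (g x) (h x)" for x
  have gc: "continuous_on \<Omega> (g x)" and hc: "continuous_on \<Omega> (h x)" for x
    unfolding g_def[abs_def] h_def[abs_def] by (intro continuous_intros cA cP cH)+
  have w: "weak_cdbar \<Omega> (g x) (h x)" for x
  proof -
    have 1: "weak_cdbar \<Omega> (\<lambda>z. A z - c1 x * P1 z) (\<lambda>z. H z - c1 x * H1 z)"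
      by (rule weak_cdbar_lin[OF weak(1,2)]) (intro li cA cP cH)+
    have "weak_cdbar \<Omega> (\<lambda>z. (A z - c1 x * P1 z) - c2 x * P2 z) (\<lambda>z. (H z - c1 x * H1 z) - c2 x * H2 z)"
      by (rule weak_cdbar_lin[OF 1 weak(3)]) (intro li continuous_on_diff continuous_on_mult continuous_on_const cA cP cH)+
    then show ?thesis unfolding g_def[abs_def] h_def[abs_def] .
  qed
  have Lc: "continuous_on UNIV (L x)" for x
    unfolding L_def by (rule continuous_localized[OF \<Omega> \<rho> gc hc])
  have Lm: "L x \<in> borel_measurable borel" for x by (rule borel_measurable_continuous_onI[OF Lc])
  \<comment> \<open>The point \<open>x\<close> enters only through the coefficients
    \<open>c1 x\<close> and \<open>c2 x\<close>; this gives the continuity in \<open>x\<close> that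
    the derivative formula requires.\<close>
  have Leq: "L x y = localized x0 \<rho> A H y - c1 x * localized x0 \<rho> P1 H1 y - c2 x * localized x0 \<rho> P2 H2 y" for x y
    unfolding L_def g_def[abs_def] h_def[abs_def] by (rule localized_lin)
  obtain B1 where B1: "B1 \<ge> 0" "\<And>z. z \<in> cball x0 \<rho> \<Longrightarrow> norm (bump x0 \<rho> z) \<le> B1"
    by (rule compact_norm_bound[OF continuous_bump(1) compact_cball]) (rule that)
  obtain B2 where B2: "B2 \<ge> 0" "\<And>z. z \<in> cball x0 \<rho> \<Longrightarrow> norm (cdbar (bump x0 \<rho>) z) \<le> B2"
    by (rule compact_norm_bound[OF continuous_bump(2) compact_cball]) (rule that)
  define K where "K = (B1 + B2) * C"
  have K: "K \<ge> 0" using B1(1) B2(1) C by (simp add: K_def)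
  have Lb: "norm (L x y) \<le> K * indicator (cball x0 \<rho>) y * norm (x - y) powr (1/2)" if x: "x \<in> ?U" for x y
  proof (cases "y \<in> cball x0 \<rho>")
    case True
    have "norm (L x y) \<le> norm (bump x0 \<rho> y) * norm (h x y) + norm (cdbar (bump x0 \<rho>) y) * norm (g x y)"
      unfolding L_def localized_def by (rule order_trans[OF norm_triangle_ineq]) (simp add: norm_mult)
    also have "\<dots> \<le> B1 * (C * norm (x - y) powr (1/2)) + B2 * (C * norm (x - y) powr (1/2))"
      unfolding g_def h_def by (intro add_mono mult_mono B1 B2 True bA[OF x True] bH[OF x True]) simp_all
    also have "\<dots> = K * norm (x - y) powr (1/2)" by (simp add: K_def algebra_simps)
    finally show ?thesis using True by simp
  next
    case False
    then show ?thesis by (simp add: L_def localized_outside[OF \<rho>(1)])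
  qed
  \<comment> \<open>The complex derivative of \<open>g x\<close> at \<open>x\<close>. The transform
    vanishes there, so in the product rule the derivative of the reciprocal of the bump drops
    out.\<close>
  define D where "D x = - (LINT y|lborel. L x y / (x - y)\<^sup>2) * inverse (of_real delta_mass * bump x0 \<rho> x)" for x
  have bnz: "of_real delta_mass * bump x0 \<rho> z \<noteq> 0" if "z \<in> ?U" for z
    using that bump_nonzero_iff[OF \<rho>(1), of x0 z] delta_mass_pos by simp
  have Dc: "continuous_on ?U D"
  proof -
    have "continuous_on ?U (\<lambda>x. LINT y|lborel. L x y / (x - y)\<^sup>2)"
    proof (rule cauchy_kernel2_continuous[OF ball_subset_cball \<rho>(1) K Lm Lb])
      fix t
      have s: "continuous_on ?U (\<lambda>x. q (x - t))" if "continuous_on UNIV q" for q :: "complex \<Rightarrow> complex"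
        by (rule continuous_on_compose2[OF that]) (auto intro!: continuous_intros)
      show "continuous_on ?U (\<lambda>x. L x (x - t))"
        unfolding Leq
        by (intro continuous_on_diff continuous_on_mult c s continuous_localized[OF \<Omega> \<rho>] cA cP cH)
    qed
    then show ?thesis
      unfolding D_def[abs_def]
      by (intro continuous_on_mult continuous_on_minus continuous_on_inverse continuous_on_const continuous_bump)
        (assumption, intro ballI bnz)
  qed
  have gD: "(g x has_derivative (\<lambda>v. D x * v)) (at x)" if x: "x \<in> ?U" for x
  proof -
    define E where "E = cauchy (L x)"
    have KR: "norm (L x y) \<le> (K * (2 * \<rho>) powr (1/2)) * indicator (cball x0 \<rho>) y" for y
    proof (cases "y \<in> cball x0 \<rho>")
      case True
      have "norm (x - y) = dist x y" by (simp add: dist_norm)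
      also have "\<dots> \<le> dist x x0 + dist x0 y" by (rule dist_triangle)
      also have "\<dots> \<le> 2 * \<rho>" using True x by (simp add: dist_commute)
      finally have "norm (x - y) powr (1/2) \<le> (2 * \<rho>) powr (1/2)" by (intro powr_mono2) simp_all
      then have "K * norm (x - y) powr (1/2) \<le> K * (2 * \<rho>) powr (1/2)" using K by (rule mult_left_mono)
      then show ?thesis using Lb[OF x, of y] True by simp
    next
      case False
      then show ?thesis using Lb[OF x, of y] by simp
    qed
    define K' where "K' = max K (K * (2 * \<rho>) powr (1/2))"
    have K': "K' \<ge> 0" using K by (simp add: K'_def)
    have Lb': "norm (L x y) \<le> K' * indicator (cball x0 \<rho>) y" for y
      using KR[of y] by (cases "y \<in> cball x0 \<rho>") (auto simp: K'_def le_max_iff_disj)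
    have Lb'': "norm (L x y) \<le> K' * indicator (cball x0 \<rho>) y * norm (x - y) powr (1/2)" for y
    proof -
      have "K * indicator (cball x0 \<rho>) y * norm (x - y) powr (1/2) \<le> K' * indicator (cball x0 \<rho>) y * norm (x - y) powr (1/2)"
        by (intro mult_right_mono) (simp_all add: K'_def)
      then show ?thesis using Lb[OF x, of y] by (rule order_trans[rotated])
    qed
    have ED: "(E has_field_derivative - (LINT y|lborel. L x y / (x - y)\<^sup>2)) (at x)"
      unfolding E_def
      by (rule cauchy_differentiable[OF Lm borel_closed[OF closed_cball] emeasure_lborel_cball_finite Lb' Lb'' K'])
    obtain M where M: "M \<ge> 0" "\<And>y y'. norm (cauchy (L x) y - cauchy (L x) y') \<le> M * norm (y - y') powr (1/2)"
      by (rule cauchy_hoelder[OF Lm borel_closed[OF closed_cball] emeasure_lborel_cball_finite Lb' K']) (rule that)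
    have Ec: "continuous_on ?U E"
      unfolding E_def by (rule hoelder_imp_continuous_on[OF hoelder_onI[OF M]])
    have ae: "AE y in lborel. of_real delta_mass * (bump x0 \<rho> y * g x y) = E y"
      unfolding E_def L_def
      by (rule weak_cdbar_representation[OF \<rho> li[OF gc] li[OF hc] w])
    \<comment> \<open>Both sides are continuous, so the identity extends from almost every point to
      every point, including \<open>x\<close>.\<close>
    have eq: "of_real delta_mass * (bump x0 \<rho> y * g x y) = E y" if y: "y \<in> ?U" for y
    proof (rule continuous_AE_eq_open[of ?U "\<lambda>y. of_real delta_mass * (bump x0 \<rho> y * g x y)" E y])
      show "continuous_on ?U (\<lambda>y. of_real delta_mass * (bump x0 \<rho> y * g x y))"
        by (intro continuous_on_mult continuous_on_const continuous_bump continuous_on_subset[OF gc UO])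
      show "AE y in lborel. y \<in> ?U \<longrightarrow> of_real delta_mass * (bump x0 \<rho> y * g x y) = E y"
        using ae by eventually_elim simp
    qed (use Ec y in simp_all)
    have gE: "E y * inverse (of_real delta_mass * bump x0 \<rho> y) = g x y" if y: "y \<in> ?U" for y
      unfolding eq[OF y, symmetric] using bnz[OF y] by (simp add: field_simps)
    \<comment> \<open>The case \<open>y = x\<close> of \<open>bA\<close>: the bound is then a
      multiple of \<open>0 powr (1/2)\<close>, which is 0.\<close>
    have gx0: "g x x = 0"
      using bA[OF x, of x] x by (simp add: g_def)
    have Ex: "E x = 0" using eq[OF x] gx0 by simp
    have bC: "(\<lambda>y. inverse (of_real delta_mass * bump x0 \<rho> y)) \<in> Ck_space (Suc 0) ?U"
      by (intro Ck1_inverse Ck1_mult Ck1_const Ck1_restrict[OF bump_smooth subset_UNIV] bnz)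
    have "((\<lambda>y. E y * inverse (of_real delta_mass * bump x0 \<rho> y)) has_derivative (\<lambda>v. D x * v)) (at x)"
      by (rule has_derivative_eq_rhs[OF has_derivative_mult[OF ED[unfolded has_field_derivative_def] Ck_Suc_has_derivative[OF bC x]]])
        (simp add: Ex D_def mult_ac)
    then show ?thesis
      by (rule has_derivative_transform_within_open[OF _ open_ball x]) (rule gE)
  qed
  let ?d = "\<lambda>P x v. of_real (Re v) * dir_deriv 1 P x + of_real (Im v) * dir_deriv \<i> P x"
  have AD: "(A has_derivative (\<lambda>v. D x * v + c1 x * ?d P1 x v + c2 x * ?d P2 x v)) (at x)" if x: "x \<in> ?U" for x
  proof -
    have xO: "x \<in> \<Omega>" using x UO by blast
    have "((\<lambda>y. g x y + c1 x * P1 y + c2 x * P2 y) has_derivative (\<lambda>v. D x * v + c1 x * ?d P1 x v + c2 x * ?d P2 x v)) (at x)"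
      by (intro has_derivative_add gD[OF x] has_derivative_mult_right Ck_Suc_has_derivative[OF P(1) xO] Ck_Suc_has_derivative[OF P(2) xO])
    then show ?thesis by (simp add: g_def)
  qed
  have dP: "continuous_on ?U (dir_deriv 1 P1)" "continuous_on ?U (dir_deriv \<i> P1)"
    "continuous_on ?U (dir_deriv 1 P2)" "continuous_on ?U (dir_deriv \<i> P2)"
    using Ck_space_dir_deriv[OF Ck1_restrict[OF P(1) UO]] Ck_space_dir_deriv[OF Ck1_restrict[OF P(2) UO]] by simp_all
  show "A \<in> Ck_space (Suc 0) ?U"
    by (rule Ck1_intro[OF AD]) (assumption, (intro continuous_on_add continuous_on_mult continuous_on_const Dc c dP)+)
  \<comment> \<open>The part \<open>D x * v\<close> of the derivative is complex linear, so
    \<open>cdbar\<close> annihilates it.\<close>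
  show "cdbar A x = c1 x * cdbar P1 x + c2 x * cdbar P2 x" if x: "x \<in> ?U" for x
    unfolding cdbar_has_derivative[OF AD[OF x]]
    by (simp add: cdbar_def field_simps)
qed

section \<open>Differentiability of solutions of the coupled system\<close>

text \<open>Since the combination vanishes at \<open>x\<close>, its value at \<open>y\<close> is
  made up of the increments of the three functions between \<open>x\<close> and \<open>y\<close>.
  Bounded coefficients suffice because they are frozen at \<open>x\<close>.\<close>

lemma hoelder_combination_bound:
  assumes F: "hoelder_on S F" and p: "hoelder_on S p1" "hoelder_on S p2"
    and k: "\<And>x. x \<in> U \<Longrightarrow> norm (k1 x) \<le> B" "\<And>x. x \<in> U \<Longrightarrow> norm (k2 x) \<le> B"
    and US: "U \<subseteq> S" and z: "\<And>x. x \<in> U \<Longrightarrow> F x - k1 x * p1 x - k2 x * p2 x = 0"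
  obtains C where "C \<ge> 0"
    "\<And>x y. x \<in> U \<Longrightarrow> y \<in> S \<Longrightarrow> norm (F y - k1 x * p1 y - k2 x * p2 y) \<le> C * norm (x - y) powr (1/2)"
proof -
  obtain L where L: "L \<ge> 0" "\<And>x y. x \<in> S \<Longrightarrow> y \<in> S \<Longrightarrow> norm (F x - F y) \<le> L * norm (x - y) powr (1/2)"
    by (rule hoelder_onE[OF F]) (rule that)
  obtain L1 where L1: "L1 \<ge> 0" "\<And>x y. x \<in> S \<Longrightarrow> y \<in> S \<Longrightarrow> norm (p1 x - p1 y) \<le> L1 * norm (x - y) powr (1/2)"
    by (rule hoelder_onE[OF p(1)]) (rule that)
  obtain L2 where L2: "L2 \<ge> 0" "\<And>x y. x \<in> S \<Longrightarrow> y \<in> S \<Longrightarrow> norm (p2 x - p2 y) \<le> L2 * norm (x - y) powr (1/2)"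
    by (rule hoelder_onE[OF p(2)]) (rule that)
  show ?thesis
  proof (rule that[of "L + \<bar>B\<bar> * L1 + \<bar>B\<bar> * L2"])
    fix x y assume x: "x \<in> U" and y: "y \<in> S"
    have xS: "x \<in> S" using x US by blast
    have kB: "norm (k1 x) \<le> \<bar>B\<bar>" "norm (k2 x) \<le> \<bar>B\<bar>"
      using k(1)[OF x] k(2)[OF x] by linarith+
    have "F y - k1 x * p1 y - k2 x * p2 y = (k1 x * (p1 x - p1 y) + k2 x * (p2 x - p2 y)) - (F x - F y)"
      using z[OF x] by (simp add: algebra_simps)
    then have "norm (F y - k1 x * p1 y - k2 x * p2 y) \<le> norm (k1 x * (p1 x - p1 y) + k2 x * (p2 x - p2 y)) + norm (F x - F y)"
      by (simp only: norm_triangle_ineq4)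
    also have "\<dots> \<le> (norm (k1 x) * norm (p1 x - p1 y) + norm (k2 x) * norm (p2 x - p2 y)) + norm (F x - F y)"
      by (intro add_right_mono order_trans[OF norm_triangle_ineq]) (simp add: norm_mult)
    also have "\<dots> \<le> (\<bar>B\<bar> * (L1 * norm (x - y) powr (1/2)) + \<bar>B\<bar> * (L2 * norm (x - y) powr (1/2))) + L * norm (x - y) powr (1/2)"
      by (intro add_mono mult_mono kB L(2) L1(2) L2(2) xS y) simp_all
    finally show "norm (F y - k1 x * p1 y - k2 x * p2 y) \<le> (L + \<bar>B\<bar> * L1 + \<bar>B\<bar> * L2) * norm (x - y) powr (1/2)"
      by (simp add: algebra_simps)
  qed (use L(1) L1(1) L2(1) in simp)
qed

lemma bounded_linear_Ck1:
  assumes L: "bounded_linear L" and g: "g \<in> Ck_space (Suc 0) \<Omega>"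
  shows "(\<lambda>z. L (g z)) \<in> Ck_space (Suc 0) \<Omega>"
proof (rule Ck1_intro[OF bounded_linear.has_derivative[OF L Ck_Suc_has_derivative[OF g]]])
  have c: "continuous_on \<Omega> (dir_deriv 1 g)" "continuous_on \<Omega> (dir_deriv \<i> g)"
    using Ck_space_dir_deriv[OF g] by simp_all
  show "continuous_on \<Omega> (\<lambda>z. L (of_real (Re 1) * dir_deriv 1 g z + of_real (Im 1) * dir_deriv \<i> g z))"
    by (intro bounded_linear.continuous_on[OF L] continuous_on_add continuous_on_mult continuous_on_const c)
  show "continuous_on \<Omega> (\<lambda>z. L (of_real (Re \<i>) * dir_deriv 1 g z + of_real (Im \<i>) * dir_deriv \<i> g z))"
    by (intro bounded_linear.continuous_on[OF L] continuous_on_add continuous_on_mult continuous_on_const c)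
qed

text \<open>The Vekua equation for j / f under j -> \<i>: the sign on the right is that of the
  bicomplex conjugate.\<close>

lemma cdbar_i_inverse:
  assumes f: "f differentiable (at z)" and nz: "f z \<noteq> 0"
  shows "cdbar (\<lambda>w. \<i> * inverse (f w)) z = (cdbar f z / f z) * (- \<i> * inverse (f z))"
proof -
  obtain f' where f': "(f has_derivative f') (at z)" using f by (auto simp: differentiable_def)
  show ?thesis
    unfolding cdbar_has_derivative[OF has_derivative_mult_right[OF Deriv.has_derivative_inverse[OF nz f']]]
      cdbar_has_derivative[OF f']
    using nz by (simp add: field_simps)
qed

text \<open>\<open>c1\<close> and \<open>c2\<close> solve A = c1 f + c2 P2 and cnj B = c1 f + c2 Q2
  at each point, by half sum and half difference since \<open>f * P2\<close> and
  \<open>f * Q2\<close> are the constants \<i> and -\<i>. The right-hand side left after subtraction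
  is \<open>a\<close> times the error in the second equation, so the Hoelder bound for
  \<open>cnj B\<close> and a bound on \<open>a\<close> control it.\<close>

lemma vekua_system_C1:
  assumes \<Omega>: "open \<Omega>" and f: "f \<in> Ck_space (Suc 0) \<Omega>" and nz: "\<And>z. z \<in> \<Omega> \<Longrightarrow> f z \<noteq> 0"
    and \<rho>: "\<rho> > 0" "cball x0 \<rho> \<subseteq> \<Omega>"
    and c: "continuous_on \<Omega> A" "continuous_on \<Omega> B"
    and hA: "hoelder_on (cball x0 \<rho>) A" and hB: "hoelder_on (cball x0 \<rho>) (\<lambda>z. cnj (B z))"
    and weak: "weak_cdbar \<Omega> A (\<lambda>z. cdbar f z / f z * cnj (B z))"
  shows "A \<in> Ck_space (Suc 0) (ball x0 \<rho>)"
    "\<And>x. x \<in> ball x0 \<rho> \<Longrightarrow> cdbar A x = cdbar f x / f x * cnj (B x)"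
proof -
  let ?U = "ball x0 \<rho>" and ?S = "cball x0 \<rho>"
  have US: "?U \<subseteq> ?S" by (rule ball_subset_cball)
  define a where "a z = cdbar f z / f z" for z
  define P2 where "P2 z = \<i> * inverse (f z)" for z
  define Q2 where "Q2 z = - \<i> * inverse (f z)" for z
  have fi: "(\<lambda>z. inverse (f z)) \<in> Ck_space (Suc 0) \<Omega>" by (rule Ck1_inverse[OF f nz])
  have P2: "P2 \<in> Ck_space (Suc 0) \<Omega>" unfolding P2_def[abs_def] by (intro Ck1_mult Ck1_const fi)
  have Q2: "Q2 \<in> Ck_space (Suc 0) \<Omega>" unfolding Q2_def[abs_def] by (intro Ck1_mult Ck1_const fi)
  have cf: "continuous_on \<Omega> f" "continuous_on \<Omega> (dir_deriv 1 f)" "continuous_on \<Omega> (dir_deriv \<i> f)"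
    using Ck_space_SucD[OF f] Ck_space_dir_deriv[OF f] by simp_all
  have cfi: "continuous_on \<Omega> (\<lambda>z. inverse (f z))" using Ck_space_SucD[OF fi] by simp
  have cd: "continuous_on \<Omega> (cdbar f)"
    unfolding cdbar_def[abs_def] by (intro continuous_intros cf) simp
  have ca: "continuous_on \<Omega> a"
    unfolding a_def[abs_def] divide_inverse by (intro continuous_on_mult cd cfi)
  have cP2: "continuous_on \<Omega> (cdbar P2)"
    using Ck_space_dir_deriv[OF P2] unfolding cdbar_def[abs_def] by (intro continuous_intros) simp_all
  have d1: "cdbar f z = a z * f z" if "z \<in> \<Omega>" for z
    using nz[OF that] by (simp add: a_def)
  have d2: "cdbar P2 z = a z * Q2 z" if z: "z \<in> \<Omega>" for z
  proof -
    have "f differentiable (at z)" using f z by (auto simp: Ck_Suc_iff)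
    then show ?thesis
      unfolding P2_def[abs_def] Q2_def a_def using nz[OF z] by (rule cdbar_i_inverse)
  qed
  define c1 where "c1 x = (A x + cnj (B x)) * (inverse 2 * inverse (f x))" for x
  define c2 where "c2 x = f x * (A x - cnj (B x)) * inverse (2 * \<i>)" for x
  have cc: "continuous_on \<Omega> c1" "continuous_on \<Omega> c2"
    unfolding c1_def[abs_def] c2_def[abs_def]
    by (intro continuous_on_mult continuous_on_add continuous_on_diff continuous_on_cnj continuous_on_const c cf(1) cfi)+
  obtain B1 where B1: "B1 \<ge> 0" "\<And>z. z \<in> ?S \<Longrightarrow> norm (c1 z) \<le> B1"
    by (rule compact_norm_bound[OF continuous_on_subset[OF cc(1) \<rho>(2)] compact_cball]) (rule that)
  obtain B2 where B2: "B2 \<ge> 0" "\<And>z. z \<in> ?S \<Longrightarrow> norm (c2 z) \<le> B2"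
    by (rule compact_norm_bound[OF continuous_on_subset[OF cc(2) \<rho>(2)] compact_cball]) (rule that)
  obtain M where M: "M \<ge> 0" "\<And>z. z \<in> ?S \<Longrightarrow> norm (a z) \<le> M"
    by (rule compact_norm_bound[OF continuous_on_subset[OF ca \<rho>(2)] compact_cball]) (rule that)
  have k: "norm (c1 x) \<le> max B1 B2" "norm (c2 x) \<le> max B1 B2" if "x \<in> ?U" for x
    using B1(2)[of x] B2(2)[of x] subsetD[OF US that] by (simp_all add: le_max_iff_disj)
  have UO: "?U \<subseteq> \<Omega>" using US \<rho>(2) by blast
  have zA: "A x - c1 x * f x - c2 x * P2 x = 0" and zB: "cnj (B x) - c1 x * f x - c2 x * Q2 x = 0" if "x \<in> ?U" for x
    using nz[OF subsetD[OF UO that]] by (simp_all add: c1_def c2_def P2_def Q2_def field_simps)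
  obtain CA where CA: "CA \<ge> 0"
    "\<And>x y. x \<in> ?U \<Longrightarrow> y \<in> ?S \<Longrightarrow> norm (A y - c1 x * f y - c2 x * P2 y) \<le> CA * norm (x - y) powr (1/2)"
    by (rule hoelder_combination_bound[OF hA Ck1_hoelder[OF f \<rho>(2)] Ck1_hoelder[OF P2 \<rho>(2)] k US zA]) (assumption, assumption, assumption, rule that)
  obtain CB where CB: "CB \<ge> 0"
    "\<And>x y. x \<in> ?U \<Longrightarrow> y \<in> ?S \<Longrightarrow> norm (cnj (B y) - c1 x * f y - c2 x * Q2 y) \<le> CB * norm (x - y) powr (1/2)"
    by (rule hoelder_combination_bound[OF hB Ck1_hoelder[OF f \<rho>(2)] Ck1_hoelder[OF Q2 \<rho>(2)] k US zB]) (assumption, assumption, assumption, rule that)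
  define C where "C = max CA (M * CB)"
  have C: "C \<ge> 0" using CA(1) by (simp add: C_def)
  have bA: "norm (A y - c1 x * f y - c2 x * P2 y) \<le> C * norm (x - y) powr (1/2)" if "x \<in> ?U" "y \<in> ?S" for x y
    by (rule order_trans[OF CA(2)[OF that] mult_right_mono]) (simp_all add: C_def)
  have bH: "norm (a y * cnj (B y) - c1 x * cdbar f y - c2 x * cdbar P2 y) \<le> C * norm (x - y) powr (1/2)"
    if x: "x \<in> ?U" and y: "y \<in> ?S" for x y
  proof -
    have yO: "y \<in> \<Omega>" using y \<rho>(2) by blast
    have "a y * cnj (B y) - c1 x * cdbar f y - c2 x * cdbar P2 y = a y * (cnj (B y) - c1 x * f y - c2 x * Q2 y)"
      unfolding d1[OF yO] d2[OF yO] by (simp add: algebra_simps)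
    then have "norm (a y * cnj (B y) - c1 x * cdbar f y - c2 x * cdbar P2 y) = norm (a y) * norm (cnj (B y) - c1 x * f y - c2 x * Q2 y)"
      by (simp only: norm_mult)
    also have "\<dots> \<le> M * (CB * norm (x - y) powr (1/2))"
      by (intro mult_mono M(2)[OF y] CB(2)[OF x y]) (simp_all add: M(1))
    also have "\<dots> \<le> C * norm (x - y) powr (1/2)"
      unfolding mult.assoc[symmetric] by (intro mult_right_mono) (simp_all add: C_def)
    finally show ?thesis .
  qed
  have cH: "continuous_on \<Omega> (\<lambda>z. a z * cnj (B z))"
    by (intro continuous_on_mult continuous_on_cnj ca c)
  have weak': "weak_cdbar \<Omega> A (\<lambda>z. a z * cnj (B z))" using weak unfolding a_def .
  note sol = weak_solution_C1[OF \<Omega> \<rho> f P2 c(1) cH cd cP2 weak' weak_cdbar_C1[OF \<Omega> f] weak_cdbar_C1[OF \<Omega> P2]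
      continuous_on_subset[OF cc(1) UO] continuous_on_subset[OF cc(2) UO] bA bH C]
  show "A \<in> Ck_space (Suc 0) ?U" by (rule sol(1))
  show "cdbar A x = cdbar f x / f x * cnj (B x)" if x: "x \<in> ?U" for x
  proof -
    have xO: "x \<in> \<Omega>" using x UO by blast
    have "cdbar A x = c1 x * cdbar f x + c2 x * cdbar P2 x" by (rule sol(2)) (assumption, assumption, assumption, assumption, rule x)
    also have "\<dots> = a x * (c1 x * f x + c2 x * Q2 x)"
      unfolding d1[OF xO] d2[OF xO] by (simp add: algebra_simps)
    also have "c1 x * f x + c2 x * Q2 x = cnj (B x)" using zB[OF x] by (simp add: algebra_simps)
    finally show ?thesis by (simp only: a_def)
  qed
qed

text \<open>The equation in the idempotent components: \<open>A\<close> is the image of the bicomplex solution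
  under \<open>\<^bold>j \<mapsto> \<i>\<close>, and \<open>B\<close> the conjugate of its image under \<open>\<^bold>j \<mapsto> - \<i>\<close>.\<close>

lemma weak_vekua_system_hoelder:
  assumes \<Omega>: "open \<Omega>" and ca: "continuous_on \<Omega> a" "continuous_on \<Omega> b"
    and Am [measurable]: "A \<in> borel_measurable borel" and Bm [measurable]: "B \<in> borel_measurable borel"
    and loc: "locally_integrable \<Omega> A" "locally_integrable \<Omega> B"
    and weak: "weak_cdbar \<Omega> A (\<lambda>z. a z * cnj (B z))" "weak_cdbar \<Omega> B (\<lambda>z. b z * cnj (A z))"
  obtains G where "\<And>x. x \<in> \<Omega> \<Longrightarrow> \<exists>r>0. cball x r \<subseteq> \<Omega> \<and> hoelder_on (cball x r) G"
    "AE z in lborel. z \<in> \<Omega> \<longrightarrow> A z = G z"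
proof -
  \<comment> \<open>The coefficients are continuous on \<open>\<Omega>\<close> only; extending them
    by 0 yields Borel functions on the plane without affecting any test integral.\<close>
  define HA where "HA z = (indicator \<Omega> z *\<^sub>R a z) * cnj (B z)" for z
  define HB where "HB z = (indicator \<Omega> z *\<^sub>R b z) * cnj (A z)" for z
  have am [measurable]: "(\<lambda>z. indicator \<Omega> z *\<^sub>R a z) \<in> borel_measurable borel" "(\<lambda>z. indicator \<Omega> z *\<^sub>R b z) \<in> borel_measurable borel"
    by (intro borel_measurable_continuous_on_indicator ca; simp add: \<Omega>)+
  have HAm: "HA \<in> borel_measurable borel" and HBm: "HB \<in> borel_measurable borel"
    unfolding HA_def[abs_def] HB_def[abs_def]
    by (intro borel_measurable_times am measurable_compose[OF Am] measurable_compose[OF Bm] borel_measurable_continuous_onI continuous_on_cnj continuous_on_id)+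
  have wk: "weak_cdbar \<Omega> A HA" "weak_cdbar \<Omega> B HB"
  proof -
    have "HA z * \<phi> z = a z * cnj (B z) * \<phi> z" "HB z * \<phi> z = b z * cnj (A z) * \<phi> z" if "\<phi> \<in> test_space \<Omega>" for \<phi> z
      using cdbar_test_space_eq_0(1)[OF that, of z] by (auto simp: HA_def HB_def indicator_def)
    then have "(LINT z|lborel. HA z * \<phi> z) = (LINT z|lborel. a z * cnj (B z) * \<phi> z)"
      "(LINT z|lborel. HB z * \<phi> z) = (LINT z|lborel. b z * cnj (A z) * \<phi> z)" if "\<phi> \<in> test_space \<Omega>" for \<phi>
      using that by presburger+
    then show "weak_cdbar \<Omega> A HA" "weak_cdbar \<Omega> B HB"
      using weak unfolding weak_cdbar_def by simp_all
  qed
  have li: "locally_integrable \<Omega> (\<lambda>z. (indicator \<Omega> z *\<^sub>R q z) * cnj (F z))"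
    if q: "continuous_on \<Omega> q" and F: "locally_integrable \<Omega> F" "F \<in> borel_measurable borel" for q F
    unfolding locally_integrable_def
  proof (intro allI impI, elim conjE)
    fix K assume K: "compact K" "K \<subseteq> \<Omega>"
    obtain M where M: "M \<ge> 0" "\<And>z. z \<in> K \<Longrightarrow> norm (q z) \<le> M"
      by (rule compact_norm_bound[OF continuous_on_subset[OF q K(2)] K(1)]) (rule that)
    have i: "integrable lborel (\<lambda>z. M *\<^sub>R (indicator K z *\<^sub>R F z))"
      using F(1) K unfolding locally_integrable_def by (intro integrable_scaleR_right) blast
    show "integrable lborel (\<lambda>z. indicator K z *\<^sub>R ((indicator \<Omega> z *\<^sub>R q z) * cnj (F z)))"
    proof (rule Bochner_Integration.integrable_bound[OF i])
      have "(\<lambda>z. indicator K z *\<^sub>R ((indicator \<Omega> z *\<^sub>R q z) * cnj (F z))) \<in> borel_measurable borel"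
        by (intro borel_measurable_scaleR borel_measurable_indicator borel_measurable_times
            borel_measurable_continuous_on_indicator measurable_compose[OF F(2)] borel_measurable_continuous_onI continuous_on_cnj continuous_on_id q)
          (simp_all add: \<Omega> borel_compact K(1))
      then show "(\<lambda>z. indicator K z *\<^sub>R ((indicator \<Omega> z *\<^sub>R q z) * cnj (F z))) \<in> borel_measurable lborel" by simp
      have "norm (indicator K z *\<^sub>R ((indicator \<Omega> z *\<^sub>R q z) * cnj (F z))) \<le> norm (M *\<^sub>R (indicator K z *\<^sub>R F z))" for z
        using M(1) M(2)[of z] subsetD[OF K(2), of z] by (cases "z \<in> K") (simp_all add: norm_mult mult_right_mono)
      then show "AE z in lborel. norm (indicator K z *\<^sub>R ((indicator \<Omega> z *\<^sub>R q z) * cnj (F z))) \<le> norm (M *\<^sub>R (indicator K z *\<^sub>R F z))"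
        by (intro always_eventually allI)
    qed
  qed
  have loc': "locally_integrable \<Omega> HA" "locally_integrable \<Omega> HB"
    unfolding HA_def[abs_def] HB_def[abs_def] by (rule li[OF ca(1) loc(2) Bm], rule li[OF ca(2) loc(1) Am])
  have "\<exists>r>0. \<exists>G. cball x r \<subseteq> \<Omega> \<and> hoelder_on (cball x r) G \<and> (AE z in lborel. z \<in> cball x r \<longrightarrow> A z = G z)"
    if x: "x \<in> \<Omega>" for x
  proof -
    obtain R where R: "R > 0" "cball x R \<subseteq> \<Omega>" using \<Omega> x open_contains_cball by blast
    obtain M1 where M1: "M1 \<ge> 0" "\<And>z. z \<in> cball x R \<Longrightarrow> norm (a z) \<le> M1"
      by (rule compact_norm_bound[OF continuous_on_subset[OF ca(1) R(2)] compact_cball]) (rule that)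
    obtain M2 where M2: "M2 \<ge> 0" "\<And>z. z \<in> cball x R \<Longrightarrow> norm (b z) \<le> M2"
      by (rule compact_norm_bound[OF continuous_on_subset[OF ca(2) R(2)] compact_cball]) (rule that)
    define M where "M = max M1 M2"
    have M: "M \<ge> 0" using M1(1) by (simp add: M_def)
    have HAb: "norm (HA z) \<le> M * norm (B z)" and HBb: "norm (HB z) \<le> M * norm (A z)" if z: "z \<in> cball x R" for z
    proof -
      have "z \<in> \<Omega>" using z R(2) by blast
      then have "norm (HA z) = norm (a z) * norm (B z)" "norm (HB z) = norm (b z) * norm (A z)"
        by (simp_all add: HA_def HB_def norm_mult)
      moreover have "norm (a z) \<le> M" "norm (b z) \<le> M"
        using M1(2)[OF z] M2(2)[OF z] by (simp_all add: M_def le_max_iff_disj)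
      ultimately show "norm (HA z) \<le> M * norm (B z)" "norm (HB z) \<le> M * norm (A z)"
        by (simp_all add: mult_right_mono)
    qed
    obtain C where C: "AE z in lborel. z \<in> cball x (R / 4) \<longrightarrow> norm (A z) \<le> C \<and> norm (B z) \<le> C"
      by (rule weak_system_locally_bounded[OF R Am Bm loc loc' wk HAb HBb M]) (assumption, assumption, rule that)
    have R4: "0 < R / 4" "cball x (R / 4) \<subseteq> \<Omega>" using R subset_cball[of "R / 4" R x] by auto
    have bd: "AE z in lborel. z \<in> cball x (R / 4) \<longrightarrow> norm (A z) \<le> max C (M * C) \<and> norm (HA z) \<le> max C (M * C)"
      using C
    proof eventually_elim
      case (elim z)
      show ?case
      proof
        assume z: "z \<in> cball x (R / 4)"
        then have AB: "norm (A z) \<le> C" "norm (B z) \<le> C" using elim by blast+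
        have "z \<in> cball x R" using z R(1) by auto
        from HAb[OF this] have "norm (HA z) \<le> M * C"
          using mult_left_mono[OF AB(2) M] by (rule order_trans)
        then show "norm (A z) \<le> max C (M * C) \<and> norm (HA z) \<le> max C (M * C)"
          using AB(1) by (simp add: le_max_iff_disj)
      qed
    qed
    obtain G where G: "hoelder_on (cball x (R / 4 / 2)) G" "AE z in lborel. z \<in> cball x (R / 4 / 2) \<longrightarrow> A z = G z"
      by (rule bounded_weak_solution_hoelder[OF R4 loc(1) loc'(1) wk(1) Am HAm bd]) (rule that)
    have "cball x (R / 4 / 2) \<subseteq> \<Omega>" using R subset_cball[of "R / 4 / 2" R x] by auto
    then show ?thesis using G R(1) by (intro exI[of _ "R / 4 / 2"] exI[of _ G] conjI) simp_all
  qed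
  then show ?thesis by (rule glue_hoelder) (assumption, rule that)
qed

lemma weak_cdbar_cong_AE:
  assumes \<Omega>: "open \<Omega>" and w: "weak_cdbar \<Omega> A (\<lambda>z. a z * cnj (B z))"
    and ca: "continuous_on \<Omega> a" and m: "A \<in> borel_measurable borel" "B \<in> borel_measurable borel"
    and c: "continuous_on \<Omega> A'" "continuous_on \<Omega> B'"
    and ae: "AE z in lborel. z \<in> \<Omega> \<longrightarrow> A z = A' z" "AE z in lborel. z \<in> \<Omega> \<longrightarrow> B z = B' z"
  shows "weak_cdbar \<Omega> A' (\<lambda>z. a z * cnj (B' z))"
  unfolding weak_cdbar_def
proof
  fix \<phi> assume \<phi>: "\<phi> \<in> test_space \<Omega>"
  obtain K where K: "compact K" "K \<subseteq> \<Omega>" "\<And>z. z \<notin> K \<Longrightarrow> \<phi> z = 0" "\<And>z. z \<notin> K \<Longrightarrow> cdbar \<phi> z = 0"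
    "continuous_on UNIV \<phi>" "continuous_on UNIV (cdbar \<phi>)"
    by (rule test_spaceE[OF \<phi>]) (rule that)
  have cm: "(\<lambda>z. Q z * q z) \<in> borel_measurable lborel"
    if "continuous_on \<Omega> Q" "continuous_on UNIV q" "\<forall>z. z \<notin> K \<longrightarrow> q z = 0" for Q q :: "complex \<Rightarrow> complex"
  proof -
    have "continuous_on UNIV (\<lambda>z. Q z * q z)"
      by (rule continuous_on_zero_extension[OF \<Omega> compact_imp_closed[OF K(1)] K(2)])
        (intro continuous_on_mult that(1) continuous_on_subset[OF that(2) subset_UNIV], simp add: that(3))
    then show ?thesis by (simp add: borel_measurable_continuous_onI)
  qed
  have qm [measurable]: "\<phi> \<in> borel_measurable borel" "cdbar \<phi> \<in> borel_measurable borel"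
    by (rule borel_measurable_continuous_onI, rule K)+
  note [measurable] = m
  have "(LINT z|lborel. A' z * cdbar \<phi> z) = (LINT z|lborel. A z * cdbar \<phi> z)"
  proof (rule integral_cong_AE)
    show "(\<lambda>z. A' z * cdbar \<phi> z) \<in> borel_measurable lborel" by (rule cm[OF c(1) K(6)]) (simp add: K(4))
    show "(\<lambda>z. A z * cdbar \<phi> z) \<in> borel_measurable lborel" by measurable
    show "AE z in lborel. A' z * cdbar \<phi> z = A z * cdbar \<phi> z"
      using ae(1)
    proof eventually_elim
      case (elim z)
      then show ?case using subsetD[OF K(2), of z] K(4)[of z] by (cases "z \<in> K") auto
    qed
  qed
  also have "\<dots> = - (LINT z|lborel. a z * cnj (B z) * \<phi> z)"
    using w \<phi> by (simp add: weak_cdbar_def)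
  \<comment> \<open>Measurability of \<open>a\<close> off \<open>\<Omega>\<close> is unknown, so it
    is grouped with \<open>\<phi>\<close>, which makes the product continuous on the plane.\<close>
  also have "(LINT z|lborel. a z * cnj (B z) * \<phi> z) = (LINT z|lborel. cnj (B z) * (a z * \<phi> z))"
    by (simp only: mult_ac)
  also have "\<dots> = (LINT z|lborel. a z * cnj (B' z) * \<phi> z)"
  proof (rule integral_cong_AE)
    have cB: "continuous_on \<Omega> (\<lambda>z. a z * cnj (B' z))" by (intro continuous_on_mult continuous_on_cnj ca c)
    show "(\<lambda>z. a z * cnj (B' z) * \<phi> z) \<in> borel_measurable lborel" by (rule cm[OF cB K(5)]) (simp add: K(3))
    have [measurable]: "(\<lambda>z. a z * \<phi> z) \<in> borel_measurable lborel" by (rule cm[OF ca K(5)]) (simp add: K(3))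
    have "(\<lambda>z. cnj (B z)) \<in> borel_measurable lborel"
      using measurable_compose[OF m(2), of cnj borel] by (simp add: borel_measurable_continuous_onI continuous_on_cnj)
    then show "(\<lambda>z. cnj (B z) * (a z * \<phi> z)) \<in> borel_measurable lborel" by measurable
    show "AE z in lborel. cnj (B z) * (a z * \<phi> z) = a z * cnj (B' z) * \<phi> z"
      using ae(2)
    proof eventually_elim
      case (elim z)
      then show ?case using subsetD[OF K(2), of z] K(3)[of z] by (cases "z \<in> K") auto
    qed
  qed
  finally show "(LINT z|lborel. A' z * cdbar \<phi> z) = - (LINT z|lborel. a z * cnj (B' z) * \<phi> z)" .
qed

section \<open>The bicomplex equation\<close>

lemma Ck_cnj: "g \<in> Ck_space k UNIV \<Longrightarrow> (\<lambda>z. cnj (g z)) \<in> Ck_space k UNIV"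
proof (induction k arbitrary: g)
  case 0
  then show ?case by (simp add: continuous_on_cnj)
next
  case (Suc k)
  have D: "((\<lambda>z. cnj (g z)) has_derivative
      (\<lambda>v. cnj (of_real (Re v) * dir_deriv 1 g z + of_real (Im v) * dir_deriv \<i> g z))) (at z)" for z
    by (rule bounded_linear.has_derivative[OF bounded_linear_cnj Ck_Suc_has_derivative[OF Suc.prems UNIV_I]])
  show ?case
    by (rule Ck_UNIV_SucI[OF D]) (use Suc.IH[OF Ck_space_dir_deriv(1)[OF Suc.prems]] Suc.IH[OF Ck_space_dir_deriv(2)[OF Suc.prems]] in simp_all)
qed

lemma dir_deriv_lin:
  assumes "g differentiable (at z)" "h differentiable (at z)"
  shows "dir_deriv e (\<lambda>w. a * g w + b * h w) z = a * dir_deriv e g z + b * dir_deriv e h z"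
proof -
  obtain g' h' where D: "(g has_derivative g') (at z)" "(h has_derivative h') (at z)"
    using assms by (auto simp: differentiable_def)
  show ?thesis
    by (simp add: dir_deriv_has_derivative[OF D(1)] dir_deriv_has_derivative[OF D(2)]
        dir_deriv_has_derivative[OF has_derivative_add[OF has_derivative_mult_right[OF D(1)] has_derivative_mult_right[OF D(2)]]])
qed

lemma dir_deriv_cmult:
  assumes "g differentiable (at z)"
  shows "dir_deriv e (\<lambda>w. a * g w) z = a * dir_deriv e g z"
  using dir_deriv_lin[OF assms assms, of e a 0] by simp

lemma dir_deriv_cnj:
  assumes "g differentiable (at z)"
  shows "dir_deriv e (\<lambda>w. cnj (g w)) z = cnj (dir_deriv e g z)"
proof -
  obtain g' where D: "(g has_derivative g') (at z)"
    using assms by (auto simp: differentiable_def)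
  show ?thesis
    using dir_deriv_has_derivative[OF D, of e]
      dir_deriv_has_derivative[OF bounded_linear.has_derivative[OF bounded_linear_cnj D], of e]
    by simp
qed

lemma test_space_cmult:
  assumes "\<phi> \<in> test_space \<Omega>"
  shows "(\<lambda>z. c * \<phi> z) \<in> test_space \<Omega>"
proof -
  have sub: "closure {z. c * \<phi> z \<noteq> 0} \<subseteq> closure {z. \<phi> z \<noteq> 0}"
    by (rule closure_mono) auto
  have b: "bounded (closure {z. \<phi> z \<noteq> 0})"
    using assms by (auto simp: test_space_def intro: compact_imp_bounded)
  have "compact (closure {z. c * \<phi> z \<noteq> 0})"
    unfolding compact_eq_bounded_closed using bounded_subset[OF b sub] by simp
  then show ?thesis
    using assms sub by (auto simp: test_space_def intro: Ck_mult Ck_const)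
qed

lemma test_space_cnj:
  assumes "\<phi> \<in> test_space \<Omega>"
  shows "(\<lambda>z. cnj (\<phi> z)) \<in> test_space \<Omega>"
  using assms by (simp add: test_space_def Ck_cnj)

section \<open>From Lebesgue measurable functions on a set to Borel functions on the plane\<close>

text \<open>The equation is posed with \<open>lebesgue_on \<Omega>\<close>, whereas the potential
  estimates use Borel functions and products of \<open>lborel\<close>. Real and imaginary part of
  the extension by 0 each have a Borel version.\<close>

lemma lebesgue_on_borel_representative:
  fixes g :: "complex \<Rightarrow> complex"
  assumes g: "g \<in> borel_measurable (lebesgue_on \<Omega>)" and \<Omega>: "\<Omega> \<in> sets lebesgue"
  obtains g' where "g' \<in> borel_measurable borel" "AE z in lborel. z \<in> \<Omega> \<longrightarrow> g z = g' z"
proof -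
  have m: "(\<lambda>z. indicator \<Omega> z *\<^sub>R g z) \<in> borel_measurable lebesgue"
    using g \<Omega> by (subst (asm) borel_measurable_restrict_space_iff) simp_all
  have "(\<lambda>z. Re (indicator \<Omega> z *\<^sub>R g z)) \<in> borel_measurable (completion lborel)"
    "(\<lambda>z. Im (indicator \<Omega> z *\<^sub>R g z)) \<in> borel_measurable (completion lborel)"
    by (intro measurable_compose[OF m] borel_measurable_continuous_onI continuous_intros)+
  from this[THEN completion_ex_borel_measurable_real]
  obtain u v :: "complex \<Rightarrow> real" where [measurable]: "u \<in> borel_measurable borel" "v \<in> borel_measurable borel"
    and uv: "AE z in lborel. Re (indicator \<Omega> z *\<^sub>R g z) = u z" "AE z in lborel. Im (indicator \<Omega> z *\<^sub>R g z) = v z"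
    by auto
  show ?thesis
  proof (rule that)
    show "(\<lambda>z. complex_of_real (u z) + \<i> * complex_of_real (v z)) \<in> borel_measurable borel"
      by measurable
    show "AE z in lborel. z \<in> \<Omega> \<longrightarrow> g z = complex_of_real (u z) + \<i> * complex_of_real (v z)"
      using uv by eventually_elim (auto simp: complex_eq_iff)
  qed
qed

lemma lebesgue_on_integral_transfer:
  fixes g g' q :: "complex \<Rightarrow> complex"
  assumes \<Omega>: "\<Omega> \<in> sets lebesgue" and g: "g \<in> borel_measurable (lebesgue_on \<Omega>)"
    and g' [measurable]: "g' \<in> borel_measurable borel" and q: "continuous_on UNIV q" "\<And>z. z \<notin> \<Omega> \<Longrightarrow> q z = 0"
    and ae: "AE z in lborel. z \<in> \<Omega> \<longrightarrow> g z = g' z"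
  shows "(LINT z|lebesgue_on \<Omega>. g z * q z) = (LINT z|lborel. g' z * q z)"
proof -
  have qm [measurable]: "q \<in> borel_measurable borel" by (rule borel_measurable_continuous_onI[OF q(1)])
  have ql: "q \<in> borel_measurable lebesgue" using qm by (intro measurable_completion) simp
  have gl: "(\<lambda>z. indicator \<Omega> z *\<^sub>R g z) \<in> borel_measurable lebesgue"
    using g \<Omega> by (subst (asm) borel_measurable_restrict_space_iff) simp_all
  have gq: "(\<lambda>z. g' z * q z) \<in> borel_measurable lborel" by measurable
  have "(LINT z|lebesgue_on \<Omega>. g z * q z) = (LINT z|lebesgue. indicator \<Omega> z *\<^sub>R (g z * q z))"
    by (rule integral_restrict_space) (use \<Omega> in simp)
  also have "\<dots> = (LINT z|lebesgue. (indicator \<Omega> z *\<^sub>R g z) * q z)" by simp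
  also have "\<dots> = (LINT z|lebesgue. g' z * q z)"
  proof (rule integral_cong_AE)
    show "(\<lambda>z. (indicator \<Omega> z *\<^sub>R g z) * q z) \<in> borel_measurable lebesgue"
      by (intro borel_measurable_times gl ql)
    show "(\<lambda>z. g' z * q z) \<in> borel_measurable lebesgue" using gq by (rule measurable_completion)
    show "AE z in lebesgue. (indicator \<Omega> z *\<^sub>R g z) * q z = g' z * q z"
      using AE_completion[OF ae]
    proof eventually_elim
      case (elim z)
      then show ?case using q(2)[of z] by (cases "z \<in> \<Omega>") auto
    qed
  qed
  also have "\<dots> = (LINT z|lborel. g' z * q z)"
    by (rule integral_completion[OF gq])
  finally show ?thesis .
qed

text \<open>On a set of finite measure |u| \<le> 1 + |u|^p gives integrability, the starting point
  of the bootstrap.\<close>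

lemma Lp_space_integrable:
  assumes \<Omega>: "open \<Omega>" "bounded \<Omega>" and p: "1 < p"
    and u: "u \<in> Lp_space p \<Omega>"
  shows "integrable (lebesgue_on \<Omega>) u"
proof -
  have um: "u \<in> borel_measurable (lebesgue_on \<Omega>)" and up: "integrable (lebesgue_on \<Omega>) (\<lambda>z. norm (u z) powr p)"
    using u by (auto simp: Lp_space_def)
  have "\<Omega> \<in> lmeasurable" using \<Omega> by (simp add: lmeasurable_open)
  then have one: "integrable (lebesgue_on \<Omega>) (\<lambda>_. 1 :: real)"
    by (intro finite_measure.integrable_const finite_measure_lebesgue_on)
  show ?thesis
  proof (rule Bochner_Integration.integrable_bound[OF Bochner_Integration.integrable_add[OF one up] um])
    have "norm (u z) \<le> norm (1 + norm (u z) powr p)" for z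
    proof (cases "norm (u z) \<le> 1")
      case True
      have "norm (u z) \<le> 1 + norm (u z) powr p" by (rule order_trans[OF True]) simp
      then show ?thesis by simp
    next
      case False
      then have "norm (u z) powr 1 \<le> norm (u z) powr p" using p by (intro powr_mono) simp_all
      then show ?thesis by simp
    qed
    then show "AE z in lebesgue_on \<Omega>. norm (u z) \<le> norm (1 + norm (u z) powr p)" by simp
  qed
qed

lemma representative_locally_integrable:
  assumes \<Omega>: "open \<Omega>" and u: "integrable (lebesgue_on \<Omega>) u"
    and u' [measurable]: "u' \<in> borel_measurable borel" and ae: "AE z in lborel. z \<in> \<Omega> \<longrightarrow> u z = u' z"
  shows "locally_integrable \<Omega> u'"
proof -
  have Om [measurable]: "\<Omega> \<in> sets borel" using \<Omega> by simp
  have 1: "integrable lebesgue (\<lambda>z. indicator \<Omega> z *\<^sub>R u z)"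
    using u \<Omega> by (subst (asm) integrable_restrict_space) simp_all
  have m: "(\<lambda>z. indicator \<Omega> z *\<^sub>R u' z) \<in> borel_measurable lborel" by measurable
  have "integrable lebesgue (\<lambda>z. indicator \<Omega> z *\<^sub>R u' z)"
  proof (rule integrable_cong_AE_imp[OF 1 measurable_completion[OF m]])
    show "AE z in lebesgue. indicator \<Omega> z *\<^sub>R u z = indicator \<Omega> z *\<^sub>R u' z"
      using AE_completion[OF ae] by eventually_elim (auto simp: indicator_def)
  qed
  then have 2: "integrable lborel (\<lambda>z. indicator \<Omega> z *\<^sub>R u' z)"
    using integrable_completion[OF m] by simp
  show ?thesis
    unfolding locally_integrable_def
  proof (intro allI impI, elim conjE)
    fix K assume K: "compact K" "K \<subseteq> \<Omega>"
    have "integrable lborel (\<lambda>z. indicator K z *\<^sub>R (indicator \<Omega> z *\<^sub>R u' z))"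
      by (rule integrable_mult_indicator[OF _ 2]) (use K in \<open>simp add: borel_compact\<close>)
    also have "(\<lambda>z. indicator K z *\<^sub>R (indicator \<Omega> z *\<^sub>R u' z)) = (\<lambda>z. indicator K z *\<^sub>R u' z)"
      by (rule ext) (use K(2) in \<open>auto simp: indicator_def\<close>)
    finally show "integrable lborel (\<lambda>z. indicator K z *\<^sub>R u' z)" .
  qed
qed

section \<open>Splitting the bicomplex equation into complex components\<close>

lemma vekua_coeff_eq:
  "vekua_coeff f z = BC (dir_deriv 1 f z / (2 * f z)) (dir_deriv \<i> f z / (2 * f z))"
proof -
  have "dir_deriv e (\<lambda>w. 0) z = 0" for e
    by (rule dir_deriv_eq_0[of UNIV]) simp_all
  then have "bc_dbar (\<lambda>w. bc_of_complex (f w)) z = BC (dir_deriv 1 f z / 2) (dir_deriv \<i> f z / 2)"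
    by (simp add: bc_dbar_def bc_dir_deriv_def bc_of_complex_def bc_j_def bicomplex_ring_defs)
  then show ?thesis
    unfolding vekua_coeff_def by (simp add: bc_divide_of_complex)
qed

text \<open>The cases \<open>s = 1\<close> and \<open>s = -1\<close> are the substitutions j -> \<i>
  and j -> -\<i>.\<close>

lemma weak_dbar_components:
  assumes w: "weak_dbar \<Omega> W V" and \<phi>: "\<phi> \<in> test_space \<Omega>" and s: "s * s = 1"
  shows "(LINT z|lebesgue_on \<Omega>. (Sc (W z) + s * \<i> * Vec (W z)) * ((dir_deriv 1 \<phi> z + s * \<i> * dir_deriv \<i> \<phi> z) / 2))
    = - (LINT z|lebesgue_on \<Omega>. (Sc (V z) + s * \<i> * Vec (V z)) * \<phi> z)"
proof -
  have sm: "\<And>k. \<phi> \<in> Ck_space k UNIV" using \<phi> by (simp add: test_space_def)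
  \<comment> \<open>A multiple of the idempotent (1 - s \<i> j) / 2, on which j acts as
    multiplication by \<open>s * \<i>\<close>. The scalar part of a product with
    \<open>\<Phi>\<close> is therefore the image of the other factor times
    \<open>\<phi>\<close>.\<close>
  define \<Phi> where "\<Phi> z = BC (\<phi> z) ((- s * \<i>) * \<phi> z)" for z
  have "\<Phi> \<in> bc_space (test_space \<Omega>)"
    unfolding bc_space_def \<Phi>_def using \<phi> test_space_cmult[OF \<phi>, of "- s * \<i>"] by simp
  then have eq: "bc_integral \<Omega> (\<lambda>z. W z * bc_dbar \<Phi> z) = - bc_integral \<Omega> (\<lambda>z. V z * \<Phi> z)"
    using w by (simp add: weak_dbar_def)
  have dd: "bc_dir_deriv e \<Phi> z = BC (dir_deriv e \<phi> z) ((- s * \<i>) * dir_deriv e \<phi> z)" for e z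
    unfolding bc_dir_deriv_def \<Phi>_def bicomplex.sel
    by (simp only: dir_deriv_cmult[OF smooth_differentiable[OF sm]])
  define d where "d z = (dir_deriv 1 \<phi> z + s * \<i> * dir_deriv \<i> \<phi> z) / 2" for z
  have db: "bc_dbar \<Phi> z = BC (d z) ((- s * \<i>) * d z)" for z
  proof -
    have "s * (s * x) = x" for x using s by (simp add: mult.assoc[symmetric])
    then show ?thesis
      unfolding bc_dbar_def dd
      by (simp add: d_def bc_of_complex_def bc_j_def bicomplex_ring_defs algebra_simps add_divide_distrib diff_divide_distrib)
  qed
  have sW: "Sc (W z * bc_dbar \<Phi> z) = (Sc (W z) + s * \<i> * Vec (W z)) * d z" for z
    by (simp add: db bicomplex_ring_defs algebra_simps)
  have sV: "Sc (V z * \<Phi> z) = (Sc (V z) + s * \<i> * Vec (V z)) * \<phi> z" for z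
    by (simp add: \<Phi>_def bicomplex_ring_defs algebra_simps)
  have "Sc (bc_integral \<Omega> (\<lambda>z. W z * bc_dbar \<Phi> z)) = - Sc (bc_integral \<Omega> (\<lambda>z. V z * \<Phi> z))"
    unfolding eq by (simp add: uminus_bicomplex_def)
  then show ?thesis
    unfolding bc_integral_def bicomplex.sel sW sV d_def .
qed

lemma Ck1_local:
  assumes "\<And>x. x \<in> \<Omega> \<Longrightarrow> \<exists>r>0. g \<in> Ck_space (Suc 0) (ball x r)"
  shows "g \<in> Ck_space (Suc 0) \<Omega>"
proof -
  have "g differentiable (at x) \<and> isCont (dir_deriv 1 g) x \<and> isCont (dir_deriv \<i> g) x" if x: "x \<in> \<Omega>" for x
  proof -
    obtain r where r: "r > 0" "g \<in> Ck_space (Suc 0) (ball x r)" using assms[OF x] by blast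
    have xb: "x \<in> ball x r" using r(1) by simp
    have "continuous_on (ball x r) (dir_deriv 1 g)" "continuous_on (ball x r) (dir_deriv \<i> g)"
      using Ck_space_dir_deriv[OF r(2)] by simp_all
    moreover have "g differentiable (at x)" using r(2) xb unfolding Ck_Suc_iff by blast
    ultimately show ?thesis using xb by (simp add: continuous_on_eq_continuous_at)
  qed
  then show ?thesis
    unfolding Ck_Suc_iff Ck_space.simps(1) mem_Collect_eq
    by (blast intro: continuous_at_imp_continuous_on)
qed

lemma hoelder_cnj: "hoelder_on S g \<Longrightarrow> hoelder_on S (\<lambda>z. cnj (g z))"
  by (simp add: hoelder_on_def flip: complex_cnj_diff)

lemma locally_hoelder_continuous:
  assumes "\<And>x. x \<in> \<Omega> \<Longrightarrow> \<exists>r>0. cball x r \<subseteq> \<Omega> \<and> hoelder_on (cball x r) G"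
  shows "continuous_on \<Omega> G"
proof (rule continuous_at_imp_continuous_on, rule ballI)
  fix x assume "x \<in> \<Omega>"
  then obtain r where r: "r > 0" "hoelder_on (cball x r) G" using assms by blast
  have "continuous_on (ball x r) G"
    by (rule continuous_on_subset[OF hoelder_imp_continuous_on[OF r(2)] ball_subset_cball])
  then show "isCont G x" using r(1) by (simp add: continuous_on_eq_continuous_at)
qed

lemma vekua_system_C1_global:
  assumes \<Omega>: "open \<Omega>" and f: "f \<in> Ck_space (Suc 0) \<Omega>" and nz: "\<And>z. z \<in> \<Omega> \<Longrightarrow> f z \<noteq> 0"
    and hA: "\<And>x. x \<in> \<Omega> \<Longrightarrow> \<exists>r>0. cball x r \<subseteq> \<Omega> \<and> hoelder_on (cball x r) A"
    and hB: "\<And>x. x \<in> \<Omega> \<Longrightarrow> \<exists>r>0. cball x r \<subseteq> \<Omega> \<and> hoelder_on (cball x r) B"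
    and weak: "weak_cdbar \<Omega> A (\<lambda>z. cdbar f z / f z * cnj (B z))"
  shows "A \<in> Ck_space (Suc 0) \<Omega>" "\<And>x. x \<in> \<Omega> \<Longrightarrow> cdbar A x = cdbar f x / f x * cnj (B x)"
proof -
  have loc: "\<exists>r>0. A \<in> Ck_space (Suc 0) (ball x r) \<and> cdbar A x = cdbar f x / f x * cnj (B x)" if x: "x \<in> \<Omega>" for x
  proof -
    obtain r where r: "r > 0" "cball x r \<subseteq> \<Omega>" "hoelder_on (cball x r) A" using hA[OF x] by blast
    obtain s where s: "s > 0" "cball x s \<subseteq> \<Omega>" "hoelder_on (cball x s) B" using hB[OF x] by blast
    define t where "t = min r s"
    have t: "t > 0" "cball x t \<subseteq> cball x r" "cball x t \<subseteq> cball x s" using r s by (auto simp: t_def)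
    have tO: "cball x t \<subseteq> \<Omega>" using t(2) r(2) by (rule order_trans)
    note C1 = vekua_system_C1[OF \<Omega> f nz t(1) tO locally_hoelder_continuous[OF hA] locally_hoelder_continuous[OF hB]
        hoelder_on_subset[OF r(3) t(2)] hoelder_cnj[OF hoelder_on_subset[OF s(3) t(3)]] weak]
    have "A \<in> Ck_space (Suc 0) (ball x t)" by (rule C1(1))
    moreover have "cdbar A x = cdbar f x / f x * cnj (B x)" by (rule C1(2)) (use t(1) in simp_all)
    ultimately show ?thesis using t(1) by blast
  qed
  show "A \<in> Ck_space (Suc 0) \<Omega>" by (rule Ck1_local) (use loc in blast)
  show "cdbar A x = cdbar f x / f x * cnj (B x)" if "x \<in> \<Omega>" for x using loc[OF that] by blast
qed

lemma Ck1_lin: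
  assumes g: "g \<in> Ck_space (Suc 0) \<Omega>" and h: "h \<in> Ck_space (Suc 0) \<Omega>"
  shows "(\<lambda>z. a * g z + b * h z) \<in> Ck_space (Suc 0) \<Omega>"
proof (rule Ck1_intro[OF has_derivative_add[OF has_derivative_mult_right[OF Ck_Suc_has_derivative[OF g]]
        has_derivative_mult_right[OF Ck_Suc_has_derivative[OF h]]]])
  have c: "continuous_on \<Omega> (dir_deriv 1 g)" "continuous_on \<Omega> (dir_deriv \<i> g)"
    "continuous_on \<Omega> (dir_deriv 1 h)" "continuous_on \<Omega> (dir_deriv \<i> h)"
    using Ck_space_dir_deriv[OF g] Ck_space_dir_deriv[OF h] by simp_all
  show "continuous_on \<Omega> (\<lambda>z. a * (of_real (Re 1) * dir_deriv 1 g z + of_real (Im 1) * dir_deriv \<i> g z)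
      + b * (of_real (Re 1) * dir_deriv 1 h z + of_real (Im 1) * dir_deriv \<i> h z))"
    by (intro continuous_on_mult continuous_on_add continuous_on_const c)
  show "continuous_on \<Omega> (\<lambda>z. a * (of_real (Re \<i>) * dir_deriv 1 g z + of_real (Im \<i>) * dir_deriv \<i> g z)
      + b * (of_real (Re \<i>) * dir_deriv 1 h z + of_real (Im \<i>) * dir_deriv \<i> h z))"
    by (intro continuous_on_mult continuous_on_add continuous_on_const c)
qed

lemma weak_cdbar_transfer:
  assumes \<Omega>: "open \<Omega>" and k: "continuous_on \<Omega> k"
    and m: "F \<in> borel_measurable (lebesgue_on \<Omega>)" "H \<in> borel_measurable (lebesgue_on \<Omega>)"
    and m': "A \<in> borel_measurable borel" "B \<in> borel_measurable borel"
    and ae: "AE z in lborel. z \<in> \<Omega> \<longrightarrow> F z = A z" "AE z in lborel. z \<in> \<Omega> \<longrightarrow> H z = k z * cnj (B z)"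
    and w: "\<And>\<phi>. \<phi> \<in> test_space \<Omega> \<Longrightarrow>
      (LINT z|lebesgue_on \<Omega>. F z * cdbar \<phi> z) = - (LINT z|lebesgue_on \<Omega>. H z * \<phi> z)"
  shows "weak_cdbar \<Omega> A (\<lambda>z. k z * cnj (B z))"
  unfolding weak_cdbar_def
proof
  fix \<phi> assume \<phi>: "\<phi> \<in> test_space \<Omega>"
  have sm: "\<And>k. \<phi> \<in> Ck_space k UNIV" using \<phi> by (simp add: test_space_def)
  note c\<phi> = smooth_continuous[OF sm] smooth_continuous[OF cdbar_smooth[OF sm]]
  have OL: "\<Omega> \<in> sets lebesgue" using \<Omega> by simp
  let ?H' = "\<lambda>z. (indicator \<Omega> z *\<^sub>R k z) * cnj (B z)"
  have H'm: "?H' \<in> borel_measurable borel"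
    by (intro borel_measurable_times borel_measurable_continuous_on_indicator k measurable_compose[OF m'(2)]
        borel_measurable_continuous_onI continuous_on_cnj continuous_on_id) (simp add: \<Omega>)
  have ae': "AE z in lborel. z \<in> \<Omega> \<longrightarrow> H z = ?H' z"
    using ae(2) by eventually_elim simp
  have "(LINT z|lborel. A z * cdbar \<phi> z) = (LINT z|lebesgue_on \<Omega>. F z * cdbar \<phi> z)"
    by (rule lebesgue_on_integral_transfer[symmetric, OF OL m(1) m'(1) c\<phi>(2) cdbar_test_space_eq_0(2)[OF \<phi>] ae(1)])
  also have "\<dots> = - (LINT z|lebesgue_on \<Omega>. H z * \<phi> z)" by (rule w[OF \<phi>])
  also have "(LINT z|lebesgue_on \<Omega>. H z * \<phi> z) = (LINT z|lborel. ?H' z * \<phi> z)"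
    by (rule lebesgue_on_integral_transfer[OF OL m(2) H'm c\<phi>(1) cdbar_test_space_eq_0(1)[OF \<phi>] ae'])
  also have "\<dots> = (LINT z|lborel. k z * cnj (B z) * \<phi> z)"
    by (rule Bochner_Integration.integral_cong[OF refl])
      (use cdbar_test_space_eq_0(1)[OF \<phi>] in \<open>auto simp: indicator_def\<close>)
  finally show "(LINT z|lborel. A z * cdbar \<phi> z) = - (LINT z|lborel. k z * cnj (B z) * \<phi> z)" .
qed

theorem corollary41:
  fixes \<Omega> :: "complex set" and p :: real and f :: "complex \<Rightarrow> complex"
  assumes "open \<Omega>" and "connected \<Omega>" and "\<Omega> \<noteq> {}" and "bounded \<Omega>" and "simply_connected \<Omega>"
    and "1 < p"
    and "\<And>z. z \<in> \<Omega> \<Longrightarrow> f z \<noteq> 0"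
    and "(\<lambda>z. 1 / f z) \<in> Linf_space \<Omega>"
    and "f \<in> Ck_space 1 \<Omega> \<inter> W1inf_space \<Omega>"
  shows "\<forall>W\<in>vekua_space p f \<Omega>. \<exists>G\<in>bc_space (Ck_space 1 \<Omega>).
           (AE z in lebesgue_on \<Omega>. W z = G z) \<and>
           (\<forall>z\<in>\<Omega>. bc_dbar G z - vekua_coeff f z * bc_cnj (G z) = 0)"
proof
  fix W assume W: "W \<in> vekua_space p f \<Omega>"
  note \<Omega> = assms(1) and nz = assms(7)
  have OL: "\<Omega> \<in> sets lebesgue" using \<Omega> by simp
  have f: "f \<in> Ck_space (Suc 0) \<Omega>" using assms(9) by simp
  \<comment> \<open>The equation for \<open>B\<close> has the same form as that for
    \<open>A\<close>, with \<open>cnj f\<close> in place of \<open>f\<close> and the unknowns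
    exchanged, so the regularity result for the system applies twice.\<close>
  define fc where "fc z = cnj (f z)" for z
  have fc: "fc \<in> Ck_space (Suc 0) \<Omega>" unfolding fc_def[abs_def] by (rule bounded_linear_Ck1[OF bounded_linear_cnj f])
  have nzc: "fc z \<noteq> 0" if "z \<in> \<Omega>" for z using nz[OF that] by (simp add: fc_def)
  define a where "a z = cdbar f z / f z" for z
  define b where "b z = cdbar fc z / fc z" for z
  have fd: "f differentiable (at z)" if "z \<in> \<Omega>" for z using f that by (auto simp: Ck_Suc_iff)
  have cc: "continuous_on \<Omega> (\<lambda>z. cdbar g z / g z)" if g: "g \<in> Ck_space (Suc 0) \<Omega>" and g0: "\<And>z. z \<in> \<Omega> \<Longrightarrow> g z \<noteq> 0" for g
    unfolding cdbar_def
    using Ck_space_SucD[OF g] Ck_space_dir_deriv[OF g] g0 by (intro continuous_intros) simp_all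
  have ca: "continuous_on \<Omega> a" unfolding a_def[abs_def] by (rule cc[OF f nz])
  have cb: "continuous_on \<Omega> b" unfolding b_def[abs_def] by (rule cc[OF fc nzc])
  define V where "V z = vekua_coeff f z * bc_cnj (W z)" for z
  have wk: "weak_dbar \<Omega> W V" and WL: "(\<lambda>z. Sc (W z)) \<in> Lp_space p \<Omega>" "(\<lambda>z. Vec (W z)) \<in> Lp_space p \<Omega>"
    using W unfolding vekua_space_def bc_space_def V_def[abs_def] by simp_all
  have Vm: "(\<lambda>z. Sc (V z)) \<in> borel_measurable (lebesgue_on \<Omega>)" "(\<lambda>z. Vec (V z)) \<in> borel_measurable (lebesgue_on \<Omega>)"
    using wk unfolding weak_dbar_def bc_space_def L1loc_space_def by simp_all
  define A0 where "A0 z = Sc (W z) + \<i> * Vec (W z)" for z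
  \<comment> \<open>Under j -> -\<i> the operator becomes the conjugate one; conjugating the
    component restores \<open>cdbar\<close>, so one transform serves both equations.\<close>
  define B0 where "B0 z = cnj (Sc (W z) - \<i> * Vec (W z))" for z
  have iSV: "integrable (lebesgue_on \<Omega>) (\<lambda>z. Sc (W z))" "integrable (lebesgue_on \<Omega>) (\<lambda>z. Vec (W z))"
    by (rule Lp_space_integrable[OF \<Omega> assms(4,6)], rule WL)+
  have iA: "integrable (lebesgue_on \<Omega>) A0"
    unfolding A0_def[abs_def] by (intro Bochner_Integration.integrable_add integrable_mult_right iSV)
  have iB: "integrable (lebesgue_on \<Omega>) B0"
    unfolding B0_def[abs_def]
    by (intro integrable_bounded_linear[OF bounded_linear_cnj] Bochner_Integration.integrable_diff integrable_mult_right iSV)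
  note mAB = borel_measurable_integrable[OF iA] borel_measurable_integrable[OF iB]
  obtain A where A: "A \<in> borel_measurable borel" "AE z in lborel. z \<in> \<Omega> \<longrightarrow> A0 z = A z"
    by (rule lebesgue_on_borel_representative[OF mAB(1) OL]) (rule that)
  obtain B where B: "B \<in> borel_measurable borel" "AE z in lborel. z \<in> \<Omega> \<longrightarrow> B0 z = B z"
    by (rule lebesgue_on_borel_representative[OF mAB(2) OL]) (rule that)
  have loc: "locally_integrable \<Omega> A" "locally_integrable \<Omega> B"
    by (rule representative_locally_integrable[OF \<Omega> iA A], rule representative_locally_integrable[OF \<Omega> iB B])
  have Vp: "Sc (V z) + \<i> * Vec (V z) = a z * cnj (B0 z)" if z: "z \<in> \<Omega>" for z
    using nz[OF z]
    by (simp add: V_def vekua_coeff_eq bc_cnj_def bicomplex_ring_defs a_def B0_def cdbar_def field_simps)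
  have Vn: "cnj (Sc (V z) - \<i> * Vec (V z)) = b z * cnj (A0 z)" if z: "z \<in> \<Omega>" for z
    using nz[OF z] dir_deriv_cnj[OF fd[OF z]]
    by (simp add: V_def vekua_coeff_eq bc_cnj_def bicomplex_ring_defs b_def A0_def cdbar_def fc_def[abs_def] field_simps)
  have wA: "weak_cdbar \<Omega> A (\<lambda>z. a z * cnj (B z))"
  proof (rule weak_cdbar_transfer[OF \<Omega> ca mAB(1) _ A(1) B(1) A(2)])
    show "(\<lambda>z. Sc (V z) + \<i> * Vec (V z)) \<in> borel_measurable (lebesgue_on \<Omega>)"
      by (intro borel_measurable_add borel_measurable_times borel_measurable_const Vm)
    show "AE z in lborel. z \<in> \<Omega> \<longrightarrow> Sc (V z) + \<i> * Vec (V z) = a z * cnj (B z)"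
      using B(2) by eventually_elim (simp add: Vp)
    show "(LINT z|lebesgue_on \<Omega>. A0 z * cdbar \<phi> z) = - (LINT z|lebesgue_on \<Omega>. (Sc (V z) + \<i> * Vec (V z)) * \<phi> z)"
      if "\<phi> \<in> test_space \<Omega>" for \<phi>
      using weak_dbar_components[OF wk that, of 1] by (simp add: A0_def cdbar_def)
  qed
  have wB: "weak_cdbar \<Omega> B (\<lambda>z. b z * cnj (A z))"
  proof (rule weak_cdbar_transfer[OF \<Omega> cb mAB(2) _ B(1) A(1) B(2)])
    have m: "(\<lambda>z. Sc (V z) - \<i> * Vec (V z)) \<in> borel_measurable (lebesgue_on \<Omega>)"
      by (intro borel_measurable_diff borel_measurable_times borel_measurable_const Vm)
    show "(\<lambda>z. cnj (Sc (V z) - \<i> * Vec (V z))) \<in> borel_measurable (lebesgue_on \<Omega>)"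
      by (intro measurable_compose[OF m] borel_measurable_continuous_onI continuous_on_cnj continuous_on_id)
    show "AE z in lborel. z \<in> \<Omega> \<longrightarrow> cnj (Sc (V z) - \<i> * Vec (V z)) = b z * cnj (A z)"
      using A(2)
    proof eventually_elim
      case (elim z)
      show ?case
      proof
        assume z: "z \<in> \<Omega>"
        then have "A0 z = A z" using elim by blast
        then show "cnj (Sc (V z) - \<i> * Vec (V z)) = b z * cnj (A z)"
          using Vn[OF z] by (simp only:)
      qed
    qed
    \<comment> \<open>Testing the component j -> -\<i> with \<open>cnj \<phi>\<close> produces the
      conjugate of \<open>cdbar \<phi>\<close>; conjugating both integrals gives the required
      identity.\<close>
    fix \<phi> assume \<phi>: "\<phi> \<in> test_space \<Omega>"
    then have d: "\<phi> differentiable (at z)" for z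
      by (intro smooth_differentiable) (simp add: test_space_def)
    have "(LINT z|lebesgue_on \<Omega>. (Sc (W z) - \<i> * Vec (W z)) * cnj (cdbar \<phi> z))
        = - (LINT z|lebesgue_on \<Omega>. (Sc (V z) - \<i> * Vec (V z)) * cnj (\<phi> z))"
      using weak_dbar_components[OF wk test_space_cnj[OF \<phi>], of "-1"]
      by (simp add: dir_deriv_cnj[OF d] cdbar_def)
    then have e: "cnj (LINT z|lebesgue_on \<Omega>. (Sc (W z) - \<i> * Vec (W z)) * cnj (cdbar \<phi> z))
        = - cnj (LINT z|lebesgue_on \<Omega>. (Sc (V z) - \<i> * Vec (V z)) * cnj (\<phi> z))"
      by simp
    have "cnj (LINT z|lebesgue_on \<Omega>. (Sc (W z) - \<i> * Vec (W z)) * cnj (cdbar \<phi> z))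
        = (LINT z|lebesgue_on \<Omega>. B0 z * cdbar \<phi> z)"
      by (subst Bochner_Integration.integral_cnj[symmetric]) (simp add: B0_def)
    moreover have "cnj (LINT z|lebesgue_on \<Omega>. (Sc (V z) - \<i> * Vec (V z)) * cnj (\<phi> z))
        = (LINT z|lebesgue_on \<Omega>. cnj (Sc (V z) - \<i> * Vec (V z)) * \<phi> z)"
      by (subst Bochner_Integration.integral_cnj[symmetric]) simp
    ultimately
    show "(LINT z|lebesgue_on \<Omega>. B0 z * cdbar \<phi> z) = - (LINT z|lebesgue_on \<Omega>. cnj (Sc (V z) - \<i> * Vec (V z)) * \<phi> z)"
      using e by (simp only:)
  qed
  obtain GA where GA: "\<And>x. x \<in> \<Omega> \<Longrightarrow> \<exists>r>0. cball x r \<subseteq> \<Omega> \<and> hoelder_on (cball x r) GA"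
    "AE z in lborel. z \<in> \<Omega> \<longrightarrow> A z = GA z"
    by (rule weak_vekua_system_hoelder[OF \<Omega> ca cb A(1) B(1) loc wA wB]) (rule that)
  obtain GB where GB: "\<And>x. x \<in> \<Omega> \<Longrightarrow> \<exists>r>0. cball x r \<subseteq> \<Omega> \<and> hoelder_on (cball x r) GB"
    "AE z in lborel. z \<in> \<Omega> \<longrightarrow> B z = GB z"
    by (rule weak_vekua_system_hoelder[OF \<Omega> cb ca B(1) A(1) loc(2,1) wB wA]) (rule that)
  have cG: "continuous_on \<Omega> GA" "continuous_on \<Omega> GB"
    by (rule locally_hoelder_continuous, erule GA(1), rule locally_hoelder_continuous, erule GB(1))
  have wGA: "weak_cdbar \<Omega> GA (\<lambda>z. cdbar f z / f z * cnj (GB z))"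
    using weak_cdbar_cong_AE[OF \<Omega> wA ca A(1) B(1) cG GA(2) GB(2)] unfolding a_def .
  have wGB: "weak_cdbar \<Omega> GB (\<lambda>z. cdbar fc z / fc z * cnj (GA z))"
    using weak_cdbar_cong_AE[OF \<Omega> wB cb B(1) A(1) cG(2,1) GB(2) GA(2)] unfolding b_def .
  have GA1: "GA \<in> Ck_space (Suc 0) \<Omega>"
    by (rule vekua_system_C1_global(1)[OF \<Omega> f nz GA(1) GB(1) wGA])
  have GAd: "cdbar GA z = a z * cnj (GB z)" if "z \<in> \<Omega>" for z
    unfolding a_def by (rule vekua_system_C1_global(2)[OF \<Omega> f nz GA(1) GB(1) wGA]) (use that in simp_all)
  have GB1: "GB \<in> Ck_space (Suc 0) \<Omega>"
    by (rule vekua_system_C1_global(1)[OF \<Omega> fc nzc GB(1) GA(1) wGB])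
  have GBd: "cdbar GB z = b z * cnj (GA z)" if "z \<in> \<Omega>" for z
    unfolding b_def by (rule vekua_system_C1_global(2)[OF \<Omega> fc nzc GB(1) GA(1) wGB]) (use that in simp_all)
  have GBc: "(\<lambda>z. cnj (GB z)) \<in> Ck_space (Suc 0) \<Omega>"
    by (rule bounded_linear_Ck1[OF bounded_linear_cnj GB1])
  \<comment> \<open>The inverse of the passage to components, which are Sc + \<i> Vec for
    \<open>GA\<close> and Sc - \<i> Vec for \<open>cnj (GB z)\<close>.\<close>
  define G where "G z = BC ((1/2) * GA z + (1/2) * cnj (GB z)) ((- \<i>/2) * GA z + (\<i>/2) * cnj (GB z))" for z
  show "\<exists>G\<in>bc_space (Ck_space 1 \<Omega>). (AE z in lebesgue_on \<Omega>. W z = G z) \<and>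
      (\<forall>z\<in>\<Omega>. bc_dbar G z - vekua_coeff f z * bc_cnj (G z) = 0)"
  proof (intro bexI[of _ G] conjI ballI)
    show "G \<in> bc_space (Ck_space 1 \<Omega>)"
      unfolding bc_space_def G_def[abs_def] mem_Collect_eq bicomplex.sel One_nat_def
      by (intro conjI Ck1_lin GA1 GBc)
    have "AE z in lborel. z \<in> \<Omega> \<longrightarrow> W z = G z"
      using A(2) B(2) GA(2) GB(2)
    proof eventually_elim
      case (elim z)
      show ?case
      proof
        assume z: "z \<in> \<Omega>"
        have 1: "GA z = Sc (W z) + \<i> * Vec (W z)" using elim(1,3) z by (simp add: A0_def)
        have "GB z = cnj (Sc (W z) - \<i> * Vec (W z))" using elim(2,4) z by (simp add: B0_def)
        then have 2: "cnj (GB z) = Sc (W z) - \<i> * Vec (W z)" by simp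
        show "W z = G z"
          unfolding G_def 1 2 bicomplex_eq_iff bicomplex.sel by (simp add: algebra_simps)
      qed
    qed
    then show "AE z in lebesgue_on \<Omega>. W z = G z"
      using OL by (subst AE_restrict_space_iff) (simp_all add: AE_completion)
    fix z assume z: "z \<in> \<Omega>"
    have dA: "GA differentiable (at z)" and dB: "GB differentiable (at z)" and dBc: "(\<lambda>z. cnj (GB z)) differentiable (at z)"
      using GA1 GB1 GBc z by (auto simp: Ck_Suc_iff)
    \<comment> \<open>The defect in the classical equation. Its images under j -> \<i> and j ->
      -\<i> both vanish, and together they determine its two parts.\<close>
    define s where "s = bc_dbar G z - vekua_coeff f z * bc_cnj (G z)"
    have dG: "bc_dir_deriv e G z = BC ((1/2) * dir_deriv e GA z + (1/2) * cnj (dir_deriv e GB z))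
        ((- \<i>/2) * dir_deriv e GA z + (\<i>/2) * cnj (dir_deriv e GB z))" for e
      unfolding bc_dir_deriv_def G_def bicomplex.sel
      by (simp only: dir_deriv_lin[OF dA dBc] dir_deriv_cnj[OF dB])
    have "Sc s + \<i> * Vec s = cdbar GA z - a z * cnj (GB z)"
      using nz[OF z] unfolding s_def bc_dbar_def dG
      by (simp add: G_def vekua_coeff_eq bc_cnj_def bc_of_complex_def bc_j_def bicomplex_ring_defs a_def cdbar_def field_simps)
    then have p: "Sc s + \<i> * Vec s = 0" using GAd[OF z] by simp
    have "Sc s - \<i> * Vec s = cnj (cdbar GB z - b z * cnj (GA z))"
      using nz[OF z] dir_deriv_cnj[OF fd[OF z]] unfolding s_def bc_dbar_def dG
      by (simp add: G_def vekua_coeff_eq bc_cnj_def bc_of_complex_def bc_j_def bicomplex_ring_defs b_def fc_def[abs_def] cdbar_def field_simps)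
    then have m: "Sc s - \<i> * Vec s = 0" using GBd[OF z] by simp
    have "Sc s = ((Sc s + \<i> * Vec s) + (Sc s - \<i> * Vec s)) / 2"
      "Vec s = ((Sc s + \<i> * Vec s) - (Sc s - \<i> * Vec s)) / (2 * \<i>)" by simp_all
    then have "Sc s = 0" "Vec s = 0" unfolding p m by simp_all
    then show "bc_dbar G z - vekua_coeff f z * bc_cnj (G z) = 0"
      unfolding s_def[symmetric] by (simp add: bicomplex_eq_iff zero_bicomplex_def)
  qed
qed

end
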